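(* Let $a,b,c\ge 0$ be integers, $S\in PP(a,b,c)$, and let $H_+$, $L=\mathbb Z^{H_+}$, $A_S$, $A'_S$ and the $L$-grading of $A'_S$ be as defined in the context. Let $L_S\subseteq L$ be the set of $L$-degrees of monomials occurring in $A'_S$, and $L_S^\perp\subseteq L$ its orthogonal for the dot product on $L$ for which the basis vectors indexed by $H_+$ are orthonormal. Then: (1) $\dim L=ab+ac+bc+a+b+c+1$. (2) $L_S$ is a cone (i.e. closed under addition), and $A'_S$ is its monoid algebra, a domain of dimension $\dim L_S$. (3) $f\in L_S^\perp$ if and only if $f$ is constant on the regions of $S\cup\{\text{all horizontal edges}\}$. (4) Hence $\dim L_S^\perp=a+1$ and $\dim L_S=ab+ac+bc+b+c$. (5) $A'_S$ and $A_S$ are complete intersections, of degree $2^{bc}$.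
   Context: $[m]=\{1,\dots,m\}$. $PP(a,b,c)$ is the set of $a$-tuples $S=(s_1\le\dots\le s_a)$ of subsets $s_\ell=\{s_{\ell,1}<\dots<s_{\ell,b}\}\in\binom{[b+c]}{b}$, with $\le$ the pointwise order. $S$ encodes a lozenge tiling of a hexagon with sides $a,b,c,a,b,c$ (equivalently a dimer configuration on the dual honeycomb graph), whose lozenges (dimers) have the following coordinates. - Type $C$: the pairs $(j,k)=(s_{\ell,m},\,s_{\ell,m}+\ell-m)$, $\ell\in[a]$, $m\in[b]$. - Type $B$: the pairs $(i,j)$ with $j\in[b+c]\setminus s_\ell$ and $i=a-\ell+1+\#\{m: s_{\ell,m}<j\}$, $\ell\in[a]$. - Type $BC$: the pairs $(i,k)\in[a+b]\times[a+c]$ with $a+2\le i+k\le a+b+c$ such that $(i,i+k-a-1)$ is not of type $B$ in $S$ and $(i+k-a-1,k)$ is not of type $C$ in $S$. There are $ac$, $ab$, $bc$ of these respectively. $A_S$ is the quotient of $\mathbb C[B_{i,j},C_{j,k},\star_{i,k}]$ ($i\in[a+b]$, $j\in[b+c]$, $k\in[a+c]$) by the ideal generated by: $B_{i,j}$ for $(i,j)$ of type $B$ in $S$; $C_{j,k}$ for $(j,k)$ of type $C$ in $S$; and $B_{i,i+k-a-1}C_{i+k-a-1,k}+B_{i,i+k-a}C_{i+k-a,k}$ for $(i,k)$ of type $BC$ in $S$. Hexagons: $H_+$ is the set of (full and partial) hexagons of the honeycomb; equivalently the set of vertices of the triangular lattice in the closed $a\times b\times c$ hexagon, parametrized as $H_+=\{(p,q)\in\mathbb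 Z^2: 0\le p\le a+b,\ 0\le q\le a+c,\ a\le p+q\le a+b+c\}$. The non-horizontal edges (including half-edges on the boundary) of the honeycomb are labelled by the variables $B_{i,j}$ with $-a\le j-i\le c$, which separate the hexagon above, $(i-1,a+j-i)$, from the hexagon below, $(i,a+j-i)$; and by the variables $C_{j,k}$ with $-a\le j-k\le b$, which separate the hexagon above, $(a+j-k,k)$, from the hexagon below, $(a+j-k,k-1)$. Such a variable is called relevant if it is not of type $B$ or $C$ in $S$. $A'_S$ is the subring of $A_S$ generated by the relevant variables, which satisfy the $bc$ binomial relations above. It is $L$-graded, where the variable on an edge $\gamma$ has degree $f_\gamma\in L$, $f_\gamma=+1$ on the hexagon above $\gamma$, $-1$ on the hexagon below $\gamma$, and $0$ elsewhere. A region of $S\cup\{\text{all horizontal edges}\}$ is a connected component of the graph with vertex set $H_+$ in which two hexagons are joined when they are separated by a non-horizontal edge (or half-edge) not in $S$. $\dim L_S$ is the rank of the subgroup of $L$ generated by $L_S$; $\dim L$, $\dim L_S^\perp$ are ranks. Degrees of $A_S,A'_S$ are with respect to the standard grading in which all variables have degree $1$. *)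

theory Defs
  imports
    "HOL-Algebra.Embedded_Algebras"
    "HOL-Algebra.Generated_Rings"
    "HOL-Computational_Algebra.Polynomial"
    "HOL-Library.Poly_Mapping"
    "HOL-Library.Extended_Nat"
    "HOL-Library.FuncSet"
begin

text \<open>
  The complex monoid algebra of a submonoid \<open>M\<close> of a commutative monoid type. Elements are finitely
  supported functions with support in \<open>M\<close>, and the product is convolution.
  Polynomials are the case where the monoid consists of exponent vectors.
\<close>

definition monoid_algebra :: "'m::comm_monoid_add set \<Rightarrow> ('m \<Rightarrow>\<^sub>0 complex) ring" where
  "monoid_algebra M =
     \<lparr>carrier = {p. Poly_Mapping.keys p \<subseteq> M}, monoid.mult = (*), one = 1, zero = 0, add = (+)\<rparr>"

definition poly_ring :: "'v set \<Rightarrow> (('v \<Rightarrow>\<^sub>0 nat) \<Rightarrow>\<^sub>0 complex) ring" where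
  "poly_ring V = monoid_algebra {m. Poly_Mapping.keys m \<subseteq> V}"

definition const :: "complex \<Rightarrow> ('v \<Rightarrow>\<^sub>0 nat) \<Rightarrow>\<^sub>0 complex" where
  "const z = Poly_Mapping.single 0 z"

definition var :: "'v \<Rightarrow> ('v \<Rightarrow>\<^sub>0 nat) \<Rightarrow>\<^sub>0 complex" where
  "var v = Poly_Mapping.single (Poly_Mapping.single v 1) 1"

definition total_degree :: "('v \<Rightarrow>\<^sub>0 nat) \<Rightarrow> nat" where
  "total_degree m = (\<Sum>v\<in>Poly_Mapping.keys m. Poly_Mapping.lookup m v)"

definition krull_dim :: "('r, 'x) ring_scheme \<Rightarrow> enat" where
  "krull_dim R = Sup {enat n |n. \<exists>P. (\<forall>i\<le>n. primeideal (P i) R) \<and> (\<forall>i<n. P i \<subset> P (Suc i))}"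

text \<open>
  In the next three definitions, \<open>R\<close> is a complex algebra presented by a surjective homomorphism \<open>\<pi>\<close>
  from the polynomial ring in a finite set \<open>V\<close> of variables: \<open>Spec R\<close> is a closed subscheme of the
  affine space with coordinates \<open>V\<close>. It is a complete intersection if its ideal can be generated by as
  many elements as its codimension. As the polynomial ring is Cohen-Macaulay, such generators form a
  regular sequence locally at every point of \<open>Spec R\<close>.
\<close>

definition complete_intersection ::
  "'v set \<Rightarrow> ('r, 'x) ring_scheme \<Rightarrow> ((('v \<Rightarrow>\<^sub>0 nat) \<Rightarrow>\<^sub>0 complex) \<Rightarrow> 'r) \<Rightarrow> bool" where
  "complete_intersection V R \<pi> \<longleftrightarrow>
     (\<exists>F \<subseteq> carrier (poly_ring V). finite F \<and>
        a_kernel (poly_ring V) R \<pi> = Idl\<^bsub>poly_ring V\<^esub> F \<and>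
        krull_dim R + enat (card F) = enat (card V))"

definition hilbert_fun ::
  "'v set \<Rightarrow> ('r, 'x) ring_scheme \<Rightarrow> ((('v \<Rightarrow>\<^sub>0 nat) \<Rightarrow>\<^sub>0 complex) \<Rightarrow> 'r) \<Rightarrow> nat \<Rightarrow> nat" where
  "hilbert_fun V R \<pi> n =
     ring.dim R (\<pi> ` range const)
       (\<pi> ` {p \<in> carrier (poly_ring V). \<forall>m\<in>Poly_Mapping.keys p. total_degree m = n})"

text \<open>
  For a standard graded algebra \<open>R\<close> of dimension \<open>d\<close>, the sum of the Hilbert function over \<open>{0..n}\<close> is
  eventually a polynomial in \<open>n\<close> with leading term \<open>e n\<^sup>d / d!\<close>, where \<open>e\<close> is the degree of \<open>R\<close>.
  For \<open>d > 0\<close> this is equivalent to the Hilbert polynomial having leading term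
  \<open>e n\<^bsup>d-1\<^esup> / (d-1)!\<close>, and for \<open>d = 0\<close> it gives \<open>e\<close> as the vector space dimension of \<open>R\<close>.
\<close>

definition has_degree ::
  "'v set \<Rightarrow> ('r, 'x) ring_scheme \<Rightarrow> ((('v \<Rightarrow>\<^sub>0 nat) \<Rightarrow>\<^sub>0 complex) \<Rightarrow> 'r) \<Rightarrow> nat \<Rightarrow> bool" where
  "has_degree V R \<pi> e \<longleftrightarrow>
     (\<exists>h :: real Polynomial.poly.
        (\<forall>\<^sub>F n in sequentially. real (\<Sum>m\<le>n. hilbert_fun V R \<pi> m) = Polynomial.poly h (real n)) \<and>
        real e = fact (Polynomial.degree h) * Polynomial.lead_coeff h)"

text \<open>
  All indices and coordinates are natural numbers. No subtraction below truncates on the ranges on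
  which it is used.
\<close>

definition nth_elem :: "nat set \<Rightarrow> nat \<Rightarrow> nat" where
  "nth_elem s m = sorted_list_of_set s ! (m - 1)"

definition PP :: "nat \<Rightarrow> nat \<Rightarrow> nat \<Rightarrow> (nat \<Rightarrow> nat set) set" where
  "PP a b c =
     {S \<in> {1..a} \<rightarrow>\<^sub>E {s. s \<subseteq> {1..b + c} \<and> card s = b}.
        \<forall>l\<in>{1..a}. \<forall>l'\<in>{1..a}. l \<le> l' \<longrightarrow>
          (\<forall>m\<in>{1..b}. nth_elem (S l) m \<le> nth_elem (S l') m)}"

definition typeC :: "nat \<Rightarrow> nat \<Rightarrow> nat \<Rightarrow> (nat \<Rightarrow> nat set) \<Rightarrow> (nat \<times> nat) set" where
  "typeC a b c S =
     {(nth_elem (S l) m, nth_elem (S l) m + l - m) |l m. l \<in> {1..a} \<and> m \<in> {1..b}}"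

definition typeB :: "nat \<Rightarrow> nat \<Rightarrow> nat \<Rightarrow> (nat \<Rightarrow> nat set) \<Rightarrow> (nat \<times> nat) set" where
  "typeB a b c S =
     {(a - l + 1 + card {m \<in> {1..b}. nth_elem (S l) m < j}, j) |l j.
        l \<in> {1..a} \<and> j \<in> {1..b + c} - S l}"

definition typeBC :: "nat \<Rightarrow> nat \<Rightarrow> nat \<Rightarrow> (nat \<Rightarrow> nat set) \<Rightarrow> (nat \<times> nat) set" where
  "typeBC a b c S =
     {(i, k). i \<in> {1..a + b} \<and> k \<in> {1..a + c} \<and> a + 2 \<le> i + k \<and> i + k \<le> a + b + c \<and>
        (i, i + k - a - 1) \<notin> typeB a b c S \<and> (i + k - a - 1, k) \<notin> typeC a b c S}"

datatype edge = BVar nat nat | CVar nat nat | StarVar nat nat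

definition all_vars :: "nat \<Rightarrow> nat \<Rightarrow> nat \<Rightarrow> edge set" where
  "all_vars a b c =
     {BVar i j |i j. i \<in> {1..a + b} \<and> j \<in> {1..b + c}} \<union>
     {CVar j k |j k. j \<in> {1..b + c} \<and> k \<in> {1..a + c}} \<union>
     {StarVar i k |i k. i \<in> {1..a + b} \<and> k \<in> {1..a + c}}"

definition A_relations ::
  "nat \<Rightarrow> nat \<Rightarrow> nat \<Rightarrow> (nat \<Rightarrow> nat set) \<Rightarrow> ((edge \<Rightarrow>\<^sub>0 nat) \<Rightarrow>\<^sub>0 complex) set" where
  "A_relations a b c S =
     {var (BVar i j) |i j. (i, j) \<in> typeB a b c S} \<union>
     {var (CVar j k) |j k. (j, k) \<in> typeC a b c S} \<union>
     {var (BVar i (i + k - a - 1)) * var (CVar (i + k - a - 1) k) +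
        var (BVar i (i + k - a)) * var (CVar (i + k - a) k) |i k. (i, k) \<in> typeBC a b c S}"

definition A_ideal ::
  "nat \<Rightarrow> nat \<Rightarrow> nat \<Rightarrow> (nat \<Rightarrow> nat set) \<Rightarrow> ((edge \<Rightarrow>\<^sub>0 nat) \<Rightarrow>\<^sub>0 complex) set" where
  "A_ideal a b c S = Idl\<^bsub>poly_ring (all_vars a b c)\<^esub> (A_relations a b c S)"

definition A_ring ::
  "nat \<Rightarrow> nat \<Rightarrow> nat \<Rightarrow> (nat \<Rightarrow> nat set) \<Rightarrow> ((edge \<Rightarrow>\<^sub>0 nat) \<Rightarrow>\<^sub>0 complex) set ring" where
  "A_ring a b c S = poly_ring (all_vars a b c) Quot A_ideal a b c S"

definition cls ::
  "nat \<Rightarrow> nat \<Rightarrow> nat \<Rightarrow> (nat \<Rightarrow> nat set) \<Rightarrow> ((edge \<Rightarrow>\<^sub>0 nat) \<Rightarrow>\<^sub>0 complex) \<Rightarrow>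
     ((edge \<Rightarrow>\<^sub>0 nat) \<Rightarrow>\<^sub>0 complex) set" where
  "cls a b c S p = A_ideal a b c S +>\<^bsub>poly_ring (all_vars a b c)\<^esub> p"

definition relevant_vars :: "nat \<Rightarrow> nat \<Rightarrow> nat \<Rightarrow> (nat \<Rightarrow> nat set) \<Rightarrow> edge set" where
  "relevant_vars a b c S =
     {BVar i j |i j. i \<in> {1..a + b} \<and> j \<in> {1..b + c} \<and> i \<le> j + a \<and> j \<le> i + c \<and>
        (i, j) \<notin> typeB a b c S} \<union>
     {CVar j k |j k. j \<in> {1..b + c} \<and> k \<in> {1..a + c} \<and> k \<le> j + a \<and> j \<le> k + b \<and>
        (j, k) \<notin> typeC a b c S}"

text \<open>Subrings of complex algebras contain the constants.\<close>

definition A'_ring ::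
  "nat \<Rightarrow> nat \<Rightarrow> nat \<Rightarrow> (nat \<Rightarrow> nat set) \<Rightarrow> ((edge \<Rightarrow>\<^sub>0 nat) \<Rightarrow>\<^sub>0 complex) set ring" where
  "A'_ring a b c S =
     (A_ring a b c S)\<lparr>carrier := generate_ring (A_ring a b c S)
        (cls a b c S ` (range const \<union> var ` relevant_vars a b c S))\<rparr>"

definition hexagons :: "nat \<Rightarrow> nat \<Rightarrow> nat \<Rightarrow> (nat \<times> nat) set" where
  "hexagons a b c = {(p, q). p \<le> a + b \<and> q \<le> a + c \<and> a \<le> p + q \<and> p + q \<le> a + b + c}"

definition hex_lattice :: "nat \<Rightarrow> nat \<Rightarrow> nat \<Rightarrow> ((nat \<times> nat) \<Rightarrow>\<^sub>0 int) set" where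
  "hex_lattice a b c = {f. Poly_Mapping.keys f \<subseteq> hexagons a b c}"

global_interpretation frag: Modules.module frag_cmul
  by unfold_locales
    (simp_all add: frag_cmul_distrib frag_cmul_distrib2)

definition rank :: "('h \<Rightarrow>\<^sub>0 int) set \<Rightarrow> enat" where
  "rank G = Sup {enat (card X) |X. X \<subseteq> G \<and> finite X \<and> frag.independent X}"

text \<open>The horizontal edges \<open>StarVar i k\<close> get no hexagons: the functions are never used on them.\<close>

fun hex_above :: "nat \<Rightarrow> edge \<Rightarrow> nat \<times> nat" where
  "hex_above a (BVar i j) = (i - 1, a + j - i)"
| "hex_above a (CVar j k) = (a + j - k, k)"

fun hex_below :: "nat \<Rightarrow> edge \<Rightarrow> nat \<times> nat" where
  "hex_below a (BVar i j) = (i, a + j - i)"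
| "hex_below a (CVar j k) = (a + j - k, k - 1)"

definition edge_degree :: "nat \<Rightarrow> edge \<Rightarrow> (nat \<times> nat) \<Rightarrow>\<^sub>0 int" where
  "edge_degree a v = frag_of (hex_above a v) - frag_of (hex_below a v)"

definition mon_degree :: "nat \<Rightarrow> (edge \<Rightarrow>\<^sub>0 nat) \<Rightarrow> (nat \<times> nat) \<Rightarrow>\<^sub>0 int" where
  "mon_degree a m =
     (\<Sum>v\<in>Poly_Mapping.keys m. frag_cmul (int (Poly_Mapping.lookup m v)) (edge_degree a v))"

text \<open>A monomial occurs in the algebra when it is nonzero there.\<close>

definition L_S :: "nat \<Rightarrow> nat \<Rightarrow> nat \<Rightarrow> (nat \<Rightarrow> nat set) \<Rightarrow> ((nat \<times> nat) \<Rightarrow>\<^sub>0 int) set" where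
  "L_S a b c S =
     {mon_degree a m |m. Poly_Mapping.keys m \<subseteq> relevant_vars a b c S \<and>
        cls a b c S (Poly_Mapping.single m 1) \<noteq> \<zero>\<^bsub>A'_ring a b c S\<^esub>}"

definition L_S_perp :: "nat \<Rightarrow> nat \<Rightarrow> nat \<Rightarrow> (nat \<Rightarrow> nat set) \<Rightarrow> ((nat \<times> nat) \<Rightarrow>\<^sub>0 int) set" where
  "L_S_perp a b c S =
     {f \<in> hex_lattice a b c. \<forall>g\<in>L_S a b c S.
        (\<Sum>h\<in>hexagons a b c. Poly_Mapping.lookup f h * Poly_Mapping.lookup g h) = 0}"

definition graded_part ::
  "nat \<Rightarrow> nat \<Rightarrow> nat \<Rightarrow> (nat \<Rightarrow> nat set) \<Rightarrow> ((nat \<times> nat) \<Rightarrow>\<^sub>0 int) \<Rightarrow>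
     ((edge \<Rightarrow>\<^sub>0 nat) \<Rightarrow>\<^sub>0 complex) set set" where
  "graded_part a b c S f =
     cls a b c S ` {p \<in> carrier (poly_ring (relevant_vars a b c S)).
        \<forall>m\<in>Poly_Mapping.keys p. mon_degree a m = f}"

text \<open>
  The isomorphism is only required to send each graded part onto the line spanned by the corresponding
  basis element: because of the plus signs in the relations, it cannot in general send
  every variable to the basis element of its degree itself.
\<close>

definition monoid_algebra_iso ::
  "nat \<Rightarrow> nat \<Rightarrow> nat \<Rightarrow> (nat \<Rightarrow> nat set) \<Rightarrow>
     (((edge \<Rightarrow>\<^sub>0 nat) \<Rightarrow>\<^sub>0 complex) set \<Rightarrow> ((nat \<times> nat) \<Rightarrow>\<^sub>0 int) \<Rightarrow>\<^sub>0 complex) \<Rightarrow> bool" where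
  "monoid_algebra_iso a b c S \<phi> \<longleftrightarrow>
     \<phi> \<in> ring_iso (A'_ring a b c S) (monoid_algebra (L_S a b c S)) \<and>
     (\<forall>z. \<phi> (cls a b c S (const z)) = Poly_Mapping.single 0 z) \<and>
     (\<forall>f\<in>L_S a b c S. \<phi> ` graded_part a b c S f = range (Poly_Mapping.single f))"

definition adjacent ::
  "nat \<Rightarrow> nat \<Rightarrow> nat \<Rightarrow> (nat \<Rightarrow> nat set) \<Rightarrow> ((nat \<times> nat) \<times> (nat \<times> nat)) set" where
  "adjacent a b c S =
     (\<Union>v\<in>relevant_vars a b c S. {(hex_above a v, hex_below a v), (hex_below a v, hex_above a v)})"

definition regions :: "nat \<Rightarrow> nat \<Rightarrow> nat \<Rightarrow> (nat \<Rightarrow> nat set) \<Rightarrow> (nat \<times> nat) set set" where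
  "regions a b c S = hexagons a b c // (adjacent a b c S)\<^sup>*"

end

(*
  Map the variables of dimers to 0 and those of relevant edges, up to sign, to the basis elements of
  their degrees in the group algebra of a free abelian group; the sign (-1)^j of BVar i j turns the plus signs
  of the relations into minus signs. In the relation of a horizontal dimer, take as leading term the
  product of the two edges to the right of the dimer. Every relevant edge touches exactly one hexagon
  in the column on its right, every hexagon outside of the leftmost column is touched by one or two
  relevant edges in this way, and by two exactly when they form a leading term. Hence a monomial
  without leading pairs is determined by its degree, column by column from right to left. As every
  monomial can be reduced to such a standard monomial, the relations generate the kernel, the image is
  the monoid algebra of the degrees, and the Hilbert function counts standard monomials. A leading pair
  xy allows the monomials in x or y alone, which contributes a factor (1 + t) / (1 - t) to the Hilbert
  series, hence the degree 2^(bc).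

  For the Krull dimension, elements picked from the successive differences of a chain of primes are
  algebraically independent modulo the first prime, so that the growth of the Hilbert function bounds
  the length of the chain; conversely the kernels of projections of the exponents to fewer and fewer
  coordinates form a chain of primes of the required length.

  Choosing for every hexagon a relevant edge to its left defines its root in the leftmost column. Since
  the two choices at a leading pair are connected through the hexagon to the left of the dimer, the root
  is constant on regions, and the regions correspond to the a + 1 hexagons of the leftmost column.
*)
theory Submission
  imports Defs "HOL-Library.Product_Lexorder"
begin

text \<open>Columns are the level sets of \<open>p + q\<close>, the leftmost one being
  \<open>p + q = a\<close>. The degree of an edge has coefficient plus or minus 1 at its right
  hexagon, and its only other coefficient sits one column to the left. This triangular shape is used
  three times: to recover a standard monomial from its degree, to bound the rank of the degrees from
  below, and to make the chain of primes strict. The number \<open>ab+ac+bc+b+c\<close> counts the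
  hexagons outside of the leftmost column. That non-horizontal dimers cover both ends of a
  horizontal edge or neither comes from reading \<open>S\<close> as \<open>a\<close> disjoint paths
  from left to right. This is why all four edges around a horizontal dimer are relevant.
  \<open>A_S\<close> has further variables, neither relevant nor of dimers. They are treated as free
  variables with degrees of their own, so that one abstract toric setting covers both
  \<open>A_S\<close> and \<open>A'_S\<close>; comparing the two instances shows that the subring
  \<open>A'_S\<close> has no relations besides those coming from the binomials.\<close>

section \<open>Linear algebra over integral domains\<close>

text \<open>Gaussian elimination without division, so that it applies to integer vectors as well as
  to complex ones: an equation with a nonzero coefficient eliminates a pivot unknown from the others
  by cross multiplication.\<close>

lemma underdetermined_system:
  fixes f :: "'i \<Rightarrow> 'x \<Rightarrow> 'k::idom"
  assumes "finite X" "finite I" "card X < card I"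
  shows "\<exists>c. (\<exists>i\<in>I. c i \<noteq> 0) \<and> (\<forall>x\<in>X. (\<Sum>i\<in>I. c i * f i x) = 0)"
  using assms
proof (induction X arbitrary: I f rule: finite_induct)
  case empty
  then obtain i where "i \<in> I" by fastforce
  then show ?case by (intro exI[of _ "\<lambda>_. 1"]) auto
next
  case (insert x X)
  show ?case
  proof (cases "\<forall>i\<in>I. f i x = 0")
    case True
    have "card X < card I" using insert by simp
    from insert.IH[OF insert.prems(1) this] obtain c where
      "\<exists>i\<in>I. c i \<noteq> 0" "\<forall>x\<in>X. (\<Sum>i\<in>I. c i * f i x) = 0" by blast
    with True show ?thesis by (intro exI[of _ c]) auto
  next
    case False
    then obtain k where k: "k \<in> I" "f k x \<noteq> 0" by blast
    define J where "J = I - {k}"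
    have I: "I = insert k J" "k \<notin> J" "finite J" using k insert.prems by (auto simp: J_def)
    have "card X < card J" using insert I by simp
    from insert.IH[OF I(3) this, of "\<lambda>i y. f k x * f i y - f i x * f k y"] obtain c where
      c: "\<exists>i\<in>J. c i \<noteq> 0" "\<And>y. y\<in>X \<Longrightarrow> (\<Sum>i\<in>J. c i * (f k x * f i y - f i x * f k y)) = 0" by blast
    \<comment> \<open>The value at the pivot solves the equation for \<open>x\<close>; scaling the
      other coefficients by the nonzero \<open>f k x\<close> keeps one of them nonzero.\<close>
    define d where "d i = (if i = k then - (\<Sum>i\<in>J. c i * f i x) else f k x * c i)" for i
    have eq: "(\<Sum>i\<in>I. d i * f i y) = (\<Sum>i\<in>J. c i * (f k x * f i y - f i x * f k y))" for y
    proof -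
      have "(\<Sum>i\<in>J. d i * f i y) = (\<Sum>i\<in>J. f k x * c i * f i y)"
        using I by (intro sum.cong) (auto simp: d_def)
      then have "(\<Sum>i\<in>I. d i * f i y) = (\<Sum>i\<in>J. f k x * c i * f i y) - (\<Sum>i\<in>J. c i * f i x) * f k y"
        using I by (simp add: d_def)
      then show ?thesis
        by (simp add: sum_distrib_right sum_distrib_left sum_subtractf[symmetric] algebra_simps)
    qed
    have "\<exists>i\<in>I. d i \<noteq> 0" using c(1) I k by (auto simp: d_def)
    moreover have "(\<Sum>i\<in>I. d i * f i y) = 0" if "y \<in> insert x X" for y
      using that c(2) unfolding eq by (auto simp: mult.commute)
    ultimately show ?thesis by blast
  qed
qed

section \<open>Ranks\<close>

lemma frag_dependent_iff:
  assumes "finite Q"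
  shows "frag.dependent Q \<longleftrightarrow> (\<exists>c. (\<exists>q\<in>Q. c q \<noteq> 0) \<and> (\<Sum>q\<in>Q. frag_cmul (c q) q) = 0)"
  using frag.dependent_finite[OF assms] by blast

text \<open>More than \<open>card Y\<close> elements have a nontrivial combination that vanishes on
  \<open>Y\<close>, by \<open>underdetermined_system\<close>. As the coordinates in \<open>Y\<close>
  detect zero, this is a linear dependence.\<close>

lemma rank_le:
  assumes Y: "finite Y"
    and det: "\<And>Q c. finite Q \<Longrightarrow> Q \<subseteq> G \<Longrightarrow>
      (\<And>y. y \<in> Y \<Longrightarrow> Poly_Mapping.lookup (\<Sum>q\<in>Q. frag_cmul (c q) q) y = 0) \<Longrightarrow>
      (\<Sum>q\<in>Q. frag_cmul (c q) q) = 0"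
  shows "rank G \<le> enat (card Y)"
  unfolding rank_def
proof (rule Sup_least, clarify)
  fix Q assume Q: "Q \<subseteq> G" "finite Q" "frag.independent Q"
  have "\<not> card Y < card Q"
  proof
    assume "card Y < card Q"
    from underdetermined_system[OF Y Q(2) this, of "\<lambda>q. Poly_Mapping.lookup q"] obtain c where
      c: "\<exists>q\<in>Q. c q \<noteq> 0" "\<And>y. y\<in>Y \<Longrightarrow> (\<Sum>q\<in>Q. c q * Poly_Mapping.lookup q y) = 0" by blast
    then have "(\<Sum>q\<in>Q. frag_cmul (c q) q) = 0"
      by (intro det Q) (simp add: lookup_sum)
    with Q c frag_dependent_iff show False by blast
  qed
  then show "enat (card Q) \<le> enat (card Y)" by simp
qed

text \<open>Triangularity with respect to \<open>col\<close>, where elements of equal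
  \<open>col\<close> do not interact: in a combination, a term of largest \<open>col\<close> with
  nonzero coefficient cannot be cancelled at its own coordinate.\<close>

lemma rank_ge:
  fixes col :: "'h \<Rightarrow> nat"
  assumes X: "finite X" and g: "g ` X \<subseteq> G"
    and diag: "\<And>h. h \<in> X \<Longrightarrow> Poly_Mapping.lookup (g h) h \<noteq> 0"
    and tri: "\<And>h h'. h \<in> X \<Longrightarrow> h' \<in> X \<Longrightarrow> h' \<noteq> h \<Longrightarrow> col h \<le> col h' \<Longrightarrow>
      Poly_Mapping.lookup (g h) h' = 0"
  shows "enat (card X) \<le> rank G"
proof -
  have inj: "inj_on g X"
  proof (rule inj_onI)
    fix x y assume "x \<in> X" "y \<in> X" "g x = g y"
    then show "x = y" using diag[of x] diag[of y] tri[of x y] tri[of y x]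
      by (cases "col x \<le> col y") auto
  qed
  have "frag.independent (g ` X)"
  proof
    assume "frag.dependent (g ` X)"
    then obtain c0 where c0: "\<exists>q\<in>g ` X. c0 q \<noteq> 0" "(\<Sum>q\<in>g ` X. frag_cmul (c0 q) q) = 0"
      using frag_dependent_iff[of "g ` X"] X by blast
    define c where "c h = c0 (g h)" for h
    have c: "\<exists>h\<in>X. c h \<noteq> 0" "(\<Sum>h\<in>X. frag_cmul (c h) (g h)) = 0"
      using c0 inj by (auto simp: c_def sum.reindex)
    define Z where "Z = {h\<in>X. c h \<noteq> 0}"
    have Z: "finite Z" "Z \<noteq> {}" using c X by (auto simp: Z_def)
    define k where "k = Max (col ` Z)"
    have "k \<in> col ` Z" unfolding k_def using Z by (intro Max_in) auto
    then obtain h where h: "h \<in> Z" "col h = k" by blast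
    have le: "col h' \<le> col h" if "h' \<in> Z" for h' using that Z h by (simp add: k_def)
    have "0 = Poly_Mapping.lookup (\<Sum>h\<in>X. frag_cmul (c h) (g h)) h" using c by simp
    also have "\<dots> = (\<Sum>h'\<in>X. c h' * Poly_Mapping.lookup (g h') h)" by (simp add: lookup_sum)
    also have "\<dots> = (\<Sum>h'\<in>{h}. c h' * Poly_Mapping.lookup (g h') h)"
      using h X le tri by (intro sum.mono_neutral_right) (auto simp: Z_def)
    finally show False using h diag by (auto simp: Z_def)
  qed
  then have "enat (card (g ` X)) \<in> {enat (card X) |X. X \<subseteq> G \<and> finite X \<and> frag.independent X}"
    using g X by blast
  then show ?thesis unfolding rank_def card_image[OF inj, symmetric] by (rule Sup_upper)
qed

section \<open>Monoid algebras\<close>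

definition submonoid_add :: "'m::comm_monoid_add set \<Rightarrow> bool" where
  "submonoid_add M \<longleftrightarrow> 0 \<in> M \<and> (\<forall>x\<in>M. \<forall>y\<in>M. x + y \<in> M)"

lemma monoid_algebra_simps [simp]:
  "carrier (monoid_algebra M) = {p. Poly_Mapping.keys p \<subseteq> M}"
  "x \<otimes>\<^bsub>monoid_algebra M\<^esub> y = x * y"
  "x \<oplus>\<^bsub>monoid_algebra M\<^esub> y = x + y"
  "\<one>\<^bsub>monoid_algebra M\<^esub> = 1"
  "\<zero>\<^bsub>monoid_algebra M\<^esub> = 0"
  by (auto simp: monoid_algebra_def)

lemma keys_mult_subset:
  assumes "submonoid_add M" "Poly_Mapping.keys p \<subseteq> M" "Poly_Mapping.keys q \<subseteq> M"
  shows "Poly_Mapping.keys (p * q) \<subseteq> M"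
proof
  fix m assume "m \<in> Poly_Mapping.keys (p * q)"
  then obtain a b where "m = a + b" "a \<in> Poly_Mapping.keys p" "b \<in> Poly_Mapping.keys q"
    using keys_mult[of p q] by blast
  with assms show "m \<in> M" by (auto simp: submonoid_add_def)
qed

lemma keys_add_subset:
  "Poly_Mapping.keys p \<subseteq> M \<Longrightarrow> Poly_Mapping.keys q \<subseteq> M \<Longrightarrow> Poly_Mapping.keys (p + q) \<subseteq> M"
  using keys_add[of p q] by blast

lemma cring_monoid_algebra:
  fixes M :: "'m::comm_monoid_add set"
  assumes M: "submonoid_add M"
  shows "cring (monoid_algebra M)"
proof (rule cringI)
  show "abelian_group (monoid_algebra M)"
  proof (rule abelian_groupI)
    fix x assume "x \<in> carrier (monoid_algebra M)"
    then show "\<exists>y\<in>carrier (monoid_algebra M). y \<oplus>\<^bsub>monoid_algebra M\<^esub> x = \<zero>\<^bsub>monoid_algebra M\<^esub>"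
      by (intro bexI[of _ "- x"]) (auto simp: in_keys_iff)
  qed (auto simp: keys_add_subset algebra_simps)
  show "comm_monoid (monoid_algebra M)"
  proof (rule comm_monoidI)
    show "\<one>\<^bsub>monoid_algebra M\<^esub> \<in> carrier (monoid_algebra M)"
      using M by (simp add: submonoid_add_def)
  qed (simp_all add: keys_mult_subset[OF M] mult.assoc mult.commute)
qed (auto simp: algebra_simps)

text \<open>The linear order on exponents supplies leading terms, whose product cannot cancel. For
  hexagon degrees it comes from the lexicographic order on pairs.\<close>

lemma domain_monoid_algebra:
  fixes M :: "'m::{ordered_cancel_comm_monoid_add,linorder} set"
  assumes "submonoid_add M"
  shows "domain (monoid_algebra M)"
proof -
  interpret cring "monoid_algebra M" by (rule cring_monoid_algebra[OF assms])
  show ?thesis by unfold_locales auto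
qed

context
  fixes M :: "'m::comm_monoid_add set" and I
  assumes M: "submonoid_add M" and I: "ideal I (monoid_algebra M)"
begin

lemma ideal_monoid_algebra_keys: "x \<in> I \<Longrightarrow> Poly_Mapping.keys x \<subseteq> M"
  using additive_subgroup.a_Hcarr[OF ideal.axioms(1)[OF I]] by auto

lemma ideal_monoid_algebra_0: "0 \<in> I"
  using additive_subgroup.zero_closed[OF ideal.axioms(1)[OF I]] by simp

lemma ideal_monoid_algebra_add: "x \<in> I \<Longrightarrow> y \<in> I \<Longrightarrow> x + y \<in> I"
  using additive_subgroup.a_closed[OF ideal.axioms(1)[OF I]] by simp

lemma ideal_monoid_algebra_mult: "x \<in> I \<Longrightarrow> Poly_Mapping.keys y \<subseteq> M \<Longrightarrow> y * x \<in> I"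
  using ideal.I_l_closed[OF I] by simp

lemma ideal_monoid_algebra_diff:
  assumes "x \<in> I" "y \<in> I"
  shows "x - y \<in> I"
proof -
  have "Poly_Mapping.single 0 (- 1) * y \<in> I"
    using M assms by (intro ideal_monoid_algebra_mult) (auto simp: submonoid_add_def)
  then show ?thesis
    using ideal_monoid_algebra_add[OF assms(1)] by (fastforce simp: single_uminus)
qed

lemma ideal_monoid_algebra_sum: "(\<And>i. i \<in> A \<Longrightarrow> f i \<in> I) \<Longrightarrow> sum f A \<in> I"
  by (induction A rule: infinite_finite_induct)
     (auto intro: ideal_monoid_algebra_0 ideal_monoid_algebra_add)

end

lemma submonoid_add_keys: "submonoid_add {m :: 'v \<Rightarrow>\<^sub>0 nat. Poly_Mapping.keys m \<subseteq> V}"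
  by (auto simp: submonoid_add_def in_keys_iff lookup_add dest!: subsetD)

lemma cring_poly_ring: "cring (poly_ring V)"
  unfolding poly_ring_def by (rule cring_monoid_algebra[OF submonoid_add_keys])

lemma poly_ring_simps [simp]:
  "carrier (poly_ring V) = {p. \<forall>m\<in>Poly_Mapping.keys p. Poly_Mapping.keys m \<subseteq> V}"
  "x \<otimes>\<^bsub>poly_ring V\<^esub> y = x * y"
  "x \<oplus>\<^bsub>poly_ring V\<^esub> y = x + y"
  "\<one>\<^bsub>poly_ring V\<^esub> = 1"
  "\<zero>\<^bsub>poly_ring V\<^esub> = 0"
  by (auto simp: poly_ring_def)

lemma lookup_single_0_mult:
  "Poly_Mapping.lookup (Poly_Mapping.single 0 z * p) m = (z::complex) * Poly_Mapping.lookup p m"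
  by (simp add: mult_map_scale_conv_mult[symmetric] map.rep_eq when_def)

lemma poly_mapping_sum_single:
  "p = (\<Sum>m\<in>Poly_Mapping.keys p. Poly_Mapping.single m (Poly_Mapping.lookup p m))"
  by (rule poly_mapping_eqI) (simp add: lookup_sum lookup_single when_def in_keys_iff)

section \<open>Extending monoid homomorphisms linearly\<close>

text \<open>Scalars enter as products with the constants \<open>single 0 z\<close>. For
  multiplicative \<open>f\<close> with \<open>f 0 = 1\<close> this is a ring homomorphism; both the
  toric maps and the projections of exponents arise in this way.\<close>

definition lin_ext :: "('m \<Rightarrow> 'n::comm_monoid_add \<Rightarrow>\<^sub>0 complex) \<Rightarrow> ('m \<Rightarrow>\<^sub>0 complex) \<Rightarrow> 'n \<Rightarrow>\<^sub>0 complex" where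
  "lin_ext f p = (\<Sum>m\<in>Poly_Mapping.keys p. Poly_Mapping.single 0 (Poly_Mapping.lookup p m) * f m)"

lemma lin_ext_superset:
  assumes "finite A" "Poly_Mapping.keys p \<subseteq> A"
  shows "lin_ext f p = (\<Sum>m\<in>A. Poly_Mapping.single 0 (Poly_Mapping.lookup p m) * f m)"
  unfolding lin_ext_def using assms by (intro sum.mono_neutral_left) (auto simp: in_keys_iff)

lemma lin_ext_add: "lin_ext f (p + q) = lin_ext f p + lin_ext f q"
proof -
  let ?A = "Poly_Mapping.keys p \<union> Poly_Mapping.keys q"
  show ?thesis using keys_add[of p q]
    by (simp add: lin_ext_superset[of ?A] lookup_add single_add distrib_right sum.distrib)
qed

lemma lin_ext_0 [simp]: "lin_ext f 0 = 0" by (simp add: lin_ext_def)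

lemma lin_ext_single [simp]: "lin_ext f (Poly_Mapping.single m z) = Poly_Mapping.single 0 z * f m"
  by (cases "z = 0") (auto simp: lin_ext_def)

lemma lin_ext_one [simp]: "lin_ext f 1 = f 0"
  using lin_ext_single[of f 0 1] by simp

lemma lin_ext_sum: "lin_ext f (sum g A) = (\<Sum>x\<in>A. lin_ext f (g x))"
  by (induction A rule: infinite_finite_induct) (auto simp: lin_ext_add)

lemma lin_ext_mult:
  fixes f :: "'m::comm_monoid_add \<Rightarrow> 'n::comm_monoid_add \<Rightarrow>\<^sub>0 complex"
  assumes f: "\<And>m n. f (m + n) = f m * f n"
  shows "lin_ext f (p * q) = lin_ext f p * lin_ext f q"
proof -
  have "p * q = (\<Sum>m\<in>Poly_Mapping.keys p. \<Sum>n\<in>Poly_Mapping.keys q.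
      Poly_Mapping.single (m + n) (Poly_Mapping.lookup p m * Poly_Mapping.lookup q n))"
  proof -
    have "p * q = (\<Sum>m\<in>Poly_Mapping.keys p. Poly_Mapping.single m (Poly_Mapping.lookup p m)) *
        (\<Sum>n\<in>Poly_Mapping.keys q. Poly_Mapping.single n (Poly_Mapping.lookup q n))"
      by (simp flip: poly_mapping_sum_single)
    then show ?thesis by (simp only: sum_product mult_single)
  qed
  then have "lin_ext f (p * q) = (\<Sum>m\<in>Poly_Mapping.keys p. \<Sum>n\<in>Poly_Mapping.keys q.
      (Poly_Mapping.single 0 (Poly_Mapping.lookup p m) * f m) *
      (Poly_Mapping.single 0 (Poly_Mapping.lookup q n) * f n))"
  proof -
    have "Poly_Mapping.single (0::'n) (x * y) = Poly_Mapping.single 0 x * Poly_Mapping.single 0 y"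
      for x y :: complex by (simp add: mult_single)
    with \<open>p * q = _\<close> show ?thesis by (simp only: lin_ext_sum lin_ext_single f mult_ac)
  qed
  then show ?thesis by (simp add: lin_ext_def sum_product)
qed

lemma lin_ext_uminus: "lin_ext f (- p) = - lin_ext f p"
  using lin_ext_add[of f p "- p"] by (simp add: minus_unique)

lemma lin_ext_diff: "lin_ext f (p - q) = lin_ext f p - lin_ext f q"
  using lin_ext_add[of f p "-q"] by (simp add: lin_ext_uminus)

lemma lin_ext_ring_hom:
  assumes "\<And>m n. f (m + n) = f m * f n" "f 0 = 1"
    and "\<And>m. m \<in> M \<Longrightarrow> Poly_Mapping.keys (f m) \<subseteq> N"
  shows "lin_ext f \<in> ring_hom (monoid_algebra M) (monoid_algebra N)"
proof (rule ring_hom_memI)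
  fix p assume p: "p \<in> carrier (monoid_algebra M)"
  have "Poly_Mapping.keys (Poly_Mapping.single 0 z * f m) \<subseteq> Poly_Mapping.keys (f m)" for z m
    by (auto simp: in_keys_iff lookup_single_0_mult)
  then show "lin_ext f p \<in> carrier (monoid_algebra N)"
    unfolding lin_ext_def using p assms(3)
    by (auto dest!: subsetD[OF keys_sum]) blast
next
  show "lin_ext f \<one>\<^bsub>monoid_algebra M\<^esub> = \<one>\<^bsub>monoid_algebra N\<^esub>"
    using lin_ext_single[of f 0 1] assms(2) by (simp)
qed (simp_all add: lin_ext_mult[of f, OF assms(1)] lin_ext_add)

section \<open>Krull dimension\<close>

lemma krull_dim_leI:
  assumes "\<And>n P. \<lbrakk>\<And>i. i \<le> n \<Longrightarrow> primeideal (P i) R; \<And>i. i < n \<Longrightarrow> P i \<subset> P (Suc i)\<rbrakk> \<Longrightarrow> n \<le> d"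
  shows "krull_dim R \<le> enat d"
  unfolding krull_dim_def
proof (rule Sup_least, clarify)
  fix n P assume "\<forall>i\<le>n. primeideal (P i) R" "\<forall>i<n. P i \<subset> P (Suc i)"
  then show "enat n \<le> enat d" using assms[of n P] by simp
qed

text \<open>Preimages of primes are prime, and surjectivity keeps the inclusions strict. Used in
  both directions, this makes the dimension an invariant.\<close>

lemma krull_dim_iso_le:
  assumes R: "cring R" and S: "ring S" and h: "h \<in> ring_iso R S"
  shows "krull_dim S \<le> krull_dim R"
  unfolding krull_dim_def
proof (rule Sup_subset_mono, clarify)
  fix n P assume P: "\<forall>i\<le>n. primeideal (P i) S" "\<forall>i<n. P i \<subset> P (Suc i)"
  interpret hom: ring_hom_ring R S h
    using R S h by (intro ring_hom_ringI2) (auto simp: ring_iso_def cring_def)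
  have surj: "h ` carrier R = carrier S" using h by (auto simp: ring_iso_def bij_betw_def)
  define Q where "Q i = {r \<in> carrier R. h r \<in> P i}" for i
  have "primeideal (Q i) R" if "i \<le> n" for i
    unfolding Q_def using hom.primeideal_vimage[OF R] P that by blast
  moreover have "Q i \<subset> Q (Suc i)" if i: "i < n" for i
  proof -
    obtain y where y: "y \<in> P (Suc i)" "y \<notin> P i" using P i by blast
    interpret primeideal "P (Suc i)" S using P i by auto
    have "y \<in> h ` carrier R" unfolding surj using y by (simp add: a_Hcarr)
    then obtain x where "x \<in> carrier R" "h x = y" by blast
    with y P i show ?thesis unfolding Q_def by blast
  qed
  ultimately show "\<exists>m. enat n = enat m \<and>
      (\<exists>P. (\<forall>i\<le>m. primeideal (P i) R) \<and> (\<forall>i<m. P i \<subset> P (Suc i)))"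
    by blast
qed

section \<open>Upper bound for the Krull dimension by growth\<close>

text \<open>\<open>G\<close> stands for a filtration of the exponents that is compatible with
  addition; later \<open>G n\<close> consists of the degrees of monomials of total degree at most
  \<open>n\<close>.\<close>

lemma single_power_keys:
  assumes G: "\<And>i j x y. x \<in> G i \<Longrightarrow> y \<in> G j \<Longrightarrow> x + y \<in> G (i + j :: nat)" "0 \<in> G 0"
    and f: "Poly_Mapping.keys f \<subseteq> G e"
  shows "Poly_Mapping.keys (f ^ t :: 'm::comm_monoid_add \<Rightarrow>\<^sub>0 complex) \<subseteq> G (t * e)"
proof (induction t)
  case (Suc t)
  show ?case
  proof
    fix m assume "m \<in> Poly_Mapping.keys (f ^ Suc t)"
    then obtain a b where "m = a + b" "a \<in> Poly_Mapping.keys f" "b \<in> Poly_Mapping.keys (f ^ t)"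
      using keys_mult[of f "f ^ t"] by auto
    then show "m \<in> G (Suc t * e)" using G(1)[of a e b "t * e"] f Suc by auto
  qed
qed (use G in simp)

text \<open>The exponents form a list so that recursion splits off the power of \<open>f i\<close>,
  the element that separates \<open>P i\<close> from \<open>P (Suc i)\<close> in a chain of
  primes.\<close>

fun list_monomial :: "(nat \<Rightarrow> 'r::comm_monoid_mult) \<Rightarrow> nat \<Rightarrow> nat list \<Rightarrow> 'r" where
  "list_monomial f i [] = 1"
| "list_monomial f i (t # ts) = f i ^ t * list_monomial f (Suc i) ts"

definition box :: "nat \<Rightarrow> nat \<Rightarrow> nat list set" where
  "box N k = {ts. set ts \<subseteq> {..N} \<and> length ts = k}"

lemma finite_box: "finite (box N k)" and card_box: "card (box N k) = Suc N ^ k"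
  unfolding box_def using finite_lists_length_eq[of "{..N}" k] card_lists_length_eq[of "{..N}" k] by auto

lemma sum_box_Suc: "(\<Sum>ts\<in>box N (Suc k). g ts) = (\<Sum>t\<le>N. \<Sum>ts\<in>box N k. g (t # ts))"
proof -
  have "box N (Suc k) = (\<lambda>(t, ts). t # ts) ` ({..N} \<times> box N k)"
    by (auto simp: box_def image_iff length_Suc_conv)
  moreover have "inj_on (\<lambda>(t, ts). t # ts) ({..N} \<times> box N k)" by (auto simp: inj_on_def)
  ultimately show ?thesis by (simp add: sum.reindex sum.cartesian_product case_prod_unfold)
qed

lemma list_monomial_keys:
  fixes f :: "nat \<Rightarrow> 'm::comm_monoid_add \<Rightarrow>\<^sub>0 complex"
  assumes G: "\<And>i j x y. x \<in> G i \<Longrightarrow> y \<in> G j \<Longrightarrow> x + y \<in> G (i + j :: nat)" "0 \<in> G 0"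
    and f: "\<And>i. i < n \<Longrightarrow> Poly_Mapping.keys (f i) \<subseteq> G e"
  shows "i + length ts \<le> n \<Longrightarrow> Poly_Mapping.keys (list_monomial f i ts) \<subseteq> G (sum_list ts * e)"
proof (induction ts arbitrary: i)
  case (Cons t ts)
  show ?case
  proof
    fix m assume "m \<in> Poly_Mapping.keys (list_monomial f i (t # ts))"
    then obtain a b where "m = a + b" "a \<in> Poly_Mapping.keys (f i ^ t)"
      "b \<in> Poly_Mapping.keys (list_monomial f (Suc i) ts)"
      using keys_mult[of "f i ^ t" "list_monomial f (Suc i) ts"] by auto
    moreover have "Poly_Mapping.keys (f i ^ t) \<subseteq> G (t * e)"
      using Cons.prems by (intro single_power_keys G f) auto
    moreover have "Poly_Mapping.keys (list_monomial f (Suc i) ts) \<subseteq> G (sum_list ts * e)"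
      using Cons.prems by (intro Cons.IH) auto
    ultimately show "m \<in> G (sum_list (t # ts) * e)"
      using G(1)[of a "t * e" b "sum_list ts * e"] by (auto simp: distrib_right)
  qed
qed (use G in simp)

text \<open>Modulo \<open>Q\<close> only \<open>g 0\<close> survives, so it is zero. Then
  \<open>f\<close> can be cancelled modulo the prime \<open>P\<close>, and the other coefficients
  follow by induction. The second assumption on \<open>g\<close> encodes independence modulo
  \<open>Q\<close>.\<close>

lemma power_sum_in_prime:
  fixes f :: "'m::comm_monoid_add \<Rightarrow>\<^sub>0 complex"
  assumes M: "submonoid_add M" and P: "primeideal P (monoid_algebra M)"
    and Q: "ideal Q (monoid_algebra M)" and sub: "P \<subseteq> Q" and f: "f \<in> Q" "f \<notin> P"
    and g: "\<And>t. g t \<in> carrier (monoid_algebra M)" "\<And>t. g t \<in> Q \<Longrightarrow> g t = 0"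
    and s: "(\<Sum>t\<le>N. f ^ t * g t) \<in> P"
  shows "\<forall>t\<le>N. g t = 0"
proof -
  interpret P: primeideal P "monoid_algebra M" by fact
  note Q' = ideal_monoid_algebra_keys[OF M Q] ideal_monoid_algebra_diff[OF M Q]
    ideal_monoid_algebra_mult[OF M Q]
  have pc: "Poly_Mapping.keys (f ^ t) \<subseteq> M" for t
    by (induction t) (use M Q'(1)[OF f(1)] in \<open>auto simp: submonoid_add_def intro: keys_mult_subset[OF M, THEN subsetD]\<close>)
  show ?thesis using g s
  proof (induction N arbitrary: g)
    case 0
    then show ?case using sub by auto
  next
    case (Suc N)
    define r where "r = (\<Sum>t\<le>N. f ^ t * g (Suc t))"
    have rc: "Poly_Mapping.keys r \<subseteq> M"
    proof -
      have "Poly_Mapping.keys (f ^ t * g (Suc t)) \<subseteq> M" for t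
        using Suc.prems(1)[of "Suc t"] pc[of t] by (intro keys_mult_subset[OF M]) auto
      then show ?thesis unfolding r_def using keys_sum[of "\<lambda>t. f ^ t * g (Suc t)" "{..N}"] by fastforce
    qed
    have eq: "(\<Sum>t\<le>Suc N. f ^ t * g t) = g 0 + f * r"
      unfolding sum.atMost_Suc_shift r_def by (simp add: sum_distrib_left mult.assoc)
    have fr: "f * r \<in> Q" using Q'(3)[OF f(1) rc] by (simp add: mult.commute)
    have "g 0 + f * r \<in> Q" using Suc.prems(3) sub eq by auto
    from Q'(2)[OF this fr] have g0: "g 0 = 0" using Suc.prems(2) by simp
    then have "f \<otimes>\<^bsub>monoid_algebra M\<^esub> r \<in> P" using Suc.prems(3) eq by simp
    then have "r \<in> P" using P.I_prime[of f r] Q'(1)[OF f(1)] rc f(2) by auto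
    then have "\<forall>t\<le>N. g (Suc t) = 0"
      using Suc.prems by (intro Suc.IH) (auto simp: r_def)
    with g0 show ?case by (metis Suc_le_mono not0_implies_Suc)
  qed
qed

text \<open>A chain of length \<open>n\<close> gives \<open>n\<close> elements with supports in some
  level \<open>e\<close> that are algebraically independent modulo \<open>P 0\<close>. Their
  \<open>Suc N ^ n\<close> monomials with exponents at most \<open>N\<close> live in a space of
  dimension \<open>card (G (n * N * e))\<close>, which grows at most like
  \<open>N ^ d\<close>.\<close>

theorem krull_dim_le:
  fixes M :: "'m::comm_monoid_add set"
  assumes M: "submonoid_add M"
    and G: "\<And>i j x y. x \<in> G i \<Longrightarrow> y \<in> G j \<Longrightarrow> x + y \<in> G (i + j :: nat)" "0 \<in> G 0"
    and G': "\<And>n. finite (G n)" "M = (\<Union>n. G n)" "\<And>m n. m \<le> n \<Longrightarrow> G m \<subseteq> G n"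
    and growth: "\<And>n. card (G n) \<le> C * Suc n ^ d"
  shows "krull_dim (monoid_algebra M) \<le> enat d"
proof (rule krull_dim_leI)
  fix n P
  assume prime: "\<And>i. i \<le> n \<Longrightarrow> primeideal (P i) (monoid_algebra M)"
    and strict: "\<And>i. i < n \<Longrightarrow> P i \<subset> P (Suc i)"
  have ideal: "ideal (P i) (monoid_algebra M)" if "i \<le> n" for i
    using prime[OF that] by (simp add: primeideal_def)
  have "\<exists>f. f \<in> P (Suc i) - P i" if "i < n" for i using strict[OF that] by blast
  then obtain f where f: "\<And>i. i < n \<Longrightarrow> f i \<in> P (Suc i) - P i" by metis
  have fM: "Poly_Mapping.keys (f i) \<subseteq> M" if "i < n" for i
    using f[OF that] ideal_monoid_algebra_keys[OF M ideal, of "Suc i"] that by auto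
  have "\<exists>e. \<forall>i<n. Poly_Mapping.keys (f i) \<subseteq> G e"
  proof -
    have "\<exists>e. K \<subseteq> G e" if "finite K" "K \<subseteq> M" for K
      using that
    proof (induction K rule: finite_induct)
      case (insert x K)
      then obtain e e' where "K \<subseteq> G e" "x \<in> G e'" using G' by blast
      then have "insert x K \<subseteq> G (max e e')" using G'(3)[of e "max e e'"] G'(3)[of e' "max e e'"] by auto
      then show ?case by blast
    qed auto
    from this[of "\<Union>i<n. Poly_Mapping.keys (f i)"] show ?thesis using fM by (auto simp: UN_subset_iff lessThan_def)
  qed
  then obtain e where e: "\<And>i. i < n \<Longrightarrow> Poly_Mapping.keys (f i) \<subseteq> G e" by blast
  have mon_keys: "Poly_Mapping.keys (list_monomial f i ts) \<subseteq> G (sum_list ts * e)" if "i + length ts \<le> n" for i ts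
    using list_monomial_keys[of G n f e i ts] G e that by blast
  have sumM: "Poly_Mapping.keys (\<Sum>ts\<in>box N k. Poly_Mapping.single 0 (c ts) * list_monomial f i ts) \<subseteq> M"
    if "i + k \<le> n" for i k N c
  proof -
    have "Poly_Mapping.keys (Poly_Mapping.single 0 (c ts) * list_monomial f i ts) \<subseteq> M" if "ts \<in> box N k" for ts
      using that mon_keys[of i ts] \<open>i + k \<le> n\<close> M G'(2) by (intro keys_mult_subset[OF M]) (auto simp: box_def submonoid_add_def)
    then show ?thesis using keys_sum[of "\<lambda>ts. Poly_Mapping.single 0 (c ts) * list_monomial f i ts" "box N k"] by fastforce
  qed
  text \<open>This is the algebraic independence of \<open>f i, \<dots>, f (n - 1)\<close> modulo \<open>P i\<close>.\<close>
  have indep: "\<forall>ts\<in>box N k. c ts = 0"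
    if "i + k \<le> n" "(\<Sum>ts\<in>box N k. Poly_Mapping.single 0 (c ts) * list_monomial f i ts) \<in> P i" for N k i c
    using that
  proof (induction k arbitrary: i c)
    case 0
    have box0: "box N 0 = {[]}" by (auto simp: box_def)
    interpret primeideal "P i" "monoid_algebra M" using prime 0 by simp
    have "c [] = 0"
    proof (rule ccontr)
      assume nz: "c [] \<noteq> 0"
      have "Poly_Mapping.single 0 (c []) \<in> P i" using 0 by (simp add: box0)
      then have "Poly_Mapping.single 0 (1 / c []) * Poly_Mapping.single 0 (c []) \<in> P i"
        using M 0 by (intro ideal_monoid_algebra_mult[OF M ideal]) (auto simp: submonoid_add_def)
      then have "1 \<in> P i" using nz by (simp add: mult_single)
      then show False using one_imp_carrier I_notcarr by simp
    qed
    then show ?case by (simp add: box_def)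
  next
    case (Suc k)
    define g where "g t = (\<Sum>ts\<in>box N k. Poly_Mapping.single 0 (c (t # ts)) * list_monomial f (Suc i) ts)" for t
    have "(\<Sum>ts\<in>box N (Suc k). Poly_Mapping.single 0 (c ts) * list_monomial f i ts) = (\<Sum>t\<le>N. f i ^ t * g t)"
      unfolding sum_box_Suc g_def by (simp add: sum_distrib_left mult_ac)
    then have s: "(\<Sum>t\<le>N. f i ^ t * g t) \<in> P i" using Suc.prems by simp
    \<comment> \<open>The induction hypothesis modulo \<open>P (Suc i)\<close> shows that a
      coefficient lying in this ideal is zero, as \<open>power_sum_in_prime\<close>
      requires.\<close>
    have z: "\<forall>ts\<in>box N k. c (t # ts) = 0" if "g t \<in> P (Suc i)" for t
      using that Suc.prems unfolding g_def by (intro Suc.IH[of "Suc i"]) auto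
    then have g0: "g t = 0" if "g t \<in> P (Suc i)" for t using that by (simp add: g_def)
    have gM: "g t \<in> carrier (monoid_algebra M)" for t
      unfolding g_def using sumM[of "Suc i" k] Suc.prems by simp
    have "\<forall>t\<le>N. g t = 0"
      using Suc.prems strict[of i] f[of i]
      by (intro power_sum_in_prime[OF M prime[of i] ideal[of "Suc i"] _ _ _ gM g0 s]) auto
    moreover have "0 \<in> P (Suc i)" using Suc.prems by (intro ideal_monoid_algebra_0[OF M ideal]) auto
    ultimately have "\<forall>t\<le>N. \<forall>ts\<in>box N k. c (t # ts) = 0" using z by auto
    then show ?case by (auto simp: box_def length_Suc_conv)
  qed
  \<comment> \<open>Otherwise there are more monomials than coordinates, and a linear relation
    between them contradicts \<open>indep\<close> because 0 lies in \<open>P 0\<close>.\<close>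
  have bound: "Suc N ^ n \<le> card (G (n * N * e))" for N
  proof (rule ccontr)
    assume "\<not> ?thesis"
    then have "card (G (n * N * e)) < card (box N n)" by (simp add: card_box)
    from underdetermined_system[OF G'(1) finite_box this, of "\<lambda>ts. Poly_Mapping.lookup (list_monomial f 0 ts)"]
    obtain c where c: "\<exists>ts\<in>box N n. c ts \<noteq> 0"
      "\<And>x. x \<in> G (n * N * e) \<Longrightarrow> (\<Sum>ts\<in>box N n. c ts * Poly_Mapping.lookup (list_monomial f 0 ts) x) = 0"
      by blast
    have "(\<Sum>ts\<in>box N n. Poly_Mapping.single 0 (c ts) * list_monomial f 0 ts) = 0"
    proof (rule poly_mapping_eqI)
      fix x
      have "(\<Sum>ts\<in>box N n. c ts * Poly_Mapping.lookup (list_monomial f 0 ts) x) = 0"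
      proof (cases "x \<in> G (n * N * e)")
        case False
        have "x \<notin> Poly_Mapping.keys (list_monomial f 0 ts)" if "ts \<in> box N n" for ts
        proof -
          have "sum_list ts \<le> n * N" using that sum_list_mono[of ts "\<lambda>x. x" "\<lambda>_. N"]
            by (auto simp: box_def sum_list_triv)
          then show ?thesis using mon_keys[of 0 ts] G'(3)[of "sum_list ts * e" "n * N * e"] that False
            by (auto simp: box_def)
        qed
        then show ?thesis by (simp add: in_keys_iff)
      qed (rule c)
      then show "Poly_Mapping.lookup (\<Sum>ts\<in>box N n. Poly_Mapping.single 0 (c ts) * list_monomial f 0 ts) x =
          Poly_Mapping.lookup 0 x"
        by (simp add: lookup_sum lookup_single_0_mult)
    qed
    then show False using indep[of 0 n c N] c(1) ideal_monoid_algebra_0[OF M ideal[of 0]] by auto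
  qed
  show "n \<le> d"
  proof (rule ccontr)
    assume "\<not> n \<le> d"
    \<comment> \<open>This \<open>K\<close> absorbs both \<open>C\<close> and
      \<open>Suc (n * e) ^ d\<close>: for \<open>N = K\<close> the bound becomes
      \<open>Suc K * Suc K ^ d \<le> K * Suc K ^ d\<close>.\<close>
    define K where "K = C * Suc (n * e) ^ d"
    have "Suc K * Suc K ^ d \<le> Suc K ^ n"
      using \<open>\<not> n \<le> d\<close> power_increasing[of "Suc d" n "Suc K"] by simp
    also have "\<dots> \<le> C * Suc (n * K * e) ^ d" using bound[of K] growth[of "n * K * e"] by linarith
    also have "\<dots> \<le> C * (Suc (n * e) * Suc K) ^ d"
      by (intro mult_left_mono power_mono) (auto simp: algebra_simps)
    also have "\<dots> = K * Suc K ^ d" by (simp only: K_def power_mult_distrib mult.assoc)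
    finally show False by simp
  qed
qed

section \<open>Lower bound: primes from coordinate projections\<close>

definition restr :: "'h set \<Rightarrow> ('h \<Rightarrow>\<^sub>0 int) \<Rightarrow> 'h \<Rightarrow>\<^sub>0 int" where
  "restr X = frag_extend (\<lambda>h. if h \<in> X then frag_of h else 0)"

lemma lookup_restr: "Poly_Mapping.lookup (restr X m) h = (if h \<in> X then Poly_Mapping.lookup m h else 0)"
proof -
  have "Poly_Mapping.lookup (restr X m) h =
      (\<Sum>i\<in>Poly_Mapping.keys m. if i = h then (if h \<in> X then Poly_Mapping.lookup m h else 0) else 0)"
    unfolding restr_def frag_extend_def lookup_sum by (intro sum.cong) auto
  then show ?thesis by (auto simp: in_keys_iff)
qed

lemma restr_add: "restr X (m + n) = restr X m + restr X n"
  by (simp add: restr_def frag_extend_add)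

lemma restr_0 [simp]: "restr X 0 = 0"
  by (simp add: restr_def)

lemma restr_restr: "X' \<subseteq> X \<Longrightarrow> restr X' (restr X m) = restr X' m"
  by (rule poly_mapping_eqI) (auto simp: lookup_restr)

definition restr_kernel :: "('h \<Rightarrow>\<^sub>0 int) set \<Rightarrow> 'h set \<Rightarrow> (('h \<Rightarrow>\<^sub>0 int) \<Rightarrow>\<^sub>0 complex) set" where
  "restr_kernel M X =
     {p \<in> carrier (monoid_algebra M). lin_ext (\<lambda>m. Poly_Mapping.single (restr X m) 1) p = 0}"

text \<open>This is the preimage of the zero ideal of the group algebra of all integer vectors,
  which is a domain.\<close>

lemma primeideal_restr_kernel:
  fixes M :: "('h::linorder \<Rightarrow>\<^sub>0 int) set"
  assumes M: "submonoid_add M"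
  shows "primeideal (restr_kernel M X) (monoid_algebra M)"
proof -
  let ?f = "\<lambda>m. Poly_Mapping.single (restr X m) 1 :: ('h \<Rightarrow>\<^sub>0 int) \<Rightarrow>\<^sub>0 complex"
  interpret T: domain "monoid_algebra (UNIV :: ('h \<Rightarrow>\<^sub>0 int) set)"
    by (rule domain_monoid_algebra) (simp add: submonoid_add_def)
  interpret R: cring "monoid_algebra M" by (rule cring_monoid_algebra[OF M])
  interpret ring_hom_ring "monoid_algebra M" "monoid_algebra (UNIV :: ('h \<Rightarrow>\<^sub>0 int) set)" "lin_ext ?f"
    by (rule ring_hom_ringI2[OF R.ring_axioms T.ring_axioms], rule lin_ext_ring_hom)
       (auto simp: restr_add mult_single)
  show ?thesis
    using primeideal_vimage[OF R.is_cring T.zeroprimeideal] unfolding restr_kernel_def by simp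
qed

text \<open>The projection to \<open>X'\<close> factors through the projection to
  \<open>X\<close>.\<close>

lemma restr_kernel_antimono:
  assumes "X' \<subseteq> X"
  shows "restr_kernel M X \<subseteq> restr_kernel M X'"
proof -
  have "lin_ext (\<lambda>m. Poly_Mapping.single (restr X' m) 1) p =
      lin_ext (\<lambda>m. Poly_Mapping.single (restr X' m) 1) (lin_ext (\<lambda>m. Poly_Mapping.single (restr X m) 1) p)" for p
    by (subst (3) lin_ext_def) (simp add: lin_ext_sum mult_single restr_restr[OF assms], simp add: lin_ext_def mult_single)
  then have "lin_ext (\<lambda>m. Poly_Mapping.single (restr X' m) 1) p = 0"
    if "lin_ext (\<lambda>m. Poly_Mapping.single (restr X m) 1) p = 0" for p
    using that by (metis lin_ext_0)
  then show ?thesis unfolding restr_kernel_def by blast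
qed

text \<open>The chain consists of the kernels of the projections to fewer and fewer coordinates.\<close>

lemma krull_dim_ge:
  fixes M :: "('h::linorder \<Rightarrow>\<^sub>0 int) set" and col :: "'h \<Rightarrow> nat"
  assumes M: "submonoid_add M" and X: "finite X" and g: "g ` X \<subseteq> M"
    and diag: "\<And>h. h \<in> X \<Longrightarrow> Poly_Mapping.lookup (g h) h \<noteq> 0"
    and tri: "\<And>h h'. h \<in> X \<Longrightarrow> h' \<in> X \<Longrightarrow> h' \<noteq> h \<Longrightarrow> col h \<le> col h' \<Longrightarrow>
      Poly_Mapping.lookup (g h) h' = 0"
  shows "enat (card X) \<le> krull_dim (monoid_algebra M)"
proof -
  have "\<exists>P. (\<forall>i\<le>card X. primeideal (P i) (monoid_algebra M)) \<and>
      (\<forall>i<card X. P i \<subset> P (Suc i)) \<and> P 0 = restr_kernel M X"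
    using X g diag tri
  proof (induction "card X" arbitrary: X)
    case 0
    then show ?case
      by (intro exI[of _ "\<lambda>_. restr_kernel M X"]) (auto simp: primeideal_restr_kernel[OF M])
  next
    case (Suc n)
    then have "X \<noteq> {}" by auto
    then have "Min (col ` X) \<in> col ` X" using Suc.prems by (intro Min_in) auto
    \<comment> \<open>The coordinate to be dropped has minimal \<open>col\<close>, so that by
      \<open>tri\<close> the vector \<open>g h\<close> vanishes on all others.\<close>
    then obtain h where h: "h \<in> X" "col h = Min (col ` X)" by auto
    define X' where "X' = X - {h}"
    have X': "n = card X'" "finite X'" "X' \<subseteq> X" "h \<notin> X'" using h Suc by (auto simp: X'_def)
    have "\<exists>P. (\<forall>i\<le>card X'. primeideal (P i) (monoid_algebra M)) \<and>
        (\<forall>i<card X'. P i \<subset> P (Suc i)) \<and> P 0 = restr_kernel M X'"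
    proof (rule Suc.hyps(1)[OF X'(1,2)])
      show "g ` X' \<subseteq> M" using Suc.prems(2) X' by auto
      show "Poly_Mapping.lookup (g k) k \<noteq> 0" if "k \<in> X'" for k
        using that Suc.prems(3) X'(3) by blast
      show "Poly_Mapping.lookup (g k) k' = 0"
        if "k \<in> X'" "k' \<in> X'" "k' \<noteq> k" "col k \<le> col k'" for k k'
        using that Suc.prems(4) X'(3) by blast
    qed
    then obtain P where P: "\<forall>i\<le>n. primeideal (P i) (monoid_algebra M)"
        "\<forall>i<n. P i \<subset> P (Suc i)" "P 0 = restr_kernel M X'"
      unfolding X'(1)[symmetric] by blast
    \<comment> \<open>This binomial separates the two kernels: \<open>g h\<close> projects to zero
      on \<open>X'\<close> but not on \<open>X\<close>.\<close>
    define q :: "('h \<Rightarrow>\<^sub>0 int) \<Rightarrow>\<^sub>0 complex" where "q = Poly_Mapping.single (g h) 1 - Poly_Mapping.single 0 1"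
    have q: "Poly_Mapping.keys q \<subseteq> M"
      using Suc.prems(2) h M by (auto simp: q_def in_keys_iff lookup_minus lookup_single lookup_one when_def submonoid_add_def split: if_splits)
    have le: "restr X (g h) \<noteq> 0"
      using Suc.prems(3)[OF h(1)] h(1) by (metis lookup_restr lookup_zero)
    have 0: "restr X' (g h) = 0"
    proof (rule poly_mapping_eqI)
      fix h'
      have "col h \<le> col h'" if "h' \<in> X'" using that h Suc.prems(1) X' by auto
      then show "Poly_Mapping.lookup (restr X' (g h)) h' = Poly_Mapping.lookup 0 h'"
        using Suc.prems(4)[of h h'] h X' by (auto simp: lookup_restr)
    qed
    have "q \<in> restr_kernel M X'"
      using q 0 by (simp add: restr_kernel_def q_def lin_ext_diff)
    moreover have "q \<notin> restr_kernel M X"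
    proof
      assume "q \<in> restr_kernel M X"
      then have "Poly_Mapping.single (restr X (g h)) (1::complex) = Poly_Mapping.single 0 1"
        by (simp add: restr_kernel_def q_def lin_ext_diff)
      then have "Poly_Mapping.lookup (Poly_Mapping.single (restr X (g h)) (1::complex)) (restr X (g h)) =
          Poly_Mapping.lookup (Poly_Mapping.single 0 1) (restr X (g h))" by simp
      then show False using le by (simp add: lookup_one)
    qed
    ultimately have "restr_kernel M X \<subset> P 0" using restr_kernel_antimono[OF X'(3), of M] P(3) by blast
    define P' where "P' = case_nat (restr_kernel M X) P"
    have card: "card X = Suc n" using Suc by simp
    have "\<forall>i\<le>card X. primeideal (P' i) (monoid_algebra M)"
      unfolding card P'_def using P(1) primeideal_restr_kernel[OF M] by (auto split: nat.split)
    moreover have "\<forall>i<card X. P' i \<subset> P' (Suc i)"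
      unfolding card P'_def using P(2) \<open>restr_kernel M X \<subset> P 0\<close> by (auto split: nat.split)
    ultimately show ?case by (intro exI[of _ P']) (simp add: P'_def)
  qed
  then show ?thesis unfolding krull_dim_def by (intro Sup_upper) blast
qed

section \<open>Counting monomials\<close>

lemma total_degree_superset:
  assumes "finite V" "Poly_Mapping.keys m \<subseteq> V"
  shows "total_degree m = (\<Sum>v\<in>V. Poly_Mapping.lookup m v)"
  unfolding total_degree_def using assms by (intro sum.mono_neutral_left) (auto simp: in_keys_iff)

lemma total_degree_add [simp]: "total_degree (m + n) = total_degree m + total_degree n"
proof -
  let ?A = "Poly_Mapping.keys m \<union> Poly_Mapping.keys n"
  show ?thesis using keys_add[of m n]
    by (simp add: total_degree_superset[of ?A] lookup_add sum.distrib)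
qed

lemma total_degree_single [simp]: "total_degree (Poly_Mapping.single v k) = k"
  by (cases "k = 0") (auto simp: total_degree_def)

lemma total_degree_0 [simp]: "total_degree 0 = 0"
  by (simp add: total_degree_def)

lemma total_degree_eq_0_iff: "total_degree m = 0 \<longleftrightarrow> m = 0"
  by (auto simp: total_degree_def in_keys_iff intro!: poly_mapping_eqI)

lemma poly_mapping_minus_single:
  fixes m :: "'v \<Rightarrow>\<^sub>0 nat"
  assumes "Poly_Mapping.lookup m v > 0"
  obtains m' where "m = m' + Poly_Mapping.single v (Suc 0)"
proof
  show "m = (m - Poly_Mapping.single v (Suc 0)) + Poly_Mapping.single v (Suc 0)"
    using assms by (intro poly_mapping_eqI) (auto simp: lookup_add lookup_minus lookup_single when_def)
qed

lemma keys_add_single: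
  "Poly_Mapping.keys (m + Poly_Mapping.single v (Suc 0)) = insert v (Poly_Mapping.keys m)"
  by (auto simp: in_keys_iff lookup_add lookup_single when_def split: if_splits)

text \<open>The monomials in \<open>W\<close> not divisible by any \<open>x y\<close> with
  \<open>(x, y) \<in> E\<close>; they represent a basis of the polynomial ring modulo these
  products.\<close>

definition std_monomials :: "'v set \<Rightarrow> ('v \<times> 'v) set \<Rightarrow> ('v \<Rightarrow>\<^sub>0 nat) set" where
  "std_monomials W E = {m. Poly_Mapping.keys m \<subseteq> W \<and>
     (\<forall>(x, y)\<in>E. Poly_Mapping.lookup m x = 0 \<or> Poly_Mapping.lookup m y = 0)}"

text \<open>A monomial either avoids \<open>v\<close> or is \<open>v\<close> times a monomial of
  degree one less. For the counts this is Pascal's rule.\<close>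

lemma monomials_insert:
  fixes v :: 'v
  assumes v: "v \<notin> W"
  defines "D \<equiv> \<lambda>W n. {m :: 'v \<Rightarrow>\<^sub>0 nat. Poly_Mapping.keys m \<subseteq> W \<and> total_degree m \<le> n}"
  shows "D (insert v W) (Suc n) = D W (Suc n) \<union> (\<lambda>m. m + Poly_Mapping.single v (Suc 0)) ` D (insert v W) n"
    and "D W (Suc n) \<inter> (\<lambda>m. m + Poly_Mapping.single v (Suc 0)) ` D (insert v W) n = {}"
proof -
  show "D (insert v W) (Suc n) = D W (Suc n) \<union> (\<lambda>m. m + Poly_Mapping.single v (Suc 0)) ` D (insert v W) n"
  proof (intro equalityI subsetI)
    fix m assume m: "m \<in> D (insert v W) (Suc n)"
    show "m \<in> D W (Suc n) \<union> (\<lambda>m. m + Poly_Mapping.single v (Suc 0)) ` D (insert v W) n"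
    proof (cases "Poly_Mapping.lookup m v = 0")
      case True
      then show ?thesis using m by (auto simp: D_def in_keys_iff)
    next
      case False
      then obtain m' where m': "m = m' + Poly_Mapping.single v (Suc 0)"
        using poly_mapping_minus_single[of m v] by auto
      then have "m' \<in> D (insert v W) n" using m by (auto simp: D_def keys_add_single)
      then show ?thesis using m' by blast
    qed
  qed (auto simp: D_def keys_add_single)
  show "D W (Suc n) \<inter> (\<lambda>m. m + Poly_Mapping.single v (Suc 0)) ` D (insert v W) n = {}"
    using v by (auto simp: D_def keys_add_single)
qed

lemma card_monomials:
  assumes "finite W"
  shows "finite {m :: 'v \<Rightarrow>\<^sub>0 nat. Poly_Mapping.keys m \<subseteq> W \<and> total_degree m \<le> n} \<and>
    card {m :: 'v \<Rightarrow>\<^sub>0 nat. Poly_Mapping.keys m \<subseteq> W \<and> total_degree m \<le> n} = (n + card W) choose n"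
  using assms
proof (induction W arbitrary: n rule: finite_induct)
  case (insert v W)
  note * = monomials_insert[OF insert.hyps(2)]
  show ?case
  proof (induction n)
    case 0
    have "{m :: 'v \<Rightarrow>\<^sub>0 nat. Poly_Mapping.keys m \<subseteq> insert v W \<and> total_degree m \<le> 0} = {0}"
      by (auto simp: total_degree_eq_0_iff)
    then show ?case by simp
  next
    case (Suc n)
    have inj: "inj_on (\<lambda>m :: 'v \<Rightarrow>\<^sub>0 nat. m + Poly_Mapping.single v (Suc 0)) A" for A
      by (auto simp: inj_on_def)
    show ?case
      unfolding *(1)
      using Suc insert.IH[of "Suc n"] *(2)[of n] insert.hyps
      by (subst card_Un_disjoint) (auto simp: card_image[OF inj])
  qed
next
  case empty
  have "{m :: 'v \<Rightarrow>\<^sub>0 nat. Poly_Mapping.keys m \<subseteq> {} \<and> total_degree m \<le> n} = {0}"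
    by auto
  then show ?case by simp
qed

text \<open>The induction step multiplies by \<open>(n + w + 1) / (w + 1)\<close>, which raises the
  degree by one and divides the leading coefficient by \<open>w + 1\<close>.\<close>

lemma binomial_poly:
  "\<exists>h :: real poly. degree h = w \<and> fact w * lead_coeff h = 1 \<and>
     (\<forall>n. real ((n + w) choose n) = poly h (real n))"
proof (induction w)
  case 0
  then show ?case by (intro exI[of _ 1]) auto
next
  case (Suc w)
  then obtain h :: "real poly" where h: "degree h = w" "fact w * lead_coeff h = 1"
    "\<And>n. real ((n + w) choose n) = poly h (real n)" by blast
  define l where "l = [:real (Suc w), 1:]"
  have l: "degree l = 1" "lead_coeff l = 1" "l \<noteq> 0" "\<And>x. poly l x = real (Suc w) + x"
    by (auto simp: l_def)
  define g where "g = smult (1 / real (Suc w)) (h * l)"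
  have h0: "h \<noteq> 0" using h by auto
  have "degree g = Suc w" using h h0 l by (simp add: g_def degree_mult_eq)
  moreover have "fact (Suc w) * lead_coeff g = 1"
  proof -
    have "lead_coeff g = lead_coeff h / real (Suc w)"
      unfolding g_def lead_coeff_smult lead_coeff_mult l(2) by simp
    then show ?thesis using h(2) by (simp add: field_simps del: of_nat_Suc)
  qed
  moreover have "real ((n + Suc w) choose n) = poly g (real n)" for n
  proof -
    have "Suc w * ((n + Suc w) choose Suc w) = (n + Suc w) * ((n + w) choose w)"
      using Suc_times_binomial[of w "n + w"] by simp
    moreover have "(n + Suc w) choose Suc w = (n + Suc w) choose n" "(n + w) choose w = (n + w) choose n"
      using binomial_symmetric[of n "n + Suc w"] binomial_symmetric[of n "n + w"] by simp_all
    ultimately have "real (Suc w) * real ((n + Suc w) choose n) = real (n + Suc w) * real ((n + w) choose n)"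
      by (metis of_nat_mult)
    then have "real ((n + Suc w) choose n) = real (n + Suc w) * real ((n + w) choose n) / real (Suc w)"
      by (simp add: field_simps del: of_nat_Suc)
    then show ?thesis by (simp add: g_def h(3) l(4) mult.commute)
  qed
  ultimately show ?case by blast
qed

text \<open>If \<open>y\<close> occurs, \<open>x\<close> does not, and after removing one factor
  \<open>y\<close> the pair imposes no condition beyond the absence of \<open>x\<close>. Both parts
  thus have one variable and one pair less.\<close>

lemma std_monomials_insert:
  assumes xy: "x \<noteq> y" and E: "\<And>x' y'. (x', y') \<in> E \<Longrightarrow> y \<noteq> x' \<and> y \<noteq> y'"
  defines "D \<equiv> \<lambda>W E n. {m \<in> std_monomials W E. total_degree m \<le> n}"
  shows "D W (insert (x, y) E) (Suc n) =
      D (W - {y}) E (Suc n) \<union> (if y \<in> W then (\<lambda>m. m + Poly_Mapping.single y (Suc 0)) ` D (W - {x}) E n else {})"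
    and "D (W - {y}) E (Suc n) \<inter> (\<lambda>m. m + Poly_Mapping.single y (Suc 0)) ` D (W - {x}) E n = {}"
proof -
  show "D W (insert (x, y) E) (Suc n) =
      D (W - {y}) E (Suc n) \<union> (if y \<in> W then (\<lambda>m. m + Poly_Mapping.single y (Suc 0)) ` D (W - {x}) E n else {})"
  proof (intro equalityI subsetI)
    fix m assume m: "m \<in> D W (insert (x, y) E) (Suc n)"
    show "m \<in> D (W - {y}) E (Suc n) \<union> (if y \<in> W then (\<lambda>m. m + Poly_Mapping.single y (Suc 0)) ` D (W - {x}) E n else {})"
    proof (cases "Poly_Mapping.lookup m y = 0")
      case True
      then show ?thesis using m by (auto simp: D_def std_monomials_def in_keys_iff)
    next
      case False
      then obtain m' where m': "m = m' + Poly_Mapping.single y (Suc 0)"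
        using poly_mapping_minus_single[of m y] by auto
      moreover have "y \<in> W" using m m' by (auto simp: D_def std_monomials_def keys_add_single)
      moreover have "Poly_Mapping.lookup m x = 0"
        using m False by (auto simp: D_def std_monomials_def)
      then have "m' \<in> D (W - {x}) E n"
        using m m' xy
        by (auto simp: D_def std_monomials_def keys_add_single lookup_add in_keys_iff)
      ultimately show ?thesis by auto
    qed
  next
    fix m assume "m \<in> D (W - {y}) E (Suc n) \<union> (if y \<in> W then (\<lambda>m. m + Poly_Mapping.single y (Suc 0)) ` D (W - {x}) E n else {})"
    then show "m \<in> D W (insert (x, y) E) (Suc n)"
      using E xy
      by (auto simp: D_def std_monomials_def keys_add_single lookup_add lookup_single in_keys_iff
           subset_iff when_def split: if_splits)
  qed
  show "D (W - {y}) E (Suc n) \<inter> (\<lambda>m. m + Poly_Mapping.single y (Suc 0)) ` D (W - {x}) E n = {}"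
    by (auto simp: D_def std_monomials_def keys_add_single)
qed

lemma finite_std_monomials: "finite W \<Longrightarrow> finite {m \<in> std_monomials W E. total_degree m \<le> n}"
  using card_monomials[of W n] by (auto simp: std_monomials_def elim!: finite_subset[rotated])

text \<open>Each pair splits the count into two counts of the same degree and leading coefficient in
  one variable less, so it lowers the degree by one and doubles the normalized leading
  coefficient.\<close>

lemma card_std_monomials:
  assumes "finite E" "finite W"
    and "\<And>x y. (x, y) \<in> E \<Longrightarrow> x \<in> W \<and> y \<in> W \<and> x \<noteq> y"
    and "\<And>x y x' y'. (x, y) \<in> E \<Longrightarrow> (x', y') \<in> E \<Longrightarrow> {x, y} \<inter> {x', y'} \<noteq> {} \<Longrightarrow> (x, y) = (x', y')"
  shows "\<exists>h :: real poly. card W = degree h + card E \<and> fact (degree h) * lead_coeff h = 2 ^ card E \<and>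
    (\<forall>\<^sub>F n in sequentially. real (card {m \<in> std_monomials W E. total_degree m \<le> n}) = poly h (real n))"
  using assms
proof (induction E arbitrary: W rule: finite_induct)
  case empty
  obtain h :: "real poly" where h: "degree h = card W" "fact (card W) * lead_coeff h = 1"
     "\<And>n. real ((n + card W) choose n) = poly h (real n)" using binomial_poly by blast
  have "real (card {m \<in> std_monomials W {}. total_degree m \<le> n}) = poly h (real n)" for n
    using card_monomials[OF empty.prems(1), of n] h(3) by (simp add: std_monomials_def)
  with h show ?case by (intro exI[of _ h]) auto
next
  case (insert e E)
  obtain x y where e: "e = (x, y)" by (cases e)
  have xy: "x \<in> W" "y \<in> W" "x \<noteq> y" using insert.prems(2)[of x y] e by auto
  have disj: "x' \<notin> {x, y} \<and> y' \<notin> {x, y}" if "(x', y') \<in> E" for x' y'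
    using insert.prems(3)[of x y x' y'] that e insert.hyps by auto
  have IH: "\<exists>h :: real poly. card (W - {z}) = degree h + card E \<and> fact (degree h) * lead_coeff h = 2 ^ card E \<and>
    (\<forall>\<^sub>F n in sequentially. real (card {m \<in> std_monomials (W - {z}) E. total_degree m \<le> n}) = poly h (real n))"
    if "z \<in> {x, y}" for z
  proof (rule insert.IH)
    show "\<And>x' y'. (x', y') \<in> E \<Longrightarrow> x' \<in> W - {z} \<and> y' \<in> W - {z} \<and> x' \<noteq> y'"
      using insert.prems(2) disj that by blast
    show "\<And>x y x' y'. (x, y) \<in> E \<Longrightarrow> (x', y') \<in> E \<Longrightarrow> {x, y} \<inter> {x', y'} \<noteq> {} \<Longrightarrow> (x, y) = (x', y')"
      using insert.prems(3)[OF insertI2 insertI2] by blast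
  qed (use insert.prems(1) in auto)
  obtain h1 :: "real poly" where h1: "card (W - {y}) = degree h1 + card E" "fact (degree h1) * lead_coeff h1 = 2 ^ card E"
    "\<forall>\<^sub>F n in sequentially. real (card {m \<in> std_monomials (W - {y}) E. total_degree m \<le> n}) = poly h1 (real n)"
    using IH[of y] by blast
  obtain h2 :: "real poly" where h2: "card (W - {x}) = degree h2 + card E" "fact (degree h2) * lead_coeff h2 = 2 ^ card E"
    "\<forall>\<^sub>F n in sequentially. real (card {m \<in> std_monomials (W - {x}) E. total_degree m \<le> n}) = poly h2 (real n)"
    using IH[of x] by blast
  have deg: "degree h1 = degree h2" using h1(1) h2(1) xy insert.prems(1) by simp
  \<comment> \<open>The second part is counted up to degree \<open>n\<close> when the whole is
    counted up to \<open>Suc n\<close>. Shifting the argument by one does not change the leading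
    term.\<close>
  define q where "q = pcompose h2 [:- 1, 1:]"
  have q: "degree q = degree h1" "lead_coeff q = lead_coeff h1"
  proof -
    show "degree q = degree h1" by (simp add: q_def deg degree_pcompose)
    have "lead_coeff q = lead_coeff h2" unfolding q_def by (subst lead_coeff_comp) auto
    moreover have "lead_coeff h2 = lead_coeff h1" using h1(2) h2(2) deg
      by (metis fact_nonzero mult_cancel_left)
    ultimately show "lead_coeff q = lead_coeff h1" by simp
  qed
  have lc: "coeff (h1 + q) (degree h1) = 2 * lead_coeff h1" using q by simp
  have "lead_coeff h1 \<noteq> 0" using h1(2) by auto
  then have dg: "degree (h1 + q) = degree h1"
    using lc q by (intro antisym degree_add_le le_degree) auto
  have "card W = degree (h1 + q) + card (insert e E)"
    using dg h1(1) xy insert.prems(1) insert.hyps by (simp add: card_Diff_singleton) (metis card_gt_0_iff empty_iff Suc_pred)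
  moreover have "fact (degree (h1 + q)) * lead_coeff (h1 + q) = 2 ^ card (insert e E)"
    using dg lc h1(2) insert.hyps by simp
  moreover have "\<forall>\<^sub>F n in sequentially. real (card {m \<in> std_monomials W (insert e E). total_degree m \<le> n}) = poly (h1 + q) (real n)"
  proof -
    have "\<forall>\<^sub>F n in sequentially. real (card {m \<in> std_monomials W (insert e E). total_degree m \<le> Suc n}) = poly (h1 + q) (real (Suc n))"
      using h2(3) h1(3)[THEN eventually_sequentially_Suc[THEN iffD2]]
    proof eventually_elim
      case (elim n)
      have inj: "inj_on (\<lambda>m :: 'a \<Rightarrow>\<^sub>0 nat. m + Poly_Mapping.single y (Suc 0)) A" for A
        by (auto simp: inj_on_def)
      let ?A = "{m \<in> std_monomials (W - {y}) E. total_degree m \<le> Suc n}"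
      let ?B = "(\<lambda>m. m + Poly_Mapping.single y (Suc 0)) ` {m \<in> std_monomials (W - {x}) E. total_degree m \<le> n}"
      have disj': "y \<noteq> x' \<and> y \<noteq> y'" if "(x', y') \<in> E" for x' y' using disj[OF that] by auto
      note * = std_monomials_insert[OF xy(3) disj', where W = W and n = n]
      have "{m \<in> std_monomials W (insert e E). total_degree m \<le> Suc n} = ?A \<union> ?B"
        using *(1) xy(2) by (simp add: e)
      moreover have "card (?A \<union> ?B) = card ?A + card ?B"
        using *(2) finite_std_monomials[of "W - {x}"] finite_std_monomials[of "W - {y}"] insert.prems(1)
        by (intro card_Un_disjoint finite_imageI) auto
      ultimately have "card {m \<in> std_monomials W (insert e E). total_degree m \<le> Suc n} =
          card {m \<in> std_monomials (W - {y}) E. total_degree m \<le> Suc n} +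
          card {m \<in> std_monomials (W - {x}) E. total_degree m \<le> n}"
        by (simp add: card_image[OF inj])
      then show ?case using elim by (simp add: q_def poly_pcompose)
    qed
    then show ?thesis by (rule eventually_sequentially_Suc[THEN iffD1])
  qed
  ultimately show ?case by blast
qed

text \<open>Beyond \<open>n0\<close> the sum of the absolute values of the coefficients is a
  sufficient constant; below, monotonicity bounds \<open>N n\<close> by \<open>N n0\<close>.\<close>

lemma poly_growth:
  fixes h :: "real poly" and N :: "nat \<Rightarrow> nat"
  assumes "mono N" "\<forall>\<^sub>F n in sequentially. real (N n) = poly h (real n)"
  shows "\<exists>C. \<forall>n. N n \<le> C * Suc n ^ degree h"
proof -
  obtain n0 where n0: "\<And>n. n \<ge> n0 \<Longrightarrow> real (N n) = poly h (real n)"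
    using assms(2) by (auto simp: eventually_sequentially)
  define K where "K = (\<Sum>i\<le>degree h. \<bar>coeff h i\<bar>)"
  have K: "poly h (real n) \<le> K * real (Suc n) ^ degree h" for n
  proof -
    have "coeff h i * real n ^ i \<le> \<bar>coeff h i\<bar> * real (Suc n) ^ degree h" if "i \<le> degree h" for i
    proof (intro mult_mono)
      have "real n ^ i \<le> real (Suc n) ^ i" by (intro power_mono) auto
      also have "\<dots> \<le> real (Suc n) ^ degree h" using that by (intro power_increasing) auto
      finally show "real n ^ i \<le> real (Suc n) ^ degree h" .
    qed auto
    then show ?thesis
      unfolding poly_altdef K_def sum_distrib_right by (intro sum_mono) auto
  qed
  have "K \<ge> 0" by (simp add: K_def sum_nonneg)
  define C where "C = N n0 + nat \<lceil>K\<rceil>"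
  have "N n \<le> C * Suc n ^ degree h" for n
  proof (cases "n \<ge> n0")
    case True
    have "K \<le> real C" using real_nat_ceiling_ge[of K] by (simp add: C_def)
    then have "real (N n) \<le> real C * real (Suc n) ^ degree h"
      using K[of n] n0[OF True] by (metis mult_right_mono order_trans of_nat_0_le_iff zero_le_power)
    then show ?thesis by (metis of_nat_le_iff of_nat_mult of_nat_power)
  next
    case False
    then have "N n \<le> N n0" using assms(1) by (intro monoD[of N]) auto
    also have "\<dots> \<le> C * 1" by (simp add: C_def)
    also have "\<dots> \<le> C * Suc n ^ degree h" by (intro mult_left_mono) auto
    finally show ?thesis .
  qed
  then show ?thesis by blast
qed

section \<open>Vector space dimensions\<close>

context
  fixes M :: "'m::comm_monoid_add set"
  assumes M: "submonoid_add M"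
begin

interpretation R: cring "monoid_algebra M" by (rule cring_monoid_algebra[OF M])

lemma subfield_constants: "subfield (range (Poly_Mapping.single 0)) (monoid_algebra M)"
proof -
  let ?K = "range (Poly_Mapping.single 0) :: ('m \<Rightarrow>\<^sub>0 complex) set"
  have 0: "0 \<in> M" using M by (simp add: submonoid_add_def)
  have neg: "\<ominus>\<^bsub>monoid_algebra M\<^esub> Poly_Mapping.single 0 z = Poly_Mapping.single 0 (- z)" for z :: complex
  proof (rule R.minus_equality)
    show "Poly_Mapping.single 0 (- z) \<oplus>\<^bsub>monoid_algebra M\<^esub> Poly_Mapping.single 0 z = \<zero>\<^bsub>monoid_algebra M\<^esub>"
      by (simp flip: single_add)
  qed (use 0 in auto)
  have sub: "subring ?K (monoid_algebra M)"
  proof (rule R.subringI)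
    show "\<one>\<^bsub>monoid_algebra M\<^esub> \<in> ?K" using single_one[symmetric] by (metis monoid_algebra_simps(4) rangeI)
    show "?K \<subseteq> carrier (monoid_algebra M)" using 0 by (auto split: if_splits)
  next
    fix h assume "h \<in> ?K" then show "\<ominus>\<^bsub>monoid_algebra M\<^esub> h \<in> ?K" by (auto simp: neg)
  next
    fix h k assume "h \<in> ?K" "k \<in> ?K"
    then show "h \<otimes>\<^bsub>monoid_algebra M\<^esub> k \<in> ?K" "h \<oplus>\<^bsub>monoid_algebra M\<^esub> k \<in> ?K"
      by (auto simp: mult_single simp flip: single_add)
  qed
  show ?thesis
  proof (rule R.subfieldI)
    show "subcring ?K (monoid_algebra M)"
      using sub by (rule R.subcringI) (auto simp: mult.commute)
    show "Units ((monoid_algebra M)\<lparr>carrier := ?K\<rparr>) = ?K - {\<zero>\<^bsub>monoid_algebra M\<^esub>}"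
    proof (intro equalityI subsetI)
      fix x assume "x \<in> Units ((monoid_algebra M)\<lparr>carrier := ?K\<rparr>)"
      then show "x \<in> ?K - {\<zero>\<^bsub>monoid_algebra M\<^esub>}" by (auto simp: Units_def)
    next
      fix x assume "x \<in> ?K - {\<zero>\<^bsub>monoid_algebra M\<^esub>}"
      then obtain z where z: "x = Poly_Mapping.single 0 z" "x \<noteq> 0" by auto
      then have "z \<noteq> 0" by auto
      then have "x * Poly_Mapping.single 0 (1 / z) = 1" "Poly_Mapping.single 0 (1 / z) * x = 1"
        using z(1) by (simp_all add: mult_single)
      then show "x \<in> Units ((monoid_algebra M)\<lparr>carrier := ?K\<rparr>)" using z by (auto simp: Units_def)
    qed
  qed
qed

text \<open>Each exponent added to \<open>X\<close> extends the space by one line.\<close>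

lemma dimension_monoid_algebra:
  assumes "finite X" "X \<subseteq> M"
  shows "ring.dimension (monoid_algebra M) (card X) (range (Poly_Mapping.single 0)) {p. Poly_Mapping.keys p \<subseteq> X}"
  using assms
proof (induction X rule: finite_induct)
  case empty
  have "{p. Poly_Mapping.keys p \<subseteq> {}} = {\<zero>\<^bsub>monoid_algebra M\<^esub>}" by auto
  then show ?case by (metis R.zero_dim card.empty)
next
  case (insert x X)
  let ?K = "range (Poly_Mapping.single 0) :: ('m \<Rightarrow>\<^sub>0 complex) set"
  let ?E = "\<lambda>X. {p :: 'm \<Rightarrow>\<^sub>0 complex. Poly_Mapping.keys p \<subseteq> X}"
  have "R.line_extension ?K (Poly_Mapping.single x 1) (?E X) = ?E (insert x X)"
  proof (intro equalityI subsetI)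
    fix p assume "p \<in> R.line_extension ?K (Poly_Mapping.single x 1) (?E X)"
    then obtain z e where "p = Poly_Mapping.single x z + e" "e \<in> ?E X"
      by (auto simp: R.line_extension_mem_iff mult_single)
    then show "p \<in> ?E (insert x X)"
      using keys_add[of "Poly_Mapping.single x z" e] by (auto split: if_splits)
  next
    fix p assume p: "p \<in> ?E (insert x X)"
    define e where "e = p - Poly_Mapping.single x (Poly_Mapping.lookup p x)"
    have "e \<in> ?E X" using p
      by (auto simp: e_def in_keys_iff lookup_minus lookup_single when_def split: if_splits)
    moreover have "p = Poly_Mapping.single 0 (Poly_Mapping.lookup p x) * Poly_Mapping.single x 1 + e"
      by (simp add: e_def mult_single)
    ultimately show "p \<in> R.line_extension ?K (Poly_Mapping.single x 1) (?E X)"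
      unfolding R.line_extension_mem_iff by auto
  qed
  moreover have "R.dimension (Suc (card X)) ?K (R.line_extension ?K (Poly_Mapping.single x 1) (?E X))"
    using insert by (intro R.Suc_dim) auto
  ultimately show ?case using insert by simp
qed

text \<open>The dimension is taken inside \<open>R\<close>, over a subfield of \<open>R\<close>. It
  is found by carrying the monoid algebra into \<open>R\<close> with the inverse of
  \<open>\<phi>\<close>, an injective homomorphism.\<close>

lemma dim_iso_monoid_algebra:
  assumes R: "ring R" and \<phi>: "\<phi> \<in> ring_iso R (monoid_algebra M)" and X: "finite X" "X \<subseteq> M"
    and K: "K \<subseteq> carrier R" "\<phi> ` K = range (Poly_Mapping.single 0)"
    and E: "E \<subseteq> carrier R" "\<phi> ` E = {p. Poly_Mapping.keys p \<subseteq> X}"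
  shows "ring.dim R K E = card X"
proof -
  interpret R': ring R by fact
  define \<psi> where "\<psi> = inv_into (carrier R) \<phi>"
  have \<psi>: "\<psi> \<in> ring_iso (monoid_algebra M) R"
    unfolding \<psi>_def by (rule ring_iso_set_sym[OF R \<phi>])
  interpret h: ring_hom_ring "monoid_algebra M" R \<psi>
    using \<psi> by (intro ring_hom_ringI2 R R.ring_axioms) (auto simp: ring_iso_def)
  have inj: "inj_on \<psi> (carrier (monoid_algebra M))" using \<psi> by (auto simp: ring_iso_def bij_betw_def)
  have inj': "inj_on \<phi> (carrier R)" using \<phi> by (auto simp: ring_iso_def bij_betw_def)
  have im: "\<psi> ` (\<phi> ` A) = A" if "A \<subseteq> carrier R" for A
    unfolding \<psi>_def by (rule inv_into_image_cancel[OF inj' that])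
  have "\<one>\<^bsub>R\<^esub> \<noteq> \<zero>\<^bsub>R\<^esub>"
  proof
    assume "\<one>\<^bsub>R\<^esub> = \<zero>\<^bsub>R\<^esub>"
    then have "\<psi> \<one>\<^bsub>monoid_algebra M\<^esub> = \<psi> \<zero>\<^bsub>monoid_algebra M\<^esub>"
      using h.hom_one h.hom_zero by metis
    then have "\<one>\<^bsub>monoid_algebra M\<^esub> = \<zero>\<^bsub>monoid_algebra M\<^esub>" using inj by (auto simp: inj_on_def simp del: monoid_algebra_simps)
    then show False by simp
  qed
  note * = h.inj_hom_dimension[OF subfield_constants this]
  have "R'.dimension (card X) (\<psi> ` (\<phi> ` K)) (\<psi> ` (\<phi> ` E))"
    unfolding K(2) E(2) using dimension_monoid_algebra[OF X] X inj
    by (intro *) (auto elim!: inj_on_subset)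
  moreover have "subfield (\<psi> ` (\<phi> ` K)) R"
    unfolding K(2) by (rule h.img_is_subfield(2)[OF subfield_constants \<open>\<one>\<^bsub>R\<^esub> \<noteq> \<zero>\<^bsub>R\<^esub>\<close>])
  ultimately show ?thesis
    using R'.dimI[of K "card X" E] unfolding im[OF K(1)] im[OF E(1)] by (simp add: over_def)
qed

end

section \<open>Toric maps\<close>

definition weight_degree :: "('v \<Rightarrow> 'h \<Rightarrow>\<^sub>0 int) \<Rightarrow> ('v \<Rightarrow>\<^sub>0 nat) \<Rightarrow> 'h \<Rightarrow>\<^sub>0 int" where
  "weight_degree dg m = (\<Sum>v\<in>Poly_Mapping.keys m. frag_cmul (int (Poly_Mapping.lookup m v)) (dg v))"

definition weight_coeff :: "('v \<Rightarrow> complex) \<Rightarrow> ('v \<Rightarrow>\<^sub>0 nat) \<Rightarrow> complex" where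
  "weight_coeff \<epsilon> m = (\<Prod>v\<in>Poly_Mapping.keys m. \<epsilon> v ^ Poly_Mapping.lookup m v)"

text \<open>A variable \<open>v\<close> goes to \<open>\<epsilon> v\<close> times the basis element
  of degree \<open>dg v\<close>. The value \<open>\<epsilon> v = 0\<close> kills the variable, so
  deleted and surviving variables are treated alike.\<close>

definition toric_map ::
  "('v \<Rightarrow> 'h \<Rightarrow>\<^sub>0 int) \<Rightarrow> ('v \<Rightarrow> complex) \<Rightarrow> (('v \<Rightarrow>\<^sub>0 nat) \<Rightarrow>\<^sub>0 complex) \<Rightarrow> ('h \<Rightarrow>\<^sub>0 int) \<Rightarrow>\<^sub>0 complex" where
  "toric_map dg \<epsilon> = lin_ext (\<lambda>m. Poly_Mapping.single (weight_degree dg m) (weight_coeff \<epsilon> m))"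

lemma weight_degree_superset:
  assumes "finite A" "Poly_Mapping.keys m \<subseteq> A"
  shows "weight_degree dg m = (\<Sum>v\<in>A. frag_cmul (int (Poly_Mapping.lookup m v)) (dg v))"
  unfolding weight_degree_def using assms by (intro sum.mono_neutral_left) (auto simp: in_keys_iff)

lemma weight_degree_add [simp]: "weight_degree dg (m + n) = weight_degree dg m + weight_degree dg n"
proof -
  let ?A = "Poly_Mapping.keys m \<union> Poly_Mapping.keys n"
  show ?thesis using keys_add[of m n]
    by (simp add: weight_degree_superset[of ?A] lookup_add frag_cmul_distrib sum.distrib)
qed

lemma weight_degree_0 [simp]: "weight_degree dg 0 = 0" by (simp add: weight_degree_def)

lemma weight_degree_single [simp]: "weight_degree dg (Poly_Mapping.single v k) = frag_cmul (int k) (dg v)"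
  by (cases "k = 0") (auto simp: weight_degree_def)

lemma weight_coeff_superset:
  assumes "finite A" "Poly_Mapping.keys m \<subseteq> A"
  shows "weight_coeff \<epsilon> m = (\<Prod>v\<in>A. \<epsilon> v ^ Poly_Mapping.lookup m v)"
  unfolding weight_coeff_def using assms by (intro prod.mono_neutral_left) (auto simp: in_keys_iff)

lemma weight_coeff_add [simp]: "weight_coeff \<epsilon> (m + n) = weight_coeff \<epsilon> m * weight_coeff \<epsilon> n"
proof -
  let ?A = "Poly_Mapping.keys m \<union> Poly_Mapping.keys n"
  show ?thesis using keys_add[of m n]
    by (simp add: weight_coeff_superset[of ?A] lookup_add power_add prod.distrib)
qed

lemma weight_coeff_0 [simp]: "weight_coeff \<epsilon> 0 = 1" by (simp add: weight_coeff_def)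

lemma weight_coeff_single [simp]: "weight_coeff \<epsilon> (Poly_Mapping.single v k) = \<epsilon> v ^ k"
  by (cases "k = 0") (auto simp: weight_coeff_def)

lemma weight_coeff_eq_0_iff: "weight_coeff \<epsilon> m = 0 \<longleftrightarrow> (\<exists>v\<in>Poly_Mapping.keys m. \<epsilon> v = 0)"
  by (auto simp: weight_coeff_def in_keys_iff)

lemma toric_map_add: "toric_map dg \<epsilon> (p + q) = toric_map dg \<epsilon> p + toric_map dg \<epsilon> q"
  by (simp add: toric_map_def lin_ext_add)

lemma toric_map_mult: "toric_map dg \<epsilon> (p * q) = toric_map dg \<epsilon> p * toric_map dg \<epsilon> q"
  unfolding toric_map_def by (rule lin_ext_mult) (simp add: mult_single)

lemma toric_map_single:
  "toric_map dg \<epsilon> (Poly_Mapping.single m z) = Poly_Mapping.single (weight_degree dg m) (z * weight_coeff \<epsilon> m)"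
  by (simp add: toric_map_def mult_single)

lemma toric_map_var: "toric_map dg \<epsilon> (var v) = Poly_Mapping.single (dg v) (\<epsilon> v)"
  by (simp add: var_def toric_map_single)

lemma toric_map_const: "toric_map dg \<epsilon> (const z) = Poly_Mapping.single 0 z"
  by (simp add: const_def toric_map_single)

lemma lookup_toric_map:
  "Poly_Mapping.lookup (toric_map dg \<epsilon> p) f =
     (\<Sum>m | m \<in> Poly_Mapping.keys p \<and> weight_degree dg m = f. Poly_Mapping.lookup p m * weight_coeff \<epsilon> m)"
  unfolding toric_map_def lin_ext_def lookup_sum lookup_single_0_mult lookup_single when_def
  by (simp add: if_distrib sum.inter_filter[symmetric] cong: if_cong)

definition weight_monoid :: "('v \<Rightarrow> 'h \<Rightarrow>\<^sub>0 int) \<Rightarrow> 'v set \<Rightarrow> ('h \<Rightarrow>\<^sub>0 int) set" where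
  "weight_monoid dg W = weight_degree dg ` {m. Poly_Mapping.keys m \<subseteq> W}"

lemma submonoid_weight_monoid: "submonoid_add (weight_monoid dg W)"
  unfolding submonoid_add_def weight_monoid_def
proof (intro conjI ballI)
  show "0 \<in> weight_degree dg ` {m. Poly_Mapping.keys m \<subseteq> W}" by (intro image_eqI[of _ _ 0]) auto
next
  fix x y assume "x \<in> weight_degree dg ` {m. Poly_Mapping.keys m \<subseteq> W}"
    "y \<in> weight_degree dg ` {m. Poly_Mapping.keys m \<subseteq> W}"
  then obtain m n where "x = weight_degree dg m" "y = weight_degree dg n"
    "Poly_Mapping.keys m \<subseteq> W" "Poly_Mapping.keys n \<subseteq> W" by blast
  then show "x + y \<in> weight_degree dg ` {m. Poly_Mapping.keys m \<subseteq> W}"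
    using keys_add[of m n] by (intro image_eqI[of _ _ "m + n"]) auto
qed

lemma single_in_poly_ring [simp]: "Poly_Mapping.keys m \<subseteq> V \<Longrightarrow> Poly_Mapping.single m z \<in> carrier (poly_ring V)"
  by auto

text \<open>Monomials containing a killed variable go to zero, so the image is supported on the
  degrees of monomials in \<open>W\<close>.\<close>

lemma toric_map_hom:
  fixes V :: "'v set" and dg :: "'v \<Rightarrow> 'h \<Rightarrow>\<^sub>0 int" and \<epsilon>
  defines "W \<equiv> {v \<in> V. \<epsilon> v \<noteq> 0}"
  shows "toric_map dg \<epsilon> \<in> ring_hom (poly_ring V) (monoid_algebra (weight_monoid dg W))"
  unfolding toric_map_def poly_ring_def
proof (rule lin_ext_ring_hom)
  fix m :: "'v \<Rightarrow>\<^sub>0 nat" assume "m \<in> {m. Poly_Mapping.keys m \<subseteq> V}"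
  then show "Poly_Mapping.keys (Poly_Mapping.single (weight_degree dg m) (weight_coeff \<epsilon> m)) \<subseteq> weight_monoid dg W"
    by (auto simp: weight_coeff_eq_0_iff W_def weight_monoid_def)
qed (simp_all add: mult_single)

text \<open>\<open>W\<close> consists of the surviving variables. \<open>\<rho>\<close> gives for
  each the coordinate of largest column in its degree, and \<open>dg_rho\<close> and
  \<open>dg_col\<close> state the triangular shape. By \<open>fib\<close> and
  \<open>inj_lead\<close>, at most two surviving variables share this coordinate, and two that do
  form the leading pair \<open>lx i\<close>, \<open>ly i\<close> of a relation, whose trailing pair
  \<open>tx i\<close>, \<open>ty i\<close> lies in smaller columns. By \<open>dg_rel\<close> and
  \<open>\<epsilon>_rel\<close> the relations map to zero.\<close>

locale toric =
  fixes V :: "'v set" and dg :: "'v \<Rightarrow> 'h::linorder \<Rightarrow>\<^sub>0 int" and \<epsilon> :: "'v \<Rightarrow> complex"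
    and \<rho> :: "'v \<Rightarrow> 'h" and col :: "'h \<Rightarrow> nat"
    and I :: "'i set" and lx ly tx ty :: "'i \<Rightarrow> 'v" and W :: "'v set"
  defines "W \<equiv> {v \<in> V. \<epsilon> v \<noteq> 0}"
  assumes finite_V: "finite V"
    and lead: "i \<in> I \<Longrightarrow> lx i \<in> W \<and> ly i \<in> W \<and> lx i \<noteq> ly i \<and> \<rho> (ly i) = \<rho> (lx i)"
    and trail: "i \<in> I \<Longrightarrow> tx i \<in> W \<and> ty i \<in> W \<and> col (\<rho> (tx i)) < col (\<rho> (lx i)) \<and> col (\<rho> (ty i)) < col (\<rho> (lx i))"
    and dg_rel: "i \<in> I \<Longrightarrow> dg (lx i) + dg (ly i) = dg (tx i) + dg (ty i)"
    and \<epsilon>_rel: "i \<in> I \<Longrightarrow> \<epsilon> (lx i) * \<epsilon> (ly i) = - (\<epsilon> (tx i) * \<epsilon> (ty i))"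
    and fib: "v \<in> W \<Longrightarrow> v' \<in> W \<Longrightarrow> v \<noteq> v' \<Longrightarrow> \<rho> v = \<rho> v' \<Longrightarrow> \<exists>i\<in>I. {v, v'} = {lx i, ly i}"
    and inj_lead: "inj_on (\<lambda>i. \<rho> (lx i)) I"
    and dg_rho: "v \<in> W \<Longrightarrow> Poly_Mapping.lookup (dg v) (\<rho> v) \<noteq> 0"
    and dg_lead: "i \<in> I \<Longrightarrow> Poly_Mapping.lookup (dg (lx i)) (\<rho> (lx i)) = - Poly_Mapping.lookup (dg (ly i)) (\<rho> (lx i))"
    and dg_col: "v \<in> W \<Longrightarrow> Poly_Mapping.lookup (dg v) h \<noteq> 0 \<Longrightarrow> h \<noteq> \<rho> v \<Longrightarrow> col h < col (\<rho> v)"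
begin

abbreviation "Mon \<equiv> weight_monoid dg W"
abbreviation "\<Phi> \<equiv> toric_map dg \<epsilon>"

definition rel :: "'i \<Rightarrow> ('v \<Rightarrow>\<^sub>0 nat) \<Rightarrow>\<^sub>0 complex" where
  "rel i = var (tx i) * var (ty i) + var (lx i) * var (ly i)"

definition gens :: "(('v \<Rightarrow>\<^sub>0 nat) \<Rightarrow>\<^sub>0 complex) set" where
  "gens = var ` (V - W) \<union> rel ` I"

definition leads :: "('v \<times> 'v) set" where
  "leads = (\<lambda>i. (lx i, ly i)) ` I"

lemma W_sub: "W \<subseteq> V" and finite_W: "finite W"
  using finite_V by (auto simp: W_def)

lemma var_in_poly_ring: "v \<in> V \<Longrightarrow> var v \<in> carrier (poly_ring V)"
  unfolding var_def by (rule single_in_poly_ring) auto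

lemma rel_eq: "rel i = Poly_Mapping.single (Poly_Mapping.single (tx i) 1 + Poly_Mapping.single (ty i) 1) 1
    + Poly_Mapping.single (Poly_Mapping.single (lx i) 1 + Poly_Mapping.single (ly i) 1) 1"
  by (simp add: rel_def var_def mult_single)

lemma keys_add_le: "Poly_Mapping.keys m \<subseteq> A \<Longrightarrow> Poly_Mapping.keys n \<subseteq> A \<Longrightarrow> Poly_Mapping.keys (m + n :: 'v \<Rightarrow>\<^sub>0 nat) \<subseteq> A"
  using keys_add[of m n] by blast

lemma rel_in_poly_ring:
  assumes i: "i \<in> I"
  shows "rel i \<in> carrier (poly_ring V)"
proof -
  have *: "Poly_Mapping.keys (Poly_Mapping.single x (1::nat) + Poly_Mapping.single y 1) \<subseteq> V"
    if "x \<in> W" "y \<in> W" for x y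
    using that W_sub by (intro keys_add_le) auto
  interpret cring "poly_ring V" by (rule cring_poly_ring)
  show ?thesis
    unfolding rel_eq poly_ring_simps(3)[of V, symmetric]
    using lead[OF i] trail[OF i] by (intro a_closed single_in_poly_ring *) auto
qed

lemma gens_carrier: "gens \<subseteq> carrier (poly_ring V)"
  using var_in_poly_ring rel_in_poly_ring by (auto simp: gens_def simp del: poly_ring_simps)

interpretation R: cring "poly_ring V" by (rule cring_poly_ring)

interpretation T: domain "monoid_algebra Mon"
  by (rule domain_monoid_algebra[OF submonoid_weight_monoid])

interpretation hom: ring_hom_ring "poly_ring V" "monoid_algebra Mon" \<Phi>
  unfolding W_def by (rule ring_hom_ringI2[OF R.ring_axioms T.ring_axioms[unfolded W_def] toric_map_hom])

lemma rel_kernel: "i \<in> I \<Longrightarrow> \<Phi> (rel i) = 0"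
  by (simp add: rel_def toric_map_add toric_map_mult toric_map_var mult_single dg_rel \<epsilon>_rel flip: single_add)

abbreviation "J \<equiv> Idl\<^bsub>poly_ring V\<^esub> gens"

lemma ideal_J: "ideal J (monoid_algebra {m. Poly_Mapping.keys m \<subseteq> V})"
  using R.genideal_ideal[OF gens_carrier] by (simp only: poly_ring_def)

lemmas J_diff = ideal_monoid_algebra_diff[OF submonoid_add_keys ideal_J]
  and J_0 = ideal_monoid_algebra_0[OF submonoid_add_keys ideal_J]
  and J_sum = ideal_monoid_algebra_sum[OF submonoid_add_keys ideal_J]

lemma J_mult: "x \<in> J \<Longrightarrow> y \<in> carrier (poly_ring V) \<Longrightarrow> y * x \<in> J"
  using ideal_monoid_algebra_mult[OF submonoid_add_keys ideal_J, of x y] by (simp add: subset_iff)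

lemma J_gens: "x \<in> gens \<Longrightarrow> x \<in> J"
  using R.genideal_self[OF gens_carrier] by blast

lemma mem_kernel_iff:
  "p \<in> a_kernel (poly_ring V) (monoid_algebra Mon) \<Phi> \<longleftrightarrow> p \<in> carrier (poly_ring V) \<and> \<Phi> p = 0"
  by (simp only: a_kernel_def' monoid_algebra_simps mem_Collect_eq)

lemma J_kernel:
  assumes "p \<in> J"
  shows "\<Phi> p = 0"
proof -
  have "gens \<subseteq> a_kernel (poly_ring V) (monoid_algebra Mon) \<Phi>"
  proof
    fix p assume p: "p \<in> gens"
    then consider v where "p = var v" "\<epsilon> v = 0" | i where "p = rel i" "i \<in> I"
      by (auto simp: gens_def W_def)
    then have "\<Phi> p = 0" by cases (simp_all add: rel_kernel toric_map_var)
    moreover have "p \<in> carrier (poly_ring V)" using gens_carrier p by blast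
    ultimately show "p \<in> a_kernel (poly_ring V) (monoid_algebra Mon) \<Phi>"
      by (simp only: mem_kernel_iff)
  qed
  then have "J \<subseteq> a_kernel (poly_ring V) (monoid_algebra Mon) \<Phi>"
    by (rule R.genideal_minimal[OF hom.kernel_is_ideal])
  then show ?thesis using assms mem_kernel_iff by blast
qed

abbreviation "std \<equiv> std_monomials W leads"

text \<open>Replacing a leading pair by the trailing pair of its relation lowers the total column weight.\<close>

lemma reduce:
  assumes "Poly_Mapping.keys m \<subseteq> W"
  shows "\<exists>m'\<in>std. weight_degree dg m' = weight_degree dg m \<and> total_degree m' = total_degree m \<and>
    (\<exists>s. Poly_Mapping.single m 1 - Poly_Mapping.single m' s \<in> J)"
  using assms
proof (induction "\<Sum>v\<in>W. Poly_Mapping.lookup m v * col (\<rho> v)" arbitrary: m rule: less_induct)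
  case less
  show ?case
  proof (cases "m \<in> std")
    case True
    then show ?thesis using J_0 by (intro bexI[of _ m] conjI exI[of _ 1]) auto
  next
    case False
    then obtain i where i: "i \<in> I" "Poly_Mapping.lookup m (lx i) > 0" "Poly_Mapping.lookup m (ly i) > 0"
      using less.prems by (auto simp: std_monomials_def leads_def)
    note l = lead[OF i(1)] and t = trail[OF i(1)]
    obtain r0 where r0: "m = r0 + Poly_Mapping.single (lx i) 1"
      using poly_mapping_minus_single[OF i(2)] by (metis One_nat_def)
    have "Poly_Mapping.lookup r0 (ly i) > 0" using i(3) l by (simp add: r0 lookup_add lookup_single)
    then obtain r where r1: "r0 = r + Poly_Mapping.single (ly i) 1"
      using poly_mapping_minus_single by (metis One_nat_def)
    let ?l = "Poly_Mapping.single (lx i) 1 + Poly_Mapping.single (ly i) (1::nat)"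
    let ?t = "Poly_Mapping.single (tx i) 1 + Poly_Mapping.single (ty i) (1::nat)"
    define n where "n = r + ?t"
    have m: "m = r + ?l" by (simp add: r0 r1 ac_simps)
    have r: "Poly_Mapping.keys r \<subseteq> W" using less.prems by (auto simp: m in_keys_iff lookup_add)
    have n: "Poly_Mapping.keys n \<subseteq> W" unfolding n_def using r t by (intro keys_add_le) auto
    have wt: "(\<Sum>v\<in>W. Poly_Mapping.lookup (r + (Poly_Mapping.single x 1 + Poly_Mapping.single y 1)) v * col (\<rho> v)) =
        (\<Sum>v\<in>W. Poly_Mapping.lookup r v * col (\<rho> v)) + col (\<rho> x) + col (\<rho> y)" if "x \<in> W" "y \<in> W" for x y
    proof -
      have "(\<Sum>v\<in>W. Poly_Mapping.lookup (Poly_Mapping.single z (1::nat)) v * col (\<rho> v)) = col (\<rho> z)" if "z \<in> W" for z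
        using that finite_W by (simp add: lookup_single when_def if_distrib[of "\<lambda>x. x * _"] cong: if_cong)
      from this[OF that(1)] this[OF that(2)] show ?thesis
        by (simp add: lookup_add distrib_right sum.distrib)
    qed
    have "(\<Sum>v\<in>W. Poly_Mapping.lookup n v * col (\<rho> v)) < (\<Sum>v\<in>W. Poly_Mapping.lookup m v * col (\<rho> v))"
      unfolding n_def m using wt[of "tx i" "ty i"] wt[of "lx i" "ly i"] l t by simp
    from less.hyps[OF this n] obtain m' s where m': "m' \<in> std" "weight_degree dg m' = weight_degree dg n"
      "total_degree m' = total_degree n" "Poly_Mapping.single n 1 - Poly_Mapping.single m' s \<in> J" by blast
    have "rel i \<in> J" by (rule J_gens) (use i in \<open>auto simp: gens_def\<close>)
    then have "Poly_Mapping.single r 1 * rel i \<in> J"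
      by (rule J_mult) (use r W_sub in auto)
    moreover have "Poly_Mapping.single r 1 * rel i = Poly_Mapping.single n 1 + Poly_Mapping.single m 1"
      by (simp add: rel_eq distrib_left mult_single n_def m)
    ultimately have "Poly_Mapping.single n 1 + Poly_Mapping.single m 1 \<in> J" by metis
    then have "Poly_Mapping.single n 1 + Poly_Mapping.single m 1 - (Poly_Mapping.single n 1 - Poly_Mapping.single m' s) \<in> J"
      by (rule J_diff[OF _ m'(4)])
    \<comment> \<open>With \<open>n + m\<close> and \<open>n - s m'\<close> also
      \<open>m + s m'\<close> lies in \<open>J\<close>: every reduction changes the sign of the
      scalar.\<close>
    then have "Poly_Mapping.single m 1 - Poly_Mapping.single m' (- s) \<in> J"
      by (simp add: single_uminus algebra_simps)
    moreover have "weight_degree dg m' = weight_degree dg m" "total_degree m' = total_degree m"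
      using m'(2,3) dg_rel[OF i(1)] by (simp_all add: n_def m)
    ultimately show ?thesis using m'(1) by blast
  qed
qed

text \<open>The exponents of a standard monomial are read off from its degree, in order of decreasing column.\<close>

lemma inj_weight_std: "inj_on (weight_degree dg) std"
proof (rule inj_onI, rule ccontr)
  fix m m' assume m: "m \<in> std" and m': "m' \<in> std" and eq: "weight_degree dg m = weight_degree dg m'" and ne: "m \<noteq> m'"
  define d where "d v = int (Poly_Mapping.lookup m v) - int (Poly_Mapping.lookup m' v)" for v
  have kW: "Poly_Mapping.keys m \<subseteq> W" "Poly_Mapping.keys m' \<subseteq> W" using m m' by (auto simp: std_monomials_def)
  define Z where "Z = {v \<in> W. d v \<noteq> 0}"
  have "Z \<noteq> {}"
  proof
    assume "Z = {}"
    then have "Poly_Mapping.lookup m v = Poly_Mapping.lookup m' v" for v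
    proof (cases "v \<in> W")
      case False
      then have "v \<notin> Poly_Mapping.keys m" "v \<notin> Poly_Mapping.keys m'" using kW by auto
      then show ?thesis by (simp add: in_keys_iff)
    qed (use \<open>Z = {}\<close> in \<open>auto simp: Z_def d_def\<close>)
    then show False using ne poly_mapping_eqI by blast
  qed
  have "finite Z" using finite_W by (simp add: Z_def)
  have "Max ((col \<circ> \<rho>) ` Z) \<in> (col \<circ> \<rho>) ` Z" using \<open>Z \<noteq> {}\<close> \<open>finite Z\<close> by (intro Max_in) auto
  \<comment> \<open>Among the variables with different exponents, \<open>v\<close> has maximal
    column. In the coordinate \<open>\<rho> v\<close> of the difference of the degrees, only
    variables of the same fibre contribute.\<close>
  then obtain v where v: "v \<in> Z" "col (\<rho> v) = Max ((col \<circ> \<rho>) ` Z)" by auto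
  have max: "col (\<rho> u) \<le> col (\<rho> v)" if "u \<in> Z" for u
    unfolding v(2) using that \<open>finite Z\<close> by (intro Max_ge) auto
  let ?F = "{u \<in> W. \<rho> u = \<rho> v}"
  have "0 = Poly_Mapping.lookup (weight_degree dg m) (\<rho> v) - Poly_Mapping.lookup (weight_degree dg m') (\<rho> v)"
    by (simp add: eq)
  also have "\<dots> = (\<Sum>u\<in>W. d u * Poly_Mapping.lookup (dg u) (\<rho> v))"
    unfolding weight_degree_superset[OF finite_W kW(1)] weight_degree_superset[OF finite_W kW(2)]
    by (simp add: lookup_sum d_def left_diff_distrib sum_subtractf)
  also have "\<dots> = (\<Sum>u\<in>?F. d u * Poly_Mapping.lookup (dg u) (\<rho> v))"
  proof (intro sum.mono_neutral_right ballI)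
    fix u assume u: "u \<in> W - ?F"
    show "d u * Poly_Mapping.lookup (dg u) (\<rho> v) = 0"
    proof (rule ccontr)
      assume "\<not> ?thesis"
      then have "u \<in> Z" "Poly_Mapping.lookup (dg u) (\<rho> v) \<noteq> 0" using u by (auto simp: Z_def)
      then show False using dg_col[of u "\<rho> v"] u max[of u] by auto
    qed
  qed (use finite_W in auto)
  finally have sum0: "(\<Sum>u\<in>?F. d u * Poly_Mapping.lookup (dg u) (\<rho> v)) = 0" ..
  have vW: "v \<in> W" "d v \<noteq> 0" using v by (auto simp: Z_def)
  show False
  proof (cases "?F = {v}")
    case True
    then show False using sum0 dg_rho[OF vW(1)] vW(2) by simp
  next
    case False
    then obtain u where u: "u \<in> W" "\<rho> u = \<rho> v" "u \<noteq> v" using vW(1) by auto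
    obtain i where i: "i \<in> I" "{v, u} = {lx i, ly i}" using fib[OF vW(1) u(1)] u by auto
    have "?F = {v, u}"
    proof (intro equalityI subsetI)
      fix w assume w: "w \<in> ?F"
      show "w \<in> {v, u}"
      proof (cases "w = v")
        case False
        then obtain k where k: "k \<in> I" "{v, w} = {lx k, ly k}" using fib[OF vW(1), of w] w by auto
        have "\<rho> (lx k) = \<rho> (lx i)"
          using k(2) i(2) w u lead[OF i(1)] lead[OF k(1)] by (auto simp: doubleton_eq_iff)
        then have "k = i" using inj_lead k(1) i(1) by (auto dest: inj_onD)
        then show ?thesis using k(2) i(2) by auto
      qed auto
    qed (use vW u in auto)
    then have s: "d v * Poly_Mapping.lookup (dg v) (\<rho> v) + d u * Poly_Mapping.lookup (dg u) (\<rho> v) = 0"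
      using sum0 u(3) by simp
    have "Poly_Mapping.lookup (dg u) (\<rho> v) = - Poly_Mapping.lookup (dg v) (\<rho> v)"
      using i(2) dg_lead[OF i(1)] lead[OF i(1)] by (auto simp: doubleton_eq_iff)
    with s have "(d v - d u) * Poly_Mapping.lookup (dg v) (\<rho> v) = 0" by (simp add: left_diff_distrib)
    \<comment> \<open>The exponents of the pair differ by the same amount. As each of the two
      monomials omits a member of the pair, this amount can only be zero.\<close>
    then have "d v = d u" using dg_rho[OF vW(1)] by simp
    moreover have "(Poly_Mapping.lookup m (lx i) = 0 \<or> Poly_Mapping.lookup m (ly i) = 0) \<and>
        (Poly_Mapping.lookup m' (lx i) = 0 \<or> Poly_Mapping.lookup m' (ly i) = 0)"
      using m m' i(1) by (auto simp: std_monomials_def leads_def)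
    then have "(Poly_Mapping.lookup m v = 0 \<or> Poly_Mapping.lookup m u = 0) \<and>
        (Poly_Mapping.lookup m' v = 0 \<or> Poly_Mapping.lookup m' u = 0)"
      using i(2) by (auto simp: doubleton_eq_iff)
    ultimately show False using vW(2) by (auto simp: d_def)
  qed
qed

text \<open>Discarding \<open>lx i\<close> from every leading pair leaves exactly one variable over
  each coordinate in the image of \<open>\<rho>\<close>.\<close>

lemma card_W: "card W = card (\<rho> ` W) + card I"
proof -
  have inj: "inj_on \<rho> (W - lx ` I)"
  proof (rule inj_onI, rule ccontr)
    fix v v' assume v: "v \<in> W - lx ` I" "v' \<in> W - lx ` I" "\<rho> v = \<rho> v'" "v \<noteq> v'"
    then obtain i where "i \<in> I" "{v, v'} = {lx i, ly i}" using fib[of v v'] by blast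
    then show False using v by (auto simp: doubleton_eq_iff)
  qed
  have "\<rho> ` (W - lx ` I) = \<rho> ` W"
  proof (intro equalityI subsetI)
    fix h assume "h \<in> \<rho> ` W"
    then obtain v where v: "v \<in> W" "h = \<rho> v" by blast
    show "h \<in> \<rho> ` (W - lx ` I)"
    proof (cases "v \<in> lx ` I")
      case True
      then obtain i where i: "i \<in> I" "v = lx i" by blast
      have "ly i \<notin> lx ` I"
      proof
        assume "ly i \<in> lx ` I"
        then obtain k where k: "k \<in> I" "ly i = lx k" by blast
        then have "\<rho> (lx k) = \<rho> (lx i)" using lead[OF i(1)] by simp
        then have "k = i" using inj_lead k(1) i(1) by (auto dest: inj_onD)
        then show False using k(2) lead[OF i(1)] by simp
      qed
      then show ?thesis using v i lead[OF i(1)] by (intro image_eqI[of _ _ "ly i"]) auto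
    qed (use v in auto)
  qed auto
  then have "card (\<rho> ` W) = card (W - lx ` I)" using card_image[OF inj] by simp
  moreover have "card (lx ` I) = card I"
    using inj_lead by (intro card_image) (auto simp: inj_on_def)
  moreover have "lx ` I \<subseteq> W" using lead by auto
  ultimately show ?thesis
    using finite_W card_mono[of W "lx ` I"] by (simp add: card_Diff_subset finite_subset)
qed

lemma card_leads: "card leads = card I" and finite_leads: "finite leads"
proof -
  show "card leads = card I"
    unfolding leads_def using inj_lead by (intro card_image) (auto simp: inj_on_def)
  show "finite leads"
    by (rule finite_subset[of _ "W \<times> W"]) (use lead finite_W in \<open>auto simp: leads_def\<close>)
qed

lemma finite_I: "finite I"
proof (rule finite_imageD)
  show "finite ((\<lambda>i. (lx i, ly i)) ` I)" using finite_leads by (simp add: leads_def)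
  show "inj_on (\<lambda>i. (lx i, ly i)) I" using inj_lead by (auto simp: inj_on_def)
qed

text \<open>Modulo \<open>J\<close>, an element of the kernel becomes a combination \<open>q\<close>
  of standard monomials. These have distinct degrees and nonzero \<open>weight_coeff\<close>, so
  nothing can cancel in \<open>\<Phi> q = 0\<close>.\<close>

lemma kernel_eq: "a_kernel (poly_ring V) (monoid_algebra Mon) \<Phi> = J"
proof (intro equalityI subsetI)
  fix p assume p: "p \<in> a_kernel (poly_ring V) (monoid_algebra Mon) \<Phi>"
  then have pV: "p \<in> carrier (poly_ring V)" and \<Phi>p: "\<Phi> p = 0" by (simp_all only: mem_kernel_iff)
  have "\<exists>r. Poly_Mapping.keys r \<subseteq> std \<and> Poly_Mapping.single m 1 - r \<in> J" if m: "m \<in> Poly_Mapping.keys p" for m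
  proof (cases "Poly_Mapping.keys m \<subseteq> W")
    case True
    from reduce[OF this] obtain m' s where "m' \<in> std" "Poly_Mapping.single m 1 - Poly_Mapping.single m' s \<in> J" by blast
    then show ?thesis by (intro exI[of _ "Poly_Mapping.single m' s"]) auto
  next
    case False
    then obtain v where v: "v \<in> Poly_Mapping.keys m" "v \<notin> W" by blast
    have mV: "Poly_Mapping.keys m \<subseteq> V" using pV m by auto
    have "Poly_Mapping.lookup m v > 0" using v by (simp add: in_keys_iff)
    then obtain m' where m': "m = m' + Poly_Mapping.single v 1"
      using poly_mapping_minus_single by (metis One_nat_def)
    have "Poly_Mapping.keys m' \<subseteq> V" using mV by (auto simp: m' in_keys_iff lookup_add)
    moreover have "var v \<in> J" using v mV by (intro J_gens) (auto simp: gens_def)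
    ultimately have "Poly_Mapping.single m' 1 * var v \<in> J" by (intro J_mult) auto
    then have "Poly_Mapping.single m 1 \<in> J" by (simp add: var_def mult_single m')
    then show ?thesis by (intro exI[of _ 0]) auto
  qed
  then obtain r where r: "\<And>m. m \<in> Poly_Mapping.keys p \<Longrightarrow> Poly_Mapping.keys (r m) \<subseteq> std"
    "\<And>m. m \<in> Poly_Mapping.keys p \<Longrightarrow> Poly_Mapping.single m 1 - r m \<in> J" by metis
  define q where "q = (\<Sum>m\<in>Poly_Mapping.keys p. Poly_Mapping.single 0 (Poly_Mapping.lookup p m) * r m)"
  have q: "Poly_Mapping.keys q \<subseteq> std"
  proof -
    have "Poly_Mapping.keys (Poly_Mapping.single 0 (Poly_Mapping.lookup p m) * r m) \<subseteq> std" if "m \<in> Poly_Mapping.keys p" for m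
      using r(1)[OF that] by (auto simp: in_keys_iff lookup_single_0_mult)
    then show ?thesis unfolding q_def
      using keys_sum[of "\<lambda>m. Poly_Mapping.single 0 (Poly_Mapping.lookup p m) * r m" "Poly_Mapping.keys p"] by blast
  qed
  have "p - q = (\<Sum>m\<in>Poly_Mapping.keys p. Poly_Mapping.single 0 (Poly_Mapping.lookup p m) * (Poly_Mapping.single m 1 - r m))"
    by (subst poly_mapping_sum_single[of p])
       (simp add: q_def right_diff_distrib sum_subtractf mult_single)
  also have "\<dots> \<in> J" using r(2) by (intro J_sum J_mult single_in_poly_ring) auto
  finally have pq: "p - q \<in> J" .
  have "p - q + q = p" by simp
  then have "\<Phi> q = 0" using J_kernel[OF pq] \<Phi>p toric_map_add[of dg \<epsilon> "p - q" q] by simp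
  have "q = 0"
  proof (rule ccontr)
    assume "q \<noteq> 0"
    then obtain n where n: "n \<in> Poly_Mapping.keys q" by (metis keys_eq_empty all_not_in_conv poly_mapping_eqI lookup_zero in_keys_iff)
    have "{m \<in> Poly_Mapping.keys q. weight_degree dg m = weight_degree dg n} = {n}"
      using inj_weight_std q n by (auto dest: inj_onD)
    then have "Poly_Mapping.lookup (\<Phi> q) (weight_degree dg n) = Poly_Mapping.lookup q n * weight_coeff \<epsilon> n"
      unfolding lookup_toric_map by simp
    then have "weight_coeff \<epsilon> n = 0" using \<open>\<Phi> q = 0\<close> n by (simp add: in_keys_iff)
    then show False using n q unfolding weight_coeff_eq_0_iff
      by (auto simp: std_monomials_def W_def)
  qed
  then show "p \<in> J" using pq by simp
next
  fix p assume "p \<in> J"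
  moreover have "J \<subseteq> carrier (poly_ring V)" using R.genideal_ideal[OF gens_carrier] by (meson ideal.Icarr subsetI)
  ultimately show "p \<in> a_kernel (poly_ring V) (monoid_algebra Mon) \<Phi>"
    using J_kernel by (simp only: mem_kernel_iff) blast
qed

text \<open>Reduction to a standard monomial preserves the total degree, the relations being
  homogeneous.\<close>

lemma weight_image_total_degree:
  "weight_degree dg ` {m. Poly_Mapping.keys m \<subseteq> W \<and> Q (total_degree m)} =
   weight_degree dg ` {m \<in> std. Q (total_degree m)}"
proof (intro equalityI subsetI)
  fix f assume "f \<in> weight_degree dg ` {m. Poly_Mapping.keys m \<subseteq> W \<and> Q (total_degree m)}"
  then obtain m where "f = weight_degree dg m" "Poly_Mapping.keys m \<subseteq> W" "Q (total_degree m)" by blast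
  then show "f \<in> weight_degree dg ` {m \<in> std. Q (total_degree m)}" using reduce[of m] by (metis (mono_tags, lifting) image_eqI mem_Collect_eq)
qed (auto simp: std_monomials_def)

text \<open>The predicate \<open>Q\<close> is arbitrary because three cases are needed: no condition
  for surjectivity, a given total degree for the Hilbert function, and a given hexagon degree for
  the graded parts.\<close>

lemma toric_map_image:
  "\<Phi> ` {p \<in> carrier (poly_ring V). \<forall>m\<in>Poly_Mapping.keys p. Q m} =
   {q. Poly_Mapping.keys q \<subseteq> weight_degree dg ` {m. Poly_Mapping.keys m \<subseteq> W \<and> Q m}}"
proof (intro equalityI subsetI)
  fix q assume "q \<in> \<Phi> ` {p \<in> carrier (poly_ring V). \<forall>m\<in>Poly_Mapping.keys p. Q m}"
  then obtain p where p: "p \<in> carrier (poly_ring V)" "\<And>m. m\<in>Poly_Mapping.keys p \<Longrightarrow> Q m" "q = \<Phi> p" by blast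
  show "q \<in> {q. Poly_Mapping.keys q \<subseteq> weight_degree dg ` {m. Poly_Mapping.keys m \<subseteq> W \<and> Q m}}"
  proof (safe, rule ccontr)
    fix f assume f: "f \<in> Poly_Mapping.keys q" "f \<notin> weight_degree dg ` {m. Poly_Mapping.keys m \<subseteq> W \<and> Q m}"
    have "Poly_Mapping.lookup p m * weight_coeff \<epsilon> m = 0"
      if "m \<in> Poly_Mapping.keys p" "weight_degree dg m = f" for m
    proof -
      have "\<not> Poly_Mapping.keys m \<subseteq> W" using f(2) that p(2)[of m] by blast
      moreover have "Poly_Mapping.keys m \<subseteq> V" using p(1) that by auto
      ultimately have "weight_coeff \<epsilon> m = 0" by (auto simp: weight_coeff_eq_0_iff W_def)
      then show ?thesis by simp
    qed
    then have "Poly_Mapping.lookup q f = 0"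
      unfolding p(3) lookup_toric_map by (intro sum.neutral) auto
    then show False using f(1) by (simp add: in_keys_iff)
  qed
next
  fix q :: "('h \<Rightarrow>\<^sub>0 int) \<Rightarrow>\<^sub>0 complex"
  assume "q \<in> {q. Poly_Mapping.keys q \<subseteq> weight_degree dg ` {m. Poly_Mapping.keys m \<subseteq> W \<and> Q m}}"
  then have "\<forall>f\<in>Poly_Mapping.keys q. \<exists>m. f = weight_degree dg m \<and> Poly_Mapping.keys m \<subseteq> W \<and> Q m" by auto
  then obtain \<mu> where \<mu>: "\<And>f. f \<in> Poly_Mapping.keys q \<Longrightarrow> f = weight_degree dg (\<mu> f) \<and> Poly_Mapping.keys (\<mu> f) \<subseteq> W \<and> Q (\<mu> f)" by metis
  \<comment> \<open>Each degree \<open>f\<close> in \<open>q\<close> is lifted to one monomial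
    \<open>\<mu> f\<close>; the division undoes the scalar that \<open>\<Phi>\<close>
    introduces.\<close>
  define p where "p = (\<Sum>f\<in>Poly_Mapping.keys q. Poly_Mapping.single (\<mu> f) (Poly_Mapping.lookup q f / weight_coeff \<epsilon> (\<mu> f)))"
  have "Poly_Mapping.keys p \<subseteq> \<mu> ` Poly_Mapping.keys q"
    unfolding p_def using keys_sum[of "\<lambda>f. Poly_Mapping.single (\<mu> f) (Poly_Mapping.lookup q f / weight_coeff \<epsilon> (\<mu> f))" "Poly_Mapping.keys q"]
    by (auto split: if_splits)
  then have p: "p \<in> {p \<in> carrier (poly_ring V). \<forall>m\<in>Poly_Mapping.keys p. Q m}" using \<mu> W_sub by fastforce
  have nz: "weight_coeff \<epsilon> (\<mu> f) \<noteq> 0" if "f \<in> Poly_Mapping.keys q" for f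
    using \<mu>[OF that] by (auto simp: weight_coeff_eq_0_iff W_def)
  have "\<Phi> p = (\<Sum>f\<in>Poly_Mapping.keys q. \<Phi> (Poly_Mapping.single (\<mu> f) (Poly_Mapping.lookup q f / weight_coeff \<epsilon> (\<mu> f))))"
    unfolding p_def toric_map_def lin_ext_sum ..
  also have "\<dots> = (\<Sum>f\<in>Poly_Mapping.keys q. Poly_Mapping.single f (Poly_Mapping.lookup q f))"
    using \<mu> nz by (intro sum.cong) (auto simp: toric_map_single)
  also have "\<dots> = q" by (rule poly_mapping_sum_single[symmetric])
  finally show "q \<in> \<Phi> ` {p \<in> carrier (poly_ring V). \<forall>m\<in>Poly_Mapping.keys p. Q m}" using p by blast
qed

lemma toric_map_surj: "\<Phi> ` carrier (poly_ring V) = carrier (monoid_algebra Mon)"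
  using toric_map_image[of "\<lambda>_. True"] by (simp add: weight_monoid_def)

lemma std_poly:
  obtains h :: "real poly" where "degree h = card (\<rho> ` W)" "fact (degree h) * lead_coeff h = 2 ^ card I"
    "\<forall>\<^sub>F n in sequentially. real (card {m \<in> std. total_degree m \<le> n}) = poly h (real n)"
proof -
  have disj: "(x, y) = (x', y')" if "(x, y) \<in> leads" "(x', y') \<in> leads" "{x, y} \<inter> {x', y'} \<noteq> {}" for x y x' y'
  proof -
    from that obtain i k where ik: "i \<in> I" "k \<in> I" "x = lx i" "y = ly i" "x' = lx k" "y' = ly k"
      by (auto simp: leads_def)
    then have "\<rho> (lx i) = \<rho> (lx k)" using that(3) lead[OF ik(1)] lead[OF ik(2)] by auto
    then have "i = k" using inj_lead ik by (auto dest: inj_onD)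
    then show ?thesis using ik by simp
  qed
  have "\<And>x y. (x, y) \<in> leads \<Longrightarrow> x \<in> W \<and> y \<in> W \<and> x \<noteq> y" using lead by (auto simp: leads_def)
  from card_std_monomials[OF finite_leads finite_W this disj] card_W card_leads that show thesis by auto
qed

lemma krull_dim_toric: "krull_dim (monoid_algebra Mon) = enat (card (\<rho> ` W))"
proof (rule antisym)
  define G where "G n = weight_degree dg ` {m. Poly_Mapping.keys m \<subseteq> W \<and> total_degree m \<le> n}" for n
  define N where "N n = card {m \<in> std. total_degree m \<le> n}" for n
  have G_std: "G n = weight_degree dg ` {m \<in> std. total_degree m \<le> n}" for n
    unfolding G_def by (rule weight_image_total_degree)
  have fin: "finite {m \<in> std. total_degree m \<le> n}" for n by (rule finite_std_monomials[OF finite_W])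
  have "mono N" unfolding N_def by (intro monoI card_mono fin) auto
  obtain h :: "real poly" where h: "degree h = card (\<rho> ` W)"
    "\<forall>\<^sub>F n in sequentially. real (N n) = poly h (real n)"
    unfolding N_def by (rule std_poly)
  from poly_growth[OF \<open>mono N\<close> h(2)] obtain C where C: "\<And>n. N n \<le> C * Suc n ^ card (\<rho> ` W)"
    unfolding h(1) by blast
  show "krull_dim (monoid_algebra Mon) \<le> enat (card (\<rho> ` W))"
  proof (rule krull_dim_le[OF submonoid_weight_monoid])
    show "x + y \<in> G (i + j)" if xy: "x \<in> G i" "y \<in> G j" for i j x y
    proof -
      obtain m n where "x = weight_degree dg m" "y = weight_degree dg n" "Poly_Mapping.keys m \<subseteq> W"
        "Poly_Mapping.keys n \<subseteq> W" "total_degree m \<le> i" "total_degree n \<le> j" using xy by (auto simp: G_def)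
      then show ?thesis unfolding G_def
        using keys_add_le[of m W n] by (intro image_eqI[of _ _ "m + n"]) auto
    qed
    show "0 \<in> G 0" unfolding G_def by (intro image_eqI[of _ _ 0]) auto
    show "finite (G n)" for n unfolding G_std by (intro finite_imageI fin)
    show "Mon = (\<Union>n. G n)" by (auto simp: weight_monoid_def G_def)
    show "G m \<subseteq> G n" if "m \<le> n" for m n using that by (auto simp: G_def)
    show "card (G n) \<le> C * Suc n ^ card (\<rho> ` W)" for n
      using card_image_le[OF fin[of n], of "weight_degree dg"] C[of n] unfolding G_std N_def by linarith
  qed
next
  have "\<forall>h\<in>\<rho> ` W. \<exists>v\<in>W. \<rho> v = h" by auto
  \<comment> \<open>One variable over each coordinate gives the triangular family for
    \<open>krull_dim_ge\<close>.\<close>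
  then obtain g where g: "\<And>h. h \<in> \<rho> ` W \<Longrightarrow> g h \<in> W \<and> \<rho> (g h) = h" by metis
  show "enat (card (\<rho> ` W)) \<le> krull_dim (monoid_algebra Mon)"
  proof (rule krull_dim_ge[OF submonoid_weight_monoid])
    show "finite (\<rho> ` W)" using finite_W by simp
    show "(\<lambda>h. dg (g h)) ` \<rho> ` W \<subseteq> Mon"
    proof clarify
      fix v assume "v \<in> W"
      then have "g (\<rho> v) \<in> W" using g by blast
      then show "dg (g (\<rho> v)) \<in> Mon" unfolding weight_monoid_def
        by (intro image_eqI[of _ _ "Poly_Mapping.single (g (\<rho> v)) 1"]) auto
    qed
    show "Poly_Mapping.lookup (dg (g h)) h \<noteq> 0" if "h \<in> \<rho> ` W" for h
      using dg_rho[of "g h"] g[OF that] by simp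
    show "Poly_Mapping.lookup (dg (g h)) h' = 0" if "h \<in> \<rho> ` W" "h' \<noteq> h" "col h \<le> col h'" for h h'
      using dg_col[of "g h" h'] g[OF that(1)] that by force
  qed
qed

text \<open>Complete intersections are defined by the cardinality of a set of generators, so
  coincidences must be excluded. The coefficient at the leading monomial of \<open>k\<close> tells
  \<open>rel k\<close> from every other \<open>rel i\<close> of no larger column, and variables
  differ from relations by their degree.\<close>

lemma card_gens: "card gens = card (V - W) + card I"
proof -
  have lt: "tx i \<notin> {lx k, ly k}" if "i \<in> I" "k \<in> I" "\<rho> (lx i) = \<rho> (lx k)" for i k
    using trail[OF that(1)] lead[OF that(2)] that(3) by auto
  have lk: "Poly_Mapping.lookup (rel i) (Poly_Mapping.single (lx k) 1 + Poly_Mapping.single (ly k) 1) = (if i = k then 1 else 0)"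
    if "i \<in> I" "k \<in> I" "col (\<rho> (lx i)) \<le> col (\<rho> (lx k))" for i k
  proof -
    let ?s = "\<lambda>x y. Poly_Mapping.single x (1::nat) + Poly_Mapping.single y 1"
    have ne: "?s x y \<noteq> ?s (lx k) (ly k)" if "x \<noteq> lx k" "x \<noteq> ly k" for x y
    proof
      assume "?s x y = ?s (lx k) (ly k)"
      then have "Poly_Mapping.lookup (?s x y) x = Poly_Mapping.lookup (?s (lx k) (ly k)) x" by simp
      then show False using that by (simp add: lookup_add lookup_single)
    qed
    have "?s (tx i) (ty i) \<noteq> ?s (lx k) (ly k)"
      using trail[OF that(1)] lead[OF that(2)] that(3) by (intro ne) auto
    moreover have "?s (lx i) (ly i) \<noteq> ?s (lx k) (ly k)" if "i \<noteq> k"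
    proof (rule ne)
      have "\<rho> (lx i) \<noteq> \<rho> (lx k)" using that \<open>i \<in> I\<close> \<open>k \<in> I\<close> inj_lead by (auto dest: inj_onD)
      then show "lx i \<noteq> lx k" "lx i \<noteq> ly k" using lead[OF \<open>k \<in> I\<close>] by auto
    qed
    ultimately show ?thesis by (auto simp: rel_eq lookup_add lookup_single)
  qed
  have "inj_on rel I"
  proof (rule inj_onI)
    fix i k assume ik: "i \<in> I" "k \<in> I" "rel i = rel k"
    show "i = k"
    proof (cases "col (\<rho> (lx i)) \<le> col (\<rho> (lx k))")
      case True
      then show ?thesis using lk[OF ik(1,2)] lk[OF ik(2,2)] ik(3) by (metis order_refl zero_neq_one)
    next
      case False
      then show ?thesis using lk[OF ik(2,1)] lk[OF ik(1,1)] ik(3) by (metis nle_le order_refl zero_neq_one)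
    qed
  qed
  moreover have "inj_on var (V - W)"
  proof (rule inj_onI)
    fix v w :: 'v assume "var v = var w"
    then have "Poly_Mapping.keys (var v) = Poly_Mapping.keys (var w)" by simp
    then have "Poly_Mapping.keys (Poly_Mapping.single v (1::nat)) = Poly_Mapping.keys (Poly_Mapping.single w (1::nat))"
      by (simp add: var_def)
    then show "v = w" by simp
  qed
  moreover have "var v \<noteq> rel i" if "i \<in> I" for v i
  proof
    assume eq: "var v = rel i"
    have "total_degree (Poly_Mapping.single (lx i) (1::nat) + Poly_Mapping.single (ly i) 1) \<noteq> total_degree (Poly_Mapping.single v 1)" by simp
    then have "Poly_Mapping.single v (1::nat) \<noteq> Poly_Mapping.single (lx i) 1 + Poly_Mapping.single (ly i) 1" by metis
    then have "Poly_Mapping.lookup (var v) (Poly_Mapping.single (lx i) 1 + Poly_Mapping.single (ly i) 1) = 0"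
      by (simp add: var_def lookup_single)
    then show False using lk[OF that that] eq by simp
  qed
  ultimately show ?thesis
    unfolding gens_def using finite_V finite_I
    by (subst card_Un_disjoint) (auto simp: card_image)
qed

end

section \<open>Invariants of a ring presented by a toric map\<close>

context toric
begin

context
  fixes R :: "('r, 'x) ring_scheme" and \<phi> :: "'r \<Rightarrow> ('h \<Rightarrow>\<^sub>0 int) \<Rightarrow>\<^sub>0 complex"
    and \<pi> :: "(('v \<Rightarrow>\<^sub>0 nat) \<Rightarrow>\<^sub>0 complex) \<Rightarrow> 'r"
  assumes R: "cring R" and \<phi>: "\<phi> \<in> ring_iso R (monoid_algebra Mon)"
    and \<pi>: "\<And>p. p \<in> carrier (poly_ring V) \<Longrightarrow> \<pi> p \<in> carrier R \<and> \<phi> (\<pi> p) = \<Phi> p"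
begin

lemma krull_dim_presented: "krull_dim R = enat (card (\<rho> ` W))"
proof -
  have T: "cring (monoid_algebra Mon)" by (rule cring_monoid_algebra[OF submonoid_weight_monoid])
  have Rr: "ring R" and Tr: "ring (monoid_algebra Mon)" using R T by (simp_all add: cring_def)
  show ?thesis
    using krull_dim_iso_le[OF R Tr \<phi>] krull_dim_iso_le[OF T Rr ring_iso_set_sym[OF Rr \<phi>]] krull_dim_toric
    by simp
qed

text \<open>The ideal has \<open>card (V - W) + card I\<close> generators, and the dimension is
  \<open>card W - card I\<close> by \<open>card_W\<close>.\<close>

lemma complete_intersection_presented: "complete_intersection V R \<pi>"
  unfolding complete_intersection_def
proof (intro exI conjI)
  interpret R: cring R by (rule R)
  interpret T: cring "monoid_algebra Mon" by (rule cring_monoid_algebra[OF submonoid_weight_monoid])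
  interpret h: ring_hom_ring R "monoid_algebra Mon" \<phi>
    using \<phi> by (intro ring_hom_ringI2 R.ring_axioms T.ring_axioms) (auto simp: ring_iso_def)
  have "inj_on \<phi> (carrier R)" using \<phi> by (auto simp: ring_iso_def bij_betw_def)
  moreover have "\<phi> \<zero>\<^bsub>R\<^esub> = 0" using h.hom_zero by simp
  ultimately have "\<pi> p = \<zero>\<^bsub>R\<^esub> \<longleftrightarrow> \<Phi> p = 0" if "p \<in> carrier (poly_ring V)" for p
    using \<pi>[OF that] inj_on_eq_iff[of \<phi> "carrier R" "\<pi> p" "\<zero>\<^bsub>R\<^esub>"] by auto
  then have "a_kernel (poly_ring V) R \<pi> = a_kernel (poly_ring V) (monoid_algebra Mon) \<Phi>"
    unfolding a_kernel_def' by (auto simp del: poly_ring_simps)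
  then show "a_kernel (poly_ring V) R \<pi> = Idl\<^bsub>poly_ring V\<^esub> gens" using kernel_eq by simp
  show "finite gens" using finite_V finite_I by (auto simp: gens_def)
  have "card W + card (V - W) = card V"
    using W_sub finite_V finite_W card_mono[of V W] by (simp add: card_Diff_subset)
  then show "krull_dim R + enat (card gens) = enat (card V)"
    unfolding krull_dim_presented card_gens using card_W by simp
qed (rule gens_carrier)

lemma hilbert_fun_presented:
  "hilbert_fun V R \<pi> n = card {m \<in> std. total_degree m = n}"
proof -
  let ?H = "{p \<in> carrier (poly_ring V). \<forall>m\<in>Poly_Mapping.keys p. total_degree m = n}"
  let ?X = "weight_degree dg ` {m \<in> std. total_degree m = n}"
  have Rr: "ring R" using R by (simp add: cring_def)
  have const: "const z \<in> carrier (poly_ring V)" for z unfolding const_def by (rule single_in_poly_ring) simp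
  have fin: "finite {m \<in> std. total_degree m = n}"
    by (rule finite_subset[OF _ finite_std_monomials[OF finite_W, of leads n]]) auto
  have "ring.dim R (\<pi> ` range const) (\<pi> ` ?H) = card ?X"
  proof (rule dim_iso_monoid_algebra[OF submonoid_weight_monoid Rr \<phi>])
    show "finite ?X" using fin by simp
    show "?X \<subseteq> Mon" by (auto simp: weight_monoid_def std_monomials_def)
    show "\<pi> ` range const \<subseteq> carrier R" "\<pi> ` ?H \<subseteq> carrier R" using \<pi> const by blast+
    show "\<phi> ` \<pi> ` range const = range (Poly_Mapping.single 0)"
      using \<pi>[OF const] by (simp add: image_image toric_map_const)
    have "\<phi> ` \<pi> ` ?H = \<Phi> ` ?H"
      unfolding image_image using \<pi> by (intro image_cong) auto
    then show "\<phi> ` \<pi> ` ?H = {p. Poly_Mapping.keys p \<subseteq> ?X}"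
      unfolding toric_map_image using weight_image_total_degree[of "\<lambda>d. d = n"] by simp
  qed
  also have "\<dots> = card {m \<in> std. total_degree m = n}"
    using inj_weight_std by (intro card_image) (auto simp: inj_on_def)
  finally show ?thesis by (simp add: hilbert_fun_def)
qed

lemma has_degree_presented: "has_degree V R \<pi> (2 ^ card I)"
proof -
  have "(\<Sum>m\<le>n. hilbert_fun V R \<pi> m) = card {m \<in> std. total_degree m \<le> n}" for n
  proof -
    have "{m \<in> std. total_degree m \<le> n} = (\<Union>k\<le>n. {m \<in> std. total_degree m = k})" by auto
    also have "card \<dots> = (\<Sum>k\<le>n. card {m \<in> std. total_degree m = k})"
      using finite_std_monomials[OF finite_W, of leads n]
      by (intro card_UN_disjoint) (auto intro: finite_subset[OF _ finite_std_monomials[OF finite_W, of leads n]])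
    finally show ?thesis by (simp add: hilbert_fun_presented)
  qed
  moreover obtain h :: "real poly" where "fact (degree h) * lead_coeff h = 2 ^ card I"
    "\<forall>\<^sub>F n in sequentially. real (card {m \<in> std. total_degree m \<le> n}) = poly h (real n)"
    by (rule std_poly)
  ultimately show ?thesis unfolding has_degree_def by (intro exI[of _ h]) auto
qed

end

end

section \<open>The combinatorics of lozenge tilings\<close>

lemma nth_elem_strict_mono:
  assumes "m \<in> {1..card s}" "m' \<in> {1..card s}" "m < m'"
  shows "nth_elem s m < nth_elem s m'"
proof -
  have "sorted_wrt (<) (sorted_list_of_set s)" by (rule strict_sorted_list_of_set)
  from sorted_wrt_nth_less[OF this, of "m - 1" "m' - 1"] show ?thesis
    unfolding nth_elem_def using assms by auto
qed

lemma nth_elem_bij: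
  assumes "finite s"
  shows "bij_betw (nth_elem s) {1..card s} s"
proof -
  have inj: "inj_on (nth_elem s) {1..card s}"
  proof (rule inj_onI)
    fix m m' assume "m \<in> {1..card s}" "m' \<in> {1..card s}" "nth_elem s m = nth_elem s m'"
    then show "m = m'" using nth_elem_strict_mono[of m s m'] nth_elem_strict_mono[of m' s m]
      by (metis less_irrefl nat_neq_iff)
  qed
  have "nth_elem s m \<in> s" if "m \<in> {1..card s}" for m
  proof -
    have "sorted_list_of_set s ! (m - 1) \<in> set (sorted_list_of_set s)"
      using that by (intro nth_mem) auto
    then show ?thesis using assms by (simp add: nth_elem_def)
  qed
  then have "nth_elem s ` {1..card s} \<subseteq> s" by blast
  moreover have "card (nth_elem s ` {1..card s}) = card s" using card_image[OF inj] by simp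
  ultimately have "nth_elem s ` {1..card s} = s" using assms by (intro card_subset_eq)
  with inj show ?thesis by (simp add: bij_betw_def)
qed

text \<open>The count of indices in the coordinates of type \<open>B\<close> becomes a count of
  elements, free of the enumeration.\<close>

lemma card_nth_elem_less:
  assumes "finite s"
  shows "card {m \<in> {1..card s}. nth_elem s m < j} = card {x \<in> s. x < j}"
proof -
  have inj: "inj_on (nth_elem s) {1..card s}" and im: "nth_elem s ` {1..card s} = s"
    using nth_elem_bij[OF assms] by (simp_all add: bij_betw_def)
  have "{x \<in> s. x < j} = nth_elem s ` {m \<in> {1..card s}. nth_elem s m < j}"
    by (subst im[symmetric]) blast
  then show ?thesis using inj by (metis (no_types, lifting) card_image inj_on_subset mem_Collect_eq subsetI)
qed

lemma card_less_nth_elem: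
  assumes "finite s" "m \<in> {1..card s}"
  shows "Suc (card {x \<in> s. x < nth_elem s m}) = m"
proof -
  have "{m' \<in> {1..card s}. nth_elem s m' < nth_elem s m} = {1..<m}"
  proof (intro equalityI subsetI)
    fix m' assume m': "m' \<in> {m' \<in> {1..card s}. nth_elem s m' < nth_elem s m}"
    then show "m' \<in> {1..<m}" using nth_elem_strict_mono[OF assms(2), of m'] assms(2)
      by (metis (mono_tags, lifting) atLeastAtMost_iff atLeastLessThan_iff mem_Collect_eq nat_neq_iff order_less_asym)
  qed (use nth_elem_strict_mono[OF _ assms(2)] assms(2) in auto)
  then show ?thesis using card_nth_elem_less[OF assms(1), of "nth_elem s m", symmetric] assms(2) by simp
qed

locale plane_partition =
  fixes a b c :: nat and S :: "nat \<Rightarrow> nat set"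
  assumes PP: "S \<in> PP a b c"
begin

text \<open>
  The \<open>l\<close>-th path of non-horizontal dimers crosses strip \<open>j\<close> (the edges \<open>BVar _ j\<close> and \<open>CVar j _\<close>)
  next to the hexagon with first coordinate \<open>pos l j\<close> in the column on its right, using a
  \<open>C\<close> edge if \<open>j \<in> S l\<close> and a \<open>B\<close> edge otherwise.
\<close>

definition pos :: "nat \<Rightarrow> nat \<Rightarrow> nat" where
  "pos l j = a - l + 1 + card {x \<in> S l. x < j}"

lemma S_l:
  assumes "l \<in> {1..a}"
  shows "S l \<subseteq> {1..b + c}" "card (S l) = b" "finite (S l)"
proof -
  show *: "S l \<subseteq> {1..b + c}" "card (S l) = b" using PP assms by (auto simp: PP_def PiE_def Pi_def)
  show "finite (S l)" using *(1) by (rule finite_subset) simp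
qed

lemma pos_Suc: "l \<in> {1..a} \<Longrightarrow> pos l (Suc j) = pos l j + (if j \<in> S l then 1 else 0)"
proof -
  assume l: "l \<in> {1..a}"
  have "{x \<in> S l. x < Suc j} = (if j \<in> S l then insert j {x \<in> S l. x < j} else {x \<in> S l. x < j})"
    by (auto simp: less_Suc_eq)
  then show ?thesis using S_l[OF l] by (simp add: pos_def)
qed

lemma pos_1: "l \<in> {1..a} \<Longrightarrow> pos l 1 = a - l + 1"
proof -
  assume "l \<in> {1..a}"
  then have "{x \<in> S l. x < 1} = {}" using S_l(1)[of l] by fastforce
  then show ?thesis by (simp add: pos_def)
qed

text \<open>\<open>S l\<close> has at most \<open>j - 1\<close> elements below \<open>j\<close> and
  at most \<open>b + c + 1 - j\<close> from \<open>j\<close> on. With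
  \<open>q = a + j - pos l j\<close>, the last two bounds read \<open>l \<le> q \<le> l + c\<close>:
  the paths stay inside the hexagon.\<close>

lemma pos_bounds:
  assumes l: "l \<in> {1..a}" and j: "1 \<le> j" "j \<le> b + c"
  shows "1 \<le> pos l j" "pos l j + l \<le> a + b + 1" "pos l j + l \<le> a + j" "a + j \<le> pos l j + l + c"
proof -
  have "card {x \<in> S l. x < j} \<le> b"
    using S_l[OF l] card_mono[of "S l" "{x \<in> S l. x < j}"] by auto
  then show "pos l j + l \<le> a + b + 1" using l by (simp add: pos_def)
  have "card {x \<in> S l. x < j} \<le> card {1..<j}"
    using S_l[OF l] by (intro card_mono) auto
  then show "pos l j + l \<le> a + j" using l j by (simp add: pos_def)
  have "S l = {x \<in> S l. x < j} \<union> {x \<in> S l. j \<le> x}" by auto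
  then have "b \<le> card {x \<in> S l. x < j} + card {x \<in> S l. j \<le> x}"
    using S_l[OF l] card_Un_le by metis
  moreover have "card {x \<in> S l. j \<le> x} \<le> card {j..b + c}"
    using S_l[OF l] by (intro card_mono) auto
  ultimately show "a + j \<le> pos l j + l + c" using l j by (simp add: pos_def)
qed (simp add: pos_def)

text \<open>The pointwise order makes the counts weakly decreasing in \<open>l\<close>, and the
  shift \<open>a - l\<close> makes the positions strictly decreasing: the paths are
  disjoint.\<close>

lemma pos_strict:
  assumes l: "l \<in> {1..a}" "l' \<in> {1..a}" "l < l'"
  shows "pos l' j < pos l j"
proof -
  have le: "nth_elem (S l) m \<le> nth_elem (S l') m" if "m \<in> {1..b}" for m
    using PP l that by (auto simp: PP_def)
  have "{m \<in> {1..b}. nth_elem (S l') m < j} \<subseteq> {m \<in> {1..b}. nth_elem (S l) m < j}"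
    using le by fastforce
  then have "card {m \<in> {1..b}. nth_elem (S l') m < j} \<le> card {m \<in> {1..b}. nth_elem (S l) m < j}"
    by (intro card_mono) auto
  then have "card {x \<in> S l'. x < j} \<le> card {x \<in> S l. x < j}"
    using card_nth_elem_less[of "S l" j] card_nth_elem_less[of "S l'" j] S_l[OF l(1)] S_l[OF l(2)] by simp
  then show ?thesis using l by (simp add: pos_def)
qed

lemma pos_inj:
  assumes "l \<in> {1..a}" "l' \<in> {1..a}" "pos l j = pos l' j"
  shows "l = l'"
  using pos_strict[OF assms(1,2)] pos_strict[OF assms(2,1)] assms(3) by (metis less_irrefl nat_neq_iff)

lemma typeB_iff: "(p, j) \<in> typeB a b c S \<longleftrightarrow> (\<exists>l\<in>{1..a}. j \<in> {1..b + c} \<and> j \<notin> S l \<and> p = pos l j)"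
proof -
  have *: "card {m \<in> {1..b}. nth_elem (S l) m < j} = card {x \<in> S l. x < j}" if "l \<in> {1..a}" for l
    using card_nth_elem_less[of "S l" j] S_l[OF that] by simp
  have "(p, j) \<in> typeB a b c S \<longleftrightarrow>
      (\<exists>l\<in>{1..a}. j \<in> {1..b + c} - S l \<and> p = a - l + 1 + card {m \<in> {1..b}. nth_elem (S l) m < j})"
    unfolding typeB_def by blast
  also have "\<dots> \<longleftrightarrow> (\<exists>l\<in>{1..a}. j \<in> {1..b + c} \<and> j \<notin> S l \<and> p = pos l j)"
    by (rule bex_cong[OF refl]) (simp only: * pos_def Diff_iff conj_assoc)
  finally show ?thesis .
qed

text \<open>At the \<open>m\<close>-th element \<open>s\<close> of \<open>S l\<close> the path has
  position \<open>a - l + m\<close>, so \<open>s + l - m\<close> is \<open>a + s\<close> minus this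
  position; \<open>m \<le> s\<close> prevents truncation.\<close>

lemma typeC_iff: "(j, q) \<in> typeC a b c S \<longleftrightarrow> (\<exists>l\<in>{1..a}. j \<in> S l \<and> q + pos l j = a + j)"
proof -
  have *: "(\<exists>m\<in>{1..b}. j = nth_elem (S l) m \<and> q = nth_elem (S l) m + l - m) \<longleftrightarrow>
      j \<in> S l \<and> q + pos l j = a + j" if l: "l \<in> {1..a}" for l
  proof -
    have bij: "bij_betw (nth_elem (S l)) {1..b} (S l)" using nth_elem_bij[of "S l"] S_l[OF l] by simp
    have pos: "pos l (nth_elem (S l) m) = a - l + m" if "m \<in> {1..b}" for m
      using card_less_nth_elem[of "S l" m] S_l[OF l] that by (simp add: pos_def)
    have "m \<le> nth_elem (S l) m" if "m \<in> {1..b}" for m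
    proof -
      have "nth_elem (S l) m \<in> S l" using bij_betwE[OF bij] that by blast
      then have "nth_elem (S l) m \<in> {1..b + c}" using S_l(1)[OF l] by blast
      then show ?thesis using pos_bounds(3)[OF l, of "nth_elem (S l) m"] pos[OF that] l by auto
    qed
    then have "q = nth_elem (S l) m + l - m \<longleftrightarrow> q + pos l (nth_elem (S l) m) = a + nth_elem (S l) m"
      if "m \<in> {1..b}" for m
      using that pos[OF that] l by fastforce
    then have "(\<exists>m\<in>{1..b}. j = nth_elem (S l) m \<and> q = nth_elem (S l) m + l - m) \<longleftrightarrow>
        (\<exists>m\<in>{1..b}. j = nth_elem (S l) m \<and> q + pos l j = a + j)" by auto
    also have "\<dots> \<longleftrightarrow> j \<in> nth_elem (S l) ` {1..b} \<and> q + pos l j = a + j" by auto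
    finally show ?thesis using bij by (simp add: bij_betw_def)
  qed
  have "(j, q) \<in> typeC a b c S \<longleftrightarrow>
      (\<exists>l\<in>{1..a}. \<exists>m\<in>{1..b}. j = nth_elem (S l) m \<and> q = nth_elem (S l) m + l - m)"
    unfolding typeC_def by blast
  then show ?thesis using * by simp
qed

text \<open>A path runs through the left corner of the hexagon \<open>(p, a + j - p)\<close>.
  Otherwise, away from the boundary, the horizontal edge ending in this corner is a dimer.\<close>

definition cut :: "nat \<Rightarrow> nat \<Rightarrow> bool" where
  "cut p j \<longleftrightarrow> (\<exists>l\<in>{1..a}. p = pos l j)"

context
  fixes p q j
  assumes col: "p + q = a + j" and j: "1 \<le> j" "j \<le> b + c"
begin

lemma typeB_or_typeC: "(p, j) \<in> typeB a b c S \<or> (j, q) \<in> typeC a b c S \<longleftrightarrow> cut p j"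
proof -
  have "q + pos l j = a + j \<longleftrightarrow> p = pos l j" for l using col by auto
  moreover have "j \<in> {1..b + c}" using j by simp
  ultimately show ?thesis unfolding typeB_iff typeC_iff cut_def by blast
qed

lemma not_typeB_and_typeC: "\<not> ((p, j) \<in> typeB a b c S \<and> (j, q) \<in> typeC a b c S)"
proof
  assume "(p, j) \<in> typeB a b c S \<and> (j, q) \<in> typeC a b c S"
  then obtain l l' where "l \<in> {1..a}" "j \<notin> S l" "p = pos l j" "l' \<in> {1..a}" "j \<in> S l'" "q + pos l' j = a + j"
    unfolding typeB_iff typeC_iff by blast
  moreover from this have "pos l j = pos l' j" using col by linarith
  ultimately show False using pos_inj by blast
qed

text \<open>By \<open>pos_Suc\<close>, a path at position \<open>p\<close> of strip \<open>j\<close>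
  uses one of these two edges in strip \<open>j - 1\<close>. They meet in the left end of the
  horizontal edge, so paths cover both of its ends or neither.\<close>

lemma left_typeB_or_typeC:
  assumes "2 \<le> j"
  shows "(p, j - 1) \<in> typeB a b c S \<or> (j - 1, q) \<in> typeC a b c S \<longleftrightarrow> cut p j"
proof -
  have Suc: "pos l j = pos l (j - 1) + (if j - 1 \<in> S l then 1 else 0)" if "l \<in> {1..a}" for l
    using pos_Suc[OF that, of "j - 1"] j by simp
  have "q + pos l (j - 1) = a + (j - 1) \<longleftrightarrow> p = pos l (j - 1) + 1" for l
    using col j by auto
  then have "(p, j - 1) \<in> typeB a b c S \<or> (j - 1, q) \<in> typeC a b c S \<longleftrightarrow>
     (\<exists>l\<in>{1..a}. (j - 1 \<notin> S l \<and> p = pos l (j - 1)) \<or> (j - 1 \<in> S l \<and> p = pos l (j - 1) + 1))"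
  proof -
    have "j - 1 \<in> {1..b + c}" using j assms unfolding atLeastAtMost_iff by arith
    with \<open>\<And>l. q + pos l (j - 1) = a + (j - 1) \<longleftrightarrow> p = pos l (j - 1) + 1\<close> show ?thesis
      unfolding typeB_iff typeC_iff by blast
  qed
  also have "\<dots> \<longleftrightarrow> cut p j" unfolding cut_def using Suc by (intro bex_cong) auto
  finally show ?thesis .
qed

text \<open>In the first strip the paths occupy all positions from 1 to \<open>a\<close>, so no
  horizontal dimer ends there, in line with the bound \<open>a + 2 \<le> i + k\<close> for type
  \<open>BC\<close>.\<close>

lemma cut_1:
  assumes "j = 1" "1 \<le> p" "1 \<le> q"
  shows "cut p j"
proof -
  have l: "a + 1 - p \<in> {1..a}" using col assms by auto
  have "p = pos (a + 1 - p) j" unfolding assms(1) pos_1[OF l] using col assms by auto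
  then show ?thesis unfolding cut_def using l by blast
qed

lemma not_typeC_boundary: "p = 0 \<Longrightarrow> (j, q) \<notin> typeC a b c S"
  unfolding typeC_iff using col by (auto simp: pos_def)

lemma not_typeB_boundary: "q = 0 \<Longrightarrow> (p, j) \<notin> typeB a b c S"
  unfolding typeB_iff using col j pos_bounds(3) by fastforce

end

text \<open>The definition of type \<open>BC\<close> looks at the left end of the horizontal edge,
  this criterion at the right end, which is the left corner of the hexagon
  \<open>(p, q)\<close>.\<close>

lemma typeBC_iff: "(p, q) \<in> typeBC a b c S \<longleftrightarrow> 1 \<le> p \<and> 1 \<le> q \<and> (p, q) \<in> hexagons a b c \<and>
   a + 1 \<le> p + q \<and> \<not> cut p (p + q - a)"
proof (cases "1 \<le> p \<and> 1 \<le> q \<and> (p, q) \<in> hexagons a b c \<and> a + 1 \<le> p + q")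
  case True
  define j where "j = p + q - a"
  have col: "p + q = a + j" "1 \<le> j" "j \<le> b + c" using True by (auto simp: j_def hexagons_def)
  have "(p, q) \<in> typeBC a b c S \<longleftrightarrow> 2 \<le> j \<and> \<not> ((p, j - 1) \<in> typeB a b c S \<or> (j - 1, q) \<in> typeC a b c S)"
  proof -
    have "p \<in> {1..a + b}" "q \<in> {1..a + c}" "p + q \<le> a + b + c" "a + 2 \<le> p + q \<longleftrightarrow> 2 \<le> j"
      using True col by (auto simp: hexagons_def)
    then show ?thesis unfolding typeBC_def j_def by simp
  qed
  also have "\<dots> \<longleftrightarrow> \<not> cut p j"
  proof (cases "2 \<le> j")
    case True
    then show ?thesis using left_typeB_or_typeC[OF col True] by blast
  next
    case False
    then have "j = 1" using col by simp
    then show ?thesis using cut_1[OF col] \<open>1 \<le> p \<and> _\<close> by auto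
  qed
  finally show ?thesis using True by (simp add: j_def)
next
  case False
  then show ?thesis by (auto simp: typeBC_def hexagons_def)
qed

end

section \<open>Relevant edges and their hexagons\<close>

context plane_partition
begin

abbreviation "Rel \<equiv> relevant_vars a b c S"
abbreviation "H \<equiv> hexagons a b c"

text \<open>The edge is indexed by the hexagon \<open>(p, q)\<close> on its right; the equation
  \<open>p + q = a + j\<close> takes the place of truncated subtractions.\<close>

lemma BVar_relevant_iff: "BVar p j \<in> Rel \<longleftrightarrow>
    (\<exists>q. p + q = a + j \<and> (p, q) \<in> H \<and> 1 \<le> p \<and> 1 \<le> j \<and> (p, j) \<notin> typeB a b c S)"
proof
  assume "BVar p j \<in> Rel"
  then show "\<exists>q. p + q = a + j \<and> (p, q) \<in> H \<and> 1 \<le> p \<and> 1 \<le> j \<and> (p, j) \<notin> typeB a b c S"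
    by (intro exI[of _ "a + j - p"]) (auto simp: relevant_vars_def hexagons_def)
qed (auto simp: relevant_vars_def hexagons_def)

lemma CVar_relevant_iff: "CVar j q \<in> Rel \<longleftrightarrow>
    (\<exists>p. p + q = a + j \<and> (p, q) \<in> H \<and> 1 \<le> q \<and> 1 \<le> j \<and> (j, q) \<notin> typeC a b c S)"
proof
  assume "CVar j q \<in> Rel"
  then show "\<exists>p. p + q = a + j \<and> (p, q) \<in> H \<and> 1 \<le> q \<and> 1 \<le> j \<and> (j, q) \<notin> typeC a b c S"
    by (intro exI[of _ "a + j - q"]) (auto simp: relevant_vars_def hexagons_def)
qed (auto simp: relevant_vars_def hexagons_def)

lemma StarVar_not_relevant: "StarVar i k \<notin> Rel"
  by (simp add: relevant_vars_def)

lemma relevant_cases [consumes 1]: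
  assumes "v \<in> Rel"
  obtains (B) p q j where "v = BVar p j" "p + q = a + j" "(p, q) \<in> H" "1 \<le> p" "1 \<le> j" "(p, j) \<notin> typeB a b c S"
  | (C) p q j where "v = CVar j q" "p + q = a + j" "(p, q) \<in> H" "1 \<le> q" "1 \<le> j" "(j, q) \<notin> typeC a b c S"
  using assms BVar_relevant_iff CVar_relevant_iff StarVar_not_relevant by (cases v) blast+

text \<open>A \<open>B\<close> edge has its right hexagon below and a \<open>C\<close> edge above,
  so their degrees have opposite signs there. The value at horizontal edges is a dummy.\<close>

fun right_hex :: "edge \<Rightarrow> nat \<times> nat" where
  "right_hex (BVar i j) = hex_below a (BVar i j)"
| "right_hex (CVar j k) = hex_above a (CVar j k)"
| "right_hex (StarVar i k) = (0, 0)"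

fun left_hex :: "edge \<Rightarrow> nat \<times> nat" where
  "left_hex (BVar i j) = hex_above a (BVar i j)"
| "left_hex (CVar j k) = hex_below a (CVar j k)"
| "left_hex (StarVar i k) = (0, 0)"

lemma left_right_hex:
  assumes "v \<in> Rel"
  shows "right_hex v \<in> H" "left_hex v \<in> H"
    "fst (right_hex v) + snd (right_hex v) = Suc (fst (left_hex v) + snd (left_hex v))"
    "edge_degree a v = frag_of (left_hex v) - frag_of (right_hex v) \<or>
     edge_degree a v = frag_of (right_hex v) - frag_of (left_hex v)"
    "{hex_above a v, hex_below a v} = {left_hex v, right_hex v}"
  using assms
  by (atomize (full), cases rule: relevant_cases) (auto simp: hexagons_def edge_degree_def)

text \<open>At most one of the two left edges is a dimer, and where the boundary removes one of
  them, the other is not a dimer.\<close>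

lemma hexagon_has_relevant:
  assumes h: "(p, q) \<in> H" and j: "p + q = a + j" "1 \<le> j"
  shows "(1 \<le> p \<and> BVar p j \<in> Rel) \<or> (1 \<le> q \<and> CVar j q \<in> Rel)"
proof -
  have jb: "j \<le> b + c" using h j by (auto simp: hexagons_def)
  note * = not_typeB_and_typeC[OF j jb] not_typeC_boundary[OF j jb] not_typeB_boundary[OF j jb]
  have B: "BVar p j \<in> Rel \<longleftrightarrow> 1 \<le> p \<and> (p, j) \<notin> typeB a b c S"
    unfolding BVar_relevant_iff using h j by auto
  have C: "CVar j q \<in> Rel \<longleftrightarrow> 1 \<le> q \<and> (j, q) \<notin> typeC a b c S"
    unfolding CVar_relevant_iff using h j by auto
  show ?thesis unfolding B C using * j by (cases "p = 0"; cases "q = 0") auto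
qed

lemma right_hex_surj: "right_hex ` Rel = {(p, q) \<in> H. a < p + q}"
proof (intro equalityI subsetI)
  fix h assume "h \<in> right_hex ` Rel"
  then obtain v where v: "v \<in> Rel" "h = right_hex v" by blast
  have "a \<le> fst (left_hex v) + snd (left_hex v)" using left_right_hex(2)[OF v(1)] by (auto simp: hexagons_def)
  then show "h \<in> {(p, q) \<in> H. a < p + q}"
    using left_right_hex(1,3)[OF v(1)] v(2) by (cases "right_hex v") auto
next
  fix h assume "h \<in> {(p, q) \<in> H. a < p + q}"
  then obtain p q where pq: "h = (p, q)" "(p, q) \<in> H" "a < p + q" by blast
  define j where "j = p + q - a"
  have h: "h = (p, q)" "(p, q) \<in> H" "p + q = a + j" "1 \<le> j" using pq by (auto simp: j_def)
  from hexagon_has_relevant[OF h(2-4)] show "h \<in> right_hex ` Rel"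
  proof
    assume "1 \<le> p \<and> BVar p j \<in> Rel"
    then show ?thesis using h by (intro image_eqI[of _ _ "BVar p j"]) auto
  next
    assume "1 \<le> q \<and> CVar j q \<in> Rel"
    then show ?thesis using h by (intro image_eqI[of _ _ "CVar j q"]) auto
  qed
qed

text \<open>The leading edges meet in the right end of the horizontal dimer, the trailing edges in
  its left end. As the dimer covers both ends, none of the four edges is in
  \<open>S\<close>.\<close>

lemma typeBC_relevant:
  assumes pq: "(p, q) \<in> typeBC a b c S"
  defines "j \<equiv> p + q - a"
  shows "BVar p j \<in> Rel" "CVar j q \<in> Rel" "BVar p (j - 1) \<in> Rel" "CVar (j - 1) q \<in> Rel"
    "p + q = a + j" "2 \<le> j" "1 \<le> p" "1 \<le> q"
proof -
  have 1: "p \<in> {1..a + b}" "q \<in> {1..a + c}" "a + 2 \<le> p + q" "p + q \<le> a + b + c"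
    "(p, j - 1) \<notin> typeB a b c S" "(j - 1, q) \<notin> typeC a b c S"
    using pq by (auto simp: typeBC_def j_def)
  have j: "p + q = a + j" "2 \<le> j" "j \<le> b + c" using 1 by (auto simp: j_def)
  have "\<not> cut p j" using pq unfolding typeBC_iff j_def by simp
  then have 2: "(p, j) \<notin> typeB a b c S" "(j, q) \<notin> typeC a b c S"
    using typeB_or_typeC[of p q j] j by auto
  show "p + q = a + j" "2 \<le> j" "1 \<le> p" "1 \<le> q" using j 1 by auto
  have H: "(p, q) \<in> H" "(p - 1, q) \<in> H" "(p, q - 1) \<in> H" using 1 by (auto simp: hexagons_def)
  show "BVar p j \<in> Rel" unfolding BVar_relevant_iff using H 1 2 j by auto
  show "CVar j q \<in> Rel" unfolding CVar_relevant_iff using H 1 2 j by auto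
  show "BVar p (j - 1) \<in> Rel" unfolding BVar_relevant_iff using H 1 j by (intro exI[of _ "q - 1"]) auto
  show "CVar (j - 1) q \<in> Rel" unfolding CVar_relevant_iff using H 1 j by (intro exI[of _ "p - 1"]) auto
qed

text \<open>A hexagon has just one \<open>B\<close> and one \<open>C\<close> edge on its left. If
  both are relevant, no path passes through its left corner.\<close>

lemma right_hex_eq_imp_typeBC:
  assumes v: "v \<in> Rel" "v' \<in> Rel" "v \<noteq> v'" "right_hex v = right_hex v'"
  shows "\<exists>(p, q)\<in>typeBC a b c S. {v, v'} = {BVar p (p + q - a), CVar (p + q - a) q}"
proof -
  have main: "\<exists>(p', q')\<in>typeBC a b c S. {BVar p j, CVar j q} = {BVar p' (p' + q' - a), CVar (p' + q' - a) q'}"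
    if h: "p + q = a + j" "(p, q) \<in> H" "1 \<le> p" "1 \<le> q" "1 \<le> j" "(p, j) \<notin> typeB a b c S" "(j, q) \<notin> typeC a b c S" for p q j
  proof -
    have "j \<le> b + c" using h by (auto simp: hexagons_def)
    then have "\<not> cut p j" using typeB_or_typeC[OF h(1,5)] h by blast
    moreover have "p + q - a = j" using h by simp
    ultimately have "(p, q) \<in> typeBC a b c S" unfolding typeBC_iff using h by simp
    then show ?thesis using \<open>p + q - a = j\<close> by (intro bexI[of _ "(p, q)"]) simp_all
  qed
  have right: "right_hex (BVar p j) = (p, q)" "right_hex (CVar j q) = (p, q)" if "p + q = a + j" for p q j
    using that by auto
  show ?thesis using v(1)
  proof (cases rule: relevant_cases)
    case (B p q j)
    note B1 = this
    show ?thesis using v(2)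
    proof (cases rule: relevant_cases)
      case (B p' q' j')
      have "(p, q) = (p', q')" using v(4) right(1)[OF B1(2)] right(1)[OF B(2)] B1(1) B(1) by (simp only:)
      then show ?thesis using B1 B v(3) by simp
    next
      case (C p' q' j')
      have "(p, q) = (p', q')" using v(4) right(1)[OF B1(2)] right(2)[OF C(2)] B1(1) C(1) by (simp only:)
      then have "p' = p" "q' = q" by simp_all
      moreover from this have "j' = j" using B1(2) C(2) by simp
      ultimately show ?thesis using main[OF B1(2,3,4) _ B1(5,6)] C B1(1) by simp
    qed
  next
    case (C p q j)
    note C1 = this
    show ?thesis using v(2)
    proof (cases rule: relevant_cases)
      case (C p' q' j')
      have "(p, q) = (p', q')" using v(4) right(2)[OF C1(2)] right(2)[OF C(2)] C1(1) C(1) by (simp only:)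
      then show ?thesis using C1 C v(3) by simp
    next
      case (B p' q' j')
      have "(p, q) = (p', q')" using v(4) right(2)[OF C1(2)] right(1)[OF B(2)] C1(1) B(1) by (simp only:)
      then have "p' = p" "q' = q" by simp_all
      moreover from this have "j' = j" using C1(2) B(2) by simp
      ultimately show ?thesis
        using main[OF C1(2,3) _ C1(4,5) _ C1(6)] B C1(1) by (simp add: insert_commute)
    qed
  qed
qed

text \<open>
  The variables that are neither relevant nor killed by \<open>S\<close> are free; they get basis vectors outside
  of the hexagon as degrees.
\<close>

fun free_coord :: "edge \<Rightarrow> nat \<times> nat" where
  "free_coord (BVar i j) = (a + b + 1 + 3 * i, j)"
| "free_coord (CVar j k) = (a + b + 2 + 3 * j, k)"
| "free_coord (StarVar i k) = (a + b + 3 + 3 * i, k)"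

text \<open>The first coordinate, taken modulo 3 after subtracting \<open>a + b\<close>, tells the
  three kinds of variables apart.\<close>

lemma free_coord_inj: "free_coord v = free_coord v' \<Longrightarrow> v = v'"
  by (cases v; cases v'; simp; presburger)

lemma free_coord_notin: "free_coord v \<notin> H"
  by (cases v) (auto simp: hexagons_def)

definition edge_weight :: "edge \<Rightarrow> (nat \<times> nat) \<Rightarrow>\<^sub>0 int" where
  "edge_weight v = (if v \<in> Rel then edge_degree a v else frag_of (free_coord v))"

text \<open>The two \<open>B\<close> edges of a relation lie in neighbouring strips \<open>j\<close>
  and \<open>j - 1\<close>, hence their signs are opposite.\<close>

definition edge_sign :: "edge \<Rightarrow> complex" where
  "edge_sign v = (case v of
      BVar i j \<Rightarrow> if (i, j) \<in> typeB a b c S then 0 else (- 1) ^ j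
    | CVar j k \<Rightarrow> if (j, k) \<in> typeC a b c S then 0 else 1
    | StarVar i k \<Rightarrow> 1)"

definition edge_coord :: "edge \<Rightarrow> nat \<times> nat" where
  "edge_coord v = (if v \<in> Rel then right_hex v else free_coord v)"

text \<open>Coordinates of free variables lie outside of \<open>H\<close> and get column 0. This is
  harmless for triangularity, since their degrees are single basis vectors.\<close>

definition column :: "nat \<times> nat \<Rightarrow> nat" where
  "column h = (if h \<in> H then fst h + snd h - a else 0)"

lemma edge_sign_relevant: "v \<in> Rel \<Longrightarrow> edge_sign v \<noteq> 0"
  by (cases rule: relevant_cases) (auto simp: edge_sign_def)

lemma column_left: "v \<in> Rel \<Longrightarrow> column (right_hex v) = Suc (column (left_hex v))"
  using left_right_hex(1-3)[of v] by (auto simp: column_def hexagons_def)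

text \<open>Both pairs have as degree the hexagon \<open>(p - 1, q)\<close> above the horizontal
  dimer minus the hexagon \<open>(p, q - 1)\<close> below it.\<close>

lemma typeBC_edges:
  assumes pq: "(p, q) \<in> typeBC a b c S"
  defines "j \<equiv> p + q - a"
  shows "edge_coord (BVar p j) = (p, q)" "edge_coord (CVar j q) = (p, q)"
    "column (edge_coord (BVar p (j - 1))) < column (p, q)" "column (edge_coord (CVar (j - 1) q)) < column (p, q)"
    "edge_weight (BVar p j) + edge_weight (CVar j q) = edge_weight (BVar p (j - 1)) + edge_weight (CVar (j - 1) q)"
    "edge_sign (BVar p j) * edge_sign (CVar j q) = - (edge_sign (BVar p (j - 1)) * edge_sign (CVar (j - 1) q))"
    "Poly_Mapping.lookup (edge_weight (BVar p j)) (p, q) = - Poly_Mapping.lookup (edge_weight (CVar j q)) (p, q)"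
proof -
  note * = typeBC_relevant[OF pq, folded j_def]
  have sub: "a + j - p = q" "a + j - q = p" "a + (j - 1) - p = q - 1" "a + (j - 1) - q = p - 1" using * by auto
  have right: "right_hex (BVar p j) = (p, q)" "right_hex (CVar j q) = (p, q)"
    "right_hex (BVar p (j - 1)) = (p, q - 1)" "right_hex (CVar (j - 1) q) = (p - 1, q)"
    by (simp_all only: right_hex.simps hex_below.simps hex_above.simps sub)
  have hex: "(p, q) \<in> H" "(p, q - 1) \<in> H" "(p - 1, q) \<in> H"
    using left_right_hex(1)[OF *(1)] left_right_hex(1)[OF *(3)] left_right_hex(1)[OF *(4)] unfolding right by auto
  show "edge_coord (BVar p j) = (p, q)" "edge_coord (CVar j q) = (p, q)"
    unfolding edge_coord_def if_P[OF *(1)] if_P[OF *(2)] right by (rule refl)+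
  show "column (edge_coord (BVar p (j - 1))) < column (p, q)" "column (edge_coord (CVar (j - 1) q)) < column (p, q)"
    unfolding edge_coord_def if_P[OF *(3)] if_P[OF *(4)] right using hex * by (auto simp: column_def)
  show "edge_weight (BVar p j) + edge_weight (CVar j q) = edge_weight (BVar p (j - 1)) + edge_weight (CVar (j - 1) q)"
    unfolding edge_weight_def if_P[OF *(1)] if_P[OF *(2)] if_P[OF *(3)] if_P[OF *(4)] edge_degree_def
      hex_below.simps hex_above.simps sub by simp
  have "(p, j) \<notin> typeB a b c S" "(j, q) \<notin> typeC a b c S" "(p, j - 1) \<notin> typeB a b c S" "(j - 1, q) \<notin> typeC a b c S"
    using *(1-4) unfolding BVar_relevant_iff CVar_relevant_iff by blast+
  moreover have "(- 1 :: complex) ^ j = - ((- 1) ^ (j - 1))"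
    using *(6) power_Suc[of "- 1 :: complex" "j - 1"] by simp
  ultimately show "edge_sign (BVar p j) * edge_sign (CVar j q) = - (edge_sign (BVar p (j - 1)) * edge_sign (CVar (j - 1) q))"
    unfolding edge_sign_def by simp
  have "(p - 1, q) \<noteq> (p, q)" "(p, q - 1) \<noteq> (p, q)" using * by auto
  then show "Poly_Mapping.lookup (edge_weight (BVar p j)) (p, q) = - Poly_Mapping.lookup (edge_weight (CVar j q)) (p, q)"
    unfolding edge_weight_def if_P[OF *(1)] if_P[OF *(2)] edge_degree_def hex_below.simps hex_above.simps sub
    by (simp add: lookup_minus)
qed

lemma edge_coord_eq_imp_typeBC:
  assumes "v \<noteq> v'" "edge_coord v = edge_coord v'"
  shows "\<exists>(p, q)\<in>typeBC a b c S. {v, v'} = {BVar p (p + q - a), CVar (p + q - a) q}"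
proof -
  have "right_hex u \<noteq> free_coord u'" if "u \<in> Rel" for u u'
    using left_right_hex(1)[OF that] free_coord_notin by metis
  then have "v \<in> Rel \<and> v' \<in> Rel \<and> right_hex v = right_hex v'"
    using assms free_coord_inj[of v v'] unfolding edge_coord_def by metis
  then show ?thesis using right_hex_eq_imp_typeBC assms(1) by blast
qed

text \<open>\<open>V\<close> is left open: it will be the set of all variables for
  \<open>A_ring\<close> and the set of relevant ones for \<open>A'_ring\<close>.\<close>

lemma toric_edges:
  assumes V: "finite V" "Rel \<subseteq> V"
  shows "toric V edge_weight edge_sign edge_coord column (typeBC a b c S)
    (\<lambda>(p, q). BVar p (p + q - a)) (\<lambda>(p, q). CVar (p + q - a) q)
    (\<lambda>(p, q). BVar p (p + q - a - 1)) (\<lambda>(p, q). CVar (p + q - a - 1) q)"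
proof (rule toric.intro)
  show "finite V" by fact
next
  fix v v' assume "v \<in> {v \<in> V. edge_sign v \<noteq> 0}" "v' \<in> {v \<in> V. edge_sign v \<noteq> 0}" "v \<noteq> v'" "edge_coord v = edge_coord v'"
  then show "\<exists>i\<in>typeBC a b c S. {v, v'} = {case i of (p, q) \<Rightarrow> BVar p (p + q - a), case i of (p, q) \<Rightarrow> CVar (p + q - a) q}"
    using edge_coord_eq_imp_typeBC[of v v'] by (auto simp: case_prod_unfold)
next
  show "inj_on (\<lambda>i. edge_coord (case i of (p, q) \<Rightarrow> BVar p (p + q - a))) (typeBC a b c S)"
    by (rule inj_on_inverseI[of _ "\<lambda>h. h"]) (clarify, simp only: prod.case typeBC_edges(1))
next
  fix v assume "v \<in> {v \<in> V. edge_sign v \<noteq> 0}"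
  have "left_hex v \<noteq> right_hex v" "right_hex v \<noteq> left_hex v" if "v \<in> Rel"
    using left_right_hex(3)[OF that] by force+
  then show "Poly_Mapping.lookup (edge_weight v) (edge_coord v) \<noteq> 0"
    using left_right_hex(4)[of v] by (auto simp: edge_weight_def edge_coord_def lookup_minus)
next
  fix v h assume "v \<in> {v \<in> V. edge_sign v \<noteq> 0}" "Poly_Mapping.lookup (edge_weight v) h \<noteq> 0" "h \<noteq> edge_coord v"
  then show "column h < column (edge_coord v)"
    using left_right_hex(4)[of v] column_left[of v]
    by (auto simp: edge_weight_def edge_coord_def lookup_minus split: if_splits)
qed (clarify, simp only: prod.case mem_Collect_eq typeBC_edges typeBC_relevant(1-4) edge_sign_relevant subsetD[OF V(2)] edge.simps simp_thms)+

end

section \<open>Counting hexagons and horizontal dimers\<close>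

lemma card_triangle: "2 * card {(p, q). p + q < (n::nat)} = n * Suc n"
  and finite_triangle: "finite {(p, q). p + q < (n::nat)}"
proof -
  have eq: "{(p, q). p + q < n} = Sigma {..<n} (\<lambda>p. {..<n - p})" by auto
  show "finite {(p, q). p + q < n}" unfolding eq by simp
  have "2 * (\<Sum>p<n. n - p) = n * Suc n"
  proof (induction n)
    case (Suc n)
    have "(\<Sum>p<Suc n. Suc n - p) = Suc n + (\<Sum>p<n. n - p)"
      unfolding sum.lessThan_Suc_shift by simp
    then show ?case using Suc by simp
  qed simp
  then show "2 * card {(p, q). p + q < n} = n * Suc n" unfolding eq by simp
qed

lemma finite_hexagons: "finite (hexagons a b c)"
  by (rule finite_subset[of _ "{..a + b} \<times> {..a + c}"]) (auto simp: hexagons_def)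

lemma card_upper_corner: "card {(p, q). p \<le> a + b \<and> q \<le> a + c \<and> a + b + c < p + q} = card {(p, q). p + q < (a::nat)}"
proof (rule bij_betw_same_card[of "\<lambda>(p, q). (a + b - p, a + c - q)"])
  show "bij_betw (\<lambda>(p, q). (a + b - p, a + c - q)) {(p, q). p \<le> a + b \<and> q \<le> a + c \<and> a + b + c < p + q} {(p, q). p + q < a}"
    by (rule bij_betw_byWitness[where f' = "\<lambda>(p, q). (a + b - p, a + c - q)"]) auto
qed

text \<open>The hexagon is a parallelogram with \<open>(a + b + 1) * (a + c + 1)\<close> points
  minus two corner triangles of side \<open>a\<close>. Everything is doubled to avoid
  halves.\<close>

lemma card_hexagons: "card (hexagons a b c) = a * b + a * c + b * c + a + b + c + 1"
proof -
  let ?L = "{(p, q). p + q < a}" and ?U = "{(p, q). p \<le> a + b \<and> q \<le> a + c \<and> a + b + c < p + q}"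
  have fin: "finite ?U" by (rule finite_subset[of _ "{..a + b} \<times> {..a + c}"]) auto
  have eq: "{..a + b} \<times> {..a + c} = (hexagons a b c \<union> ?L) \<union> ?U" by (auto simp: hexagons_def)
  have "card ({..a + b} \<times> {..a + c}) = card (hexagons a b c) + card ?L + card ?U"
    unfolding eq using finite_hexagons finite_triangle fin
    by (subst card_Un_disjoint; (subst card_Un_disjoint)?) (auto simp: hexagons_def)
  then have "2 * card (hexagons a b c) + 2 * (2 * card ?L) = 2 * (Suc (a + b) * Suc (a + c))"
    by (simp add: card_cartesian_product card_upper_corner)
  then show ?thesis unfolding card_triangle by (simp add: algebra_simps)
qed

lemma card_left_column: "card {(p, q) \<in> hexagons a b c. p + q = a} = a + 1"
proof -
  have "{(p, q) \<in> hexagons a b c. p + q = a} = (\<lambda>p. (p, a - p)) ` {..a}"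
    by (auto simp: hexagons_def image_iff)
  moreover have "inj_on (\<lambda>p. (p, a - p)) {..a}" by (auto simp: inj_on_def)
  ultimately show ?thesis by (simp add: card_image)
qed

lemma card_right_columns: "card {(p, q) \<in> hexagons a b c. a < p + q} = a * b + a * c + b * c + b + c"
proof -
  have "hexagons a b c = {(p, q) \<in> hexagons a b c. p + q = a} \<union> {(p, q) \<in> hexagons a b c. a < p + q}"
    by (auto simp: hexagons_def)
  moreover have "card \<dots> = card {(p, q) \<in> hexagons a b c. p + q = a} + card {(p, q) \<in> hexagons a b c. a < p + q}"
    by (rule card_Un_disjoint) (auto intro: finite_subset[OF _ finite_hexagons])
  ultimately show ?thesis using card_hexagons card_left_column by simp
qed

lemma rank_hex_lattice: "rank (hex_lattice a b c) = enat (card (hexagons a b c))"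
proof (rule antisym)
  show "rank (hex_lattice a b c) \<le> enat (card (hexagons a b c))"
  proof (rule rank_le[OF finite_hexagons])
    fix Q c' assume "finite Q" "Q \<subseteq> hex_lattice a b c"
      and 0: "\<And>y. y \<in> hexagons a b c \<Longrightarrow> Poly_Mapping.lookup (\<Sum>q\<in>Q. frag_cmul (c' q) q) y = 0"
    show "(\<Sum>q\<in>Q. frag_cmul (c' q) q) = 0"
    proof (rule poly_mapping_eqI)
      fix y
      have "Poly_Mapping.lookup q y = 0" if "y \<notin> hexagons a b c" "q \<in> Q" for q
      proof -
        have "y \<notin> Poly_Mapping.keys q" using that \<open>Q \<subseteq> hex_lattice a b c\<close> unfolding hex_lattice_def by blast
        then show ?thesis by (simp add: in_keys_iff)
      qed
      then show "Poly_Mapping.lookup (\<Sum>q\<in>Q. frag_cmul (c' q) q) y = Poly_Mapping.lookup 0 y"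
        using 0[of y] by (cases "y \<in> hexagons a b c") (simp_all add: lookup_sum)
    qed
  qed
  show "enat (card (hexagons a b c)) \<le> rank (hex_lattice a b c)"
    by (rule rank_ge[OF finite_hexagons, where g = frag_of and col = "\<lambda>_. 0"]) (auto simp: hex_lattice_def keys_frag_of)
qed

context plane_partition
begin

text \<open>\<open>?K\<close> collects the hexagons whose left corner may be the end of a horizontal
  dimer, \<open>ab + ac + bc\<close> in number. The paths take \<open>a * (b + c)\<close> of them,
  one for each path and strip.\<close>

lemma card_typeBC: "card (typeBC a b c S) = b * c"
proof -
  let ?K = "{(p, q). 1 \<le> p \<and> 1 \<le> q \<and> (p, q) \<in> H \<and> a + 1 \<le> p + q}"
  let ?L = "{(p, q). 1 \<le> p \<and> 1 \<le> q \<and> p + q \<le> a}"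
  let ?U = "{(p, q). p \<le> a + b \<and> q \<le> a + c \<and> a + b + c < p + q}"
  have finK: "finite ?K" by (rule finite_subset[OF _ finite_hexagons]) auto
  have finL: "finite ?L" by (rule finite_subset[of _ "{..a} \<times> {..a}"]) auto
  have finU: "finite ?U" by (rule finite_subset[of _ "{..a + b} \<times> {..a + c}"]) auto
  have cardL: "card ?L = card {(p, q). p + q < a - 1}"
  proof (rule bij_betw_same_card[of "\<lambda>(p, q). (p - 1, q - 1)"])
    show "bij_betw (\<lambda>(p, q). (p - 1, q - 1)) ?L {(p, q). p + q < a - 1}"
      by (rule bij_betw_byWitness[where f' = "\<lambda>(p, q). (p + 1, q + 1)"]) auto
  qed
  have eq: "{1..a + b} \<times> {1..a + c} = (?K \<union> ?L) \<union> ?U" by (auto simp: hexagons_def)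
  have "card ({1..a + b} \<times> {1..a + c}) = card ?K + card ?L + card ?U"
    unfolding eq using finK finL finU
    by (subst card_Un_disjoint; (subst card_Un_disjoint)?) (auto simp: hexagons_def)
  then have "(a + b) * (a + c) = card ?K + card {(p, q). p + q < a - 1} + card {(p, q). p + q < a}"
    unfolding card_cartesian_product card_upper_corner cardL by simp
  then have "2 * card ?K + (a - 1) * Suc (a - 1) + a * Suc a = 2 * ((a + b) * (a + c))"
    using card_triangle[of "a - 1"] card_triangle[of a] by linarith
  moreover have "(a - 1) * Suc (a - 1) + a * Suc a = 2 * (a * a)"
    by (cases a) (auto simp: algebra_simps)
  ultimately have K: "card ?K = a * b + a * c + b * c" by (simp add: algebra_simps)
  let ?f = "\<lambda>(l, j). (pos l j, a + j - pos l j)"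
  let ?D = "{1..a} \<times> {1..b + c}"
  have D: "pos l j + (a + j - pos l j) = a + j" "(pos l j, a + j - pos l j) \<in> ?K" if "l \<in> {1..a}" "j \<in> {1..b + c}" for l j
    using pos_bounds[of l j] that by (auto simp: hexagons_def)
  have inj: "inj_on ?f ?D"
  proof (rule inj_onI, clarify)
    fix l j l' j' assume lj: "l \<in> {1..a}" "j \<in> {1..b + c}" "l' \<in> {1..a}" "j' \<in> {1..b + c}"
      and eq: "pos l j = pos l' j'" "a + j - pos l j = a + j' - pos l' j'"
    have "j = j'" using D(1)[OF lj(1,2)] D(1)[OF lj(3,4)] eq by simp
    then show "l = l' \<and> j = j'" using pos_inj[OF lj(1,3)] eq by simp
  qed
  have "typeBC a b c S = ?K - ?f ` ?D"
  proof (intro equalityI subsetI)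
    fix h assume h: "h \<in> typeBC a b c S"
    obtain p q where pq: "h = (p, q)" by (cases h)
    have "h \<notin> ?f ` ?D"
    proof
      assume "h \<in> ?f ` ?D"
      then obtain l j where lj: "l \<in> {1..a}" "j \<in> {1..b + c}" "p = pos l j" "q = a + j - pos l j"
        unfolding pq by auto
      then have "p + q - a = j" using D(1)[OF lj(1,2)] by simp
      then have "cut p (p + q - a)" unfolding cut_def using lj by blast
      then show False using h unfolding pq typeBC_iff by simp
    qed
    then show "h \<in> ?K - ?f ` ?D" using h unfolding pq typeBC_iff by auto
  next
    fix h assume h: "h \<in> ?K - ?f ` ?D"
    obtain p q where pq: "h = (p, q)" by (cases h)
    have K: "1 \<le> p" "1 \<le> q" "(p, q) \<in> H" "a + 1 \<le> p + q" using h pq by auto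
    have "\<not> cut p (p + q - a)"
    proof
      assume "cut p (p + q - a)"
      then obtain l where l: "l \<in> {1..a}" "p = pos l (p + q - a)" unfolding cut_def by blast
      moreover have "p + q - a \<in> {1..b + c}" using K by (auto simp: hexagons_def)
      moreover have "q = a + (p + q - a) - p" using K by simp
      ultimately have "h \<in> ?f ` ?D" unfolding pq by (intro image_eqI[of _ _ "(l, p + q - a)"]) auto
      then show False using h by blast
    qed
    then show "h \<in> typeBC a b c S" using K unfolding pq typeBC_iff by blast
  qed
  moreover have "?f ` ?D \<subseteq> ?K" using D(2) by auto
  ultimately have "card (typeBC a b c S) = card ?K - card (?f ` ?D)"
    using finK by (simp add: card_Diff_subset finite_subset)
  also have "\<dots> = b * c" unfolding K card_image[OF inj] by (simp add: card_cartesian_product algebra_simps)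
  finally show ?thesis .
qed

section \<open>Regions\<close>

text \<open>The first argument is the number of columns still to be crossed. The choice of the edge
  is arbitrary; \<open>root_edge\<close> shows that the result does not depend on it.\<close>

fun left_end :: "nat \<Rightarrow> nat \<times> nat \<Rightarrow> nat \<times> nat" where
  "left_end 0 h = h"
| "left_end (Suc n) h = left_end n (left_hex (SOME v. v \<in> Rel \<and> right_hex v = h))"

definition root :: "nat \<times> nat \<Rightarrow> nat \<times> nat" where
  "root h = left_end (column h) h"

lemma root_step:
  assumes "h \<in> right_hex ` Rel"
  obtains v where "v \<in> Rel" "right_hex v = h" "root h = root (left_hex v)"
proof
  define v where "v = (SOME v. v \<in> Rel \<and> right_hex v = h)"
  have "\<exists>v. v \<in> Rel \<and> right_hex v = h" using assms by blast
  then have v: "v \<in> Rel \<and> right_hex v = h" unfolding v_def by (rule someI_ex)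
  then show "v \<in> Rel" "right_hex v = h" by auto
  have "column h = Suc (column (left_hex v))" using v column_left by blast
  then show "root h = root (left_hex v)" by (simp add: root_def v_def)
qed

text \<open>
  The two left neighbours of a hexagon next to a horizontal dimer are connected through the hexagon
  to the left of that dimer.
\<close>

lemma root_edge: "v \<in> Rel \<Longrightarrow> root (right_hex v) = root (left_hex v)"
proof (induction "column (right_hex v)" arbitrary: v rule: less_induct)
  case less
  obtain u where u: "u \<in> Rel" "right_hex u = right_hex v" "root (right_hex v) = root (left_hex u)"
    by (rule root_step[of "right_hex v"]) (use less.prems in auto)
  show ?case
  proof (cases "u = v")
    case False
    from right_hex_eq_imp_typeBC[OF u(1) less.prems this u(2)] obtain p q where
      pq: "(p, q) \<in> typeBC a b c S" "{u, v} = {BVar p (p + q - a), CVar (p + q - a) q}" by blast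
    define j where "j = p + q - a"
    note * = typeBC_relevant[OF pq(1), folded j_def]
    have sub: "a + j - p = q" "a + j - q = p" "a + (j - 1) - p = q - 1" "a + (j - 1) - q = p - 1" using * by auto
    let ?b = "BVar p (j - 1)" and ?c = "CVar (j - 1) q"
    have hexes: "right_hex (BVar p j) = (p, q)" "right_hex (CVar j q) = (p, q)" "right_hex ?b = (p, q - 1)" "right_hex ?c = (p - 1, q)"
      "left_hex (BVar p j) = (p - 1, q)" "left_hex (CVar j q) = (p, q - 1)" "left_hex ?b = (p - 1, q - 1)" "left_hex ?c = (p - 1, q - 1)"
      by (simp_all only: right_hex.simps left_hex.simps hex_below.simps hex_above.simps sub)
    have "column (right_hex v) = column (p, q)" using pq(2) hexes(1,2) by (auto simp: doubleton_eq_iff j_def)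
    moreover have "column (p, q - 1) < column (p, q)" "column (p - 1, q) < column (p, q)"
      using column_left[OF *(1)] column_left[OF *(2)] unfolding hexes by simp_all
    \<comment> \<open>Both \<open>?b\<close> and \<open>?c\<close> have
      \<open>(p - 1, q - 1)\<close> as their left hexagon, and their right hexagons lie one column
      further left, where the induction hypothesis applies.\<close>
    ultimately have "root (p, q - 1) = root (p - 1, q)"
      using less.hyps[of ?b] less.hyps[of ?c] *(3,4) unfolding hexes by simp
    then have "root (left_hex u) = root (left_hex v)"
      using pq(2) hexes(5,6) by (auto simp: doubleton_eq_iff j_def)
    then show ?thesis using u by simp
  qed (use u in simp)
qed

abbreviation "C0 \<equiv> {(p, q) \<in> H. p + q = a}"
abbreviation "C1 \<equiv> {(p, q) \<in> H. a < p + q}"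

lemma finite_C: "finite C0" "finite C1"
  by (rule finite_subset[OF _ finite_hexagons[of a b c]], blast)+

lemma H_cases: "h \<in> H \<Longrightarrow> h \<in> C0 \<or> h \<in> C1"
  by (auto simp: hexagons_def)

lemma root_C0:
  assumes "h \<in> C0"
  shows "root h = h"
proof -
  have "column h = 0" using assms by (auto simp: column_def)
  then show ?thesis by (simp add: root_def)
qed

text \<open>Each further column is reached from the previous one along relevant edges. The step also
  supplies the equation of roots, which the statements about \<open>root\<close> use.\<close>

lemma hex_induct [consumes 1, case_names left edge]:
  assumes "h \<in> H" and left: "\<And>h. h \<in> C0 \<Longrightarrow> P h"
    and edge: "\<And>v. v \<in> Rel \<Longrightarrow> root (right_hex v) = root (left_hex v) \<Longrightarrow> P (left_hex v) \<Longrightarrow> P (right_hex v)"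
  shows "P h"
  using assms(1)
proof (induction "column h" arbitrary: h rule: less_induct)
  case less
  show ?case
  proof (cases "h \<in> C0")
    case False
    then have "h \<in> right_hex ` Rel" using H_cases[OF less.prems] unfolding right_hex_surj by blast
    then obtain v where v: "v \<in> Rel" "right_hex v = h" by blast
    have "P (left_hex v)"
      using less.hyps[of "left_hex v"] column_left[OF v(1)] left_right_hex(2)[OF v(1)] v(2) by simp
    then show ?thesis using edge[OF v(1) root_edge[OF v(1)]] v(2) by simp
  qed (rule left)
qed

lemma root_in_C0: "h \<in> H \<Longrightarrow> root h \<in> C0"
proof (induction rule: hex_induct)
  case (left h)
  then show ?case using root_C0[OF left] by simp
qed simp

lemma edge_constant_iff:
  "(\<forall>v\<in>Rel. f (hex_above a v) = f (hex_below a v)) \<longleftrightarrow> (\<forall>v\<in>Rel. f (left_hex v) = f (right_hex v))"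
proof (intro ball_cong refl)
  fix v assume "v \<in> Rel"
  from left_right_hex(5)[OF this] show "f (hex_above a v) = f (hex_below a v) \<longleftrightarrow> f (left_hex v) = f (right_hex v)"
    by (auto simp: doubleton_eq_iff)
qed

lemma edge_constant_root:
  assumes "\<forall>v\<in>Rel. f (hex_above a v) = f (hex_below a v)" "h \<in> H"
  shows "f h = f (root h)"
  using assms(2)
proof (induction rule: hex_induct)
  case (left h)
  then show ?case using root_C0[OF left] by simp
next
  case (edge v)
  then show ?case using assms(1) unfolding edge_constant_iff by simp
qed

lemma regions_constant_iff:
  "(\<forall>R\<in>regions a b c S. \<forall>h\<in>R. \<forall>h'\<in>R. f h = f h') \<longleftrightarrow> (\<forall>v\<in>Rel. f (hex_above a v) = f (hex_below a v))"
proof (intro iffI ballI)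
  fix v assume *: "\<forall>R\<in>regions a b c S. \<forall>h\<in>R. \<forall>h'\<in>R. f h = f h'" and v: "v \<in> Rel"
  let ?R = "(adjacent a b c S)\<^sup>* `` {hex_above a v}"
  have "hex_above a v \<in> H" using left_right_hex(1,2,5)[OF v] by (auto simp: doubleton_eq_iff)
  then have "?R \<in> regions a b c S" unfolding regions_def by (rule quotientI)
  moreover have "hex_above a v \<in> ?R" by simp
  moreover have "(hex_above a v, hex_below a v) \<in> adjacent a b c S" using v by (auto simp: adjacent_def)
  then have "hex_below a v \<in> ?R" by auto
  ultimately show "f (hex_above a v) = f (hex_below a v)" using * by blast
next
  fix R h h' assume *: "\<forall>v\<in>Rel. f (hex_above a v) = f (hex_below a v)" and R: "R \<in> regions a b c S" "h \<in> R" "h' \<in> R"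
  obtain x where x: "R = (adjacent a b c S)\<^sup>* `` {x}" using R(1) unfolding regions_def by (auto elim: quotientE)
  have "f y = f x" if "(x, y) \<in> (adjacent a b c S)\<^sup>*" for y
    using that
  proof (induction rule: rtrancl_induct)
    case (step y z)
    then show ?case using * by (auto simp: adjacent_def)
  qed simp
  then have "f h = f x" "f h' = f x" using R(2,3) x by blast+
  then show "f h = f h'" by simp
qed

end

context plane_partition
begin

section \<open>The lattice of degrees\<close>

lemma finite_all_vars: "finite (all_vars a b c)"
proof -
  have "all_vars a b c = (\<lambda>(i, j). BVar i j) ` ({1..a + b} \<times> {1..b + c}) \<union>
      (\<lambda>(j, k). CVar j k) ` ({1..b + c} \<times> {1..a + c}) \<union> (\<lambda>(i, k). StarVar i k) ` ({1..a + b} \<times> {1..a + c})"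
    by (auto simp: all_vars_def)
  then show ?thesis by simp
qed

lemma relevant_sub: "Rel \<subseteq> all_vars a b c"
  by (auto simp: relevant_vars_def all_vars_def)

lemma finite_relevant: "finite Rel"
  using relevant_sub finite_all_vars by (rule finite_subset)

definition dot :: "(nat \<times> nat \<Rightarrow>\<^sub>0 int) \<Rightarrow> (nat \<times> nat \<Rightarrow>\<^sub>0 int) \<Rightarrow> int" where
  "dot f g = (\<Sum>h\<in>H. Poly_Mapping.lookup f h * Poly_Mapping.lookup g h)"

lemma dot_frag_of: "h \<in> H \<Longrightarrow> dot f (frag_of h) = Poly_Mapping.lookup f h"
  using finite_hexagons[of a b c] by (simp add: dot_def if_distrib sum.delta cong: if_cong)

lemma dot_diff: "dot f (g - g') = dot f g - dot f g'"
  by (simp add: dot_def lookup_minus right_diff_distrib sum_subtractf)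

lemma dot_sum: "dot f (\<Sum>v\<in>A. frag_cmul (x v) (g v)) = (\<Sum>v\<in>A. x v * dot f (g v))"
  unfolding dot_def lookup_sum sum_distrib_left
  by (subst sum.swap) (simp add: mult_ac)

lemma dot_edge:
  assumes "v \<in> Rel"
  shows "dot f (edge_degree a v) = Poly_Mapping.lookup f (hex_above a v) - Poly_Mapping.lookup f (hex_below a v)"
proof -
  have "hex_above a v \<in> H" "hex_below a v \<in> H"
    using left_right_hex(1,2,5)[OF assms] by (auto simp: doubleton_eq_iff)
  then show ?thesis by (simp add: edge_degree_def dot_diff dot_frag_of)
qed

definition monomial_degrees :: "(nat \<times> nat \<Rightarrow>\<^sub>0 int) set" where
  "monomial_degrees = mon_degree a ` {m. Poly_Mapping.keys m \<subseteq> Rel}"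

lemma edge_degree_in: "v \<in> Rel \<Longrightarrow> edge_degree a v \<in> monomial_degrees"
  unfolding monomial_degrees_def
  by (intro image_eqI[of _ _ "Poly_Mapping.single v 1"]) (auto simp: mon_degree_def)

text \<open>The product of \<open>f\<close> with the degree of an edge is the difference of the
  values of \<open>f\<close> on its two sides, and degrees of edges generate all the others.\<close>

lemma orthogonal_iff:
  "(\<forall>g\<in>monomial_degrees. dot f g = 0) \<longleftrightarrow>
   (\<forall>v\<in>Rel. Poly_Mapping.lookup f (hex_above a v) = Poly_Mapping.lookup f (hex_below a v))"
proof (intro iffI ballI)
  fix v assume "\<forall>g\<in>monomial_degrees. dot f g = 0" "v \<in> Rel"
  then show "Poly_Mapping.lookup f (hex_above a v) = Poly_Mapping.lookup f (hex_below a v)"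
    using edge_degree_in dot_edge by fastforce
next
  fix g assume *: "\<forall>v\<in>Rel. Poly_Mapping.lookup f (hex_above a v) = Poly_Mapping.lookup f (hex_below a v)"
    and "g \<in> monomial_degrees"
  then obtain m where m: "g = mon_degree a m" "Poly_Mapping.keys m \<subseteq> Rel"
    by (auto simp: monomial_degrees_def)
  have "dot f (edge_degree a v) = 0" if "v \<in> Poly_Mapping.keys m" for v
    using * m(2) that dot_edge[of v f] by auto
  then show "dot f g = 0" unfolding m(1) mon_degree_def dot_sum by simp
qed

text \<open>For \<open>r\<close> in the leftmost column, these indicator functions restrict to the
  standard basis on that column.\<close>

definition root_indicator :: "nat \<times> nat \<Rightarrow> nat \<times> nat \<Rightarrow>\<^sub>0 int" where
  "root_indicator r = (\<Sum>h | h \<in> H \<and> root h = r. frag_of h)"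

lemma lookup_root_indicator:
  "Poly_Mapping.lookup (root_indicator r) h = (if h \<in> H \<and> root h = r then 1 else 0)"
  unfolding root_indicator_def lookup_sum
  using finite_hexagons[of a b c] by (simp add: sum.delta)

lemma root_indicator_lattice: "root_indicator r \<in> hex_lattice a b c"
  by (auto simp: hex_lattice_def in_keys_iff lookup_root_indicator split: if_splits)

lemma root_indicator_edge:
  assumes "v \<in> Rel"
  shows "Poly_Mapping.lookup (root_indicator r) (hex_above a v) = Poly_Mapping.lookup (root_indicator r) (hex_below a v)"
  using root_edge[OF assms] left_right_hex(1,2,5)[OF assms]
  by (auto simp: lookup_root_indicator doubleton_eq_iff)

text \<open>An orthogonal function is determined by its values in the leftmost column, by
  \<open>edge_constant_root\<close>, and the indicators of the roots show that these values are
  independent.\<close>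

lemma rank_orthogonal:
  "rank {f \<in> hex_lattice a b c. \<forall>g\<in>monomial_degrees. dot f g = 0} = enat (a + 1)" (is "rank ?G = _")
proof (rule antisym)
  have G: "?G = {f \<in> hex_lattice a b c. \<forall>v\<in>Rel. Poly_Mapping.lookup f (hex_above a v) = Poly_Mapping.lookup f (hex_below a v)}"
    unfolding orthogonal_iff ..
  have "rank ?G \<le> enat (card C0)"
  proof (rule rank_le[OF finite_C(1)])
    fix Q x assume Q: "finite Q" "Q \<subseteq> ?G"
      and 0: "\<And>y. y \<in> C0 \<Longrightarrow> Poly_Mapping.lookup (\<Sum>q\<in>Q. frag_cmul (x q) q) y = 0"
    let ?f = "\<Sum>q\<in>Q. frag_cmul (x q) q"
    show "?f = 0"
    proof (rule poly_mapping_eqI)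
      fix h
      show "Poly_Mapping.lookup ?f h = Poly_Mapping.lookup 0 h"
      proof (cases "h \<in> H")
        case True
        have "Poly_Mapping.lookup q h = Poly_Mapping.lookup q (root h)" if "q \<in> Q" for q
          using Q(2) that unfolding G by (intro edge_constant_root True) auto
        then have "Poly_Mapping.lookup ?f h = Poly_Mapping.lookup ?f (root h)" by (simp add: lookup_sum)
        then show ?thesis using 0[OF root_in_C0[OF True]] by simp
      next
        case False
        have "Poly_Mapping.lookup q h = 0" if "q \<in> Q" for q
        proof -
          have "h \<notin> Poly_Mapping.keys q" using Q(2) that False unfolding hex_lattice_def by blast
          then show ?thesis by (simp add: in_keys_iff)
        qed
        then show ?thesis by (simp add: lookup_sum)
      qed
    qed
  qed
  then show "rank ?G \<le> enat (a + 1)" by (simp only: card_left_column)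
  have "enat (card C0) \<le> rank ?G"
  proof (rule rank_ge[OF finite_C(1), where g = root_indicator and col = "\<lambda>_. 0"])
    show "root_indicator ` C0 \<subseteq> ?G"
      unfolding G using root_indicator_edge root_indicator_lattice by blast
    show "Poly_Mapping.lookup (root_indicator h) h \<noteq> 0" if "h \<in> C0" for h
      using that root_C0[OF that] by (auto simp: lookup_root_indicator)
    show "Poly_Mapping.lookup (root_indicator h) h' = 0" if "h' \<in> C0" "h' \<noteq> h" for h h'
      using that root_C0[OF that(1)] by (auto simp: lookup_root_indicator)
  qed
  then show "enat (a + 1) \<le> rank ?G" by (simp only: card_left_column)
qed

text \<open>The coefficients over the hexagons with a common root sum to zero. This subspace
  contains all degrees, and in it the coefficients in the leftmost column are determined by the
  others, whence the upper bound for the rank.\<close>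

definition balanced :: "(nat \<times> nat \<Rightarrow>\<^sub>0 int) set" where
  "balanced = {f \<in> hex_lattice a b c. \<forall>r. dot (root_indicator r) f = 0}"

lemma dot_add: "dot f (g + g') = dot f g + dot f g'"
  by (simp add: dot_def lookup_add distrib_left sum.distrib)

lemma dot_cmul: "dot f (frag_cmul k g) = k * dot f g"
  by (simp add: dot_def sum_distrib_left mult_ac)

lemma subspace_balanced: "frag.subspace balanced"
proof (rule frag.subspaceI)
  show "0 \<in> balanced" by (simp add: balanced_def hex_lattice_def dot_def)
next
  fix f g assume "f \<in> balanced" "g \<in> balanced"
  then show "f + g \<in> balanced"
    using keys_add[of f g] by (auto simp: balanced_def hex_lattice_def dot_add)
next
  fix k f assume "f \<in> balanced"
  then show "frag_cmul k f \<in> balanced"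
    using keys_cmul[of k f] by (auto simp: balanced_def hex_lattice_def dot_cmul)
qed

lemma span_degrees_balanced: "frag.span monomial_degrees \<subseteq> balanced"
proof (rule frag.span_minimal[OF _ subspace_balanced])
  have edge: "edge_degree a v \<in> balanced" if v: "v \<in> Rel" for v
  proof -
    have "hex_above a v \<in> H" "hex_below a v \<in> H"
      using left_right_hex(1,2,5)[OF v] by (auto simp: doubleton_eq_iff)
    then have "Poly_Mapping.keys (edge_degree a v) \<subseteq> H"
      unfolding edge_degree_def using keys_diff[of "frag_of (hex_above a v)" "frag_of (hex_below a v)"]
      by (auto simp: keys_frag_of)
    then show ?thesis using root_indicator_edge[OF v] by (simp add: balanced_def hex_lattice_def dot_edge[OF v])
  qed
  show "monomial_degrees \<subseteq> balanced"
  proof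
    fix g assume "g \<in> monomial_degrees"
    then obtain m where m: "g = mon_degree a m" "Poly_Mapping.keys m \<subseteq> Rel"
      by (auto simp: monomial_degrees_def)
    show "g \<in> balanced" unfolding m(1) mon_degree_def
      using m(2) edge by (intro frag.subspace_sum[OF subspace_balanced] frag.subspace_scale[OF subspace_balanced]) auto
  qed
qed

lemma balanced_eq_0:
  assumes f: "f \<in> balanced" and 0: "\<And>h. h \<in> C1 \<Longrightarrow> Poly_Mapping.lookup f h = 0"
  shows "f = 0"
proof (rule poly_mapping_eqI)
  fix h
  show "Poly_Mapping.lookup f h = Poly_Mapping.lookup 0 h"
  proof (cases "h \<in> C0")
    case True
    have "0 = (\<Sum>h'\<in>H. Poly_Mapping.lookup (root_indicator h) h' * Poly_Mapping.lookup f h')"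
    proof -
      have "dot (root_indicator h) f = 0" using f unfolding balanced_def by blast
      then show ?thesis unfolding dot_def by simp
    qed
    \<comment> \<open>In the leftmost column only \<open>h\<close> has root \<open>h\<close>, and in
      the other columns \<open>f\<close> vanishes.\<close>
    also have "\<dots> = (\<Sum>h'\<in>{h}. Poly_Mapping.lookup (root_indicator h) h' * Poly_Mapping.lookup f h')"
    proof (rule sum.mono_neutral_right[OF finite_hexagons])
      show "{h} \<subseteq> H" using True by auto
      show "\<forall>h'\<in>H - {h}. Poly_Mapping.lookup (root_indicator h) h' * Poly_Mapping.lookup f h' = 0"
      proof
        fix h' assume h': "h' \<in> H - {h}"
        show "Poly_Mapping.lookup (root_indicator h) h' * Poly_Mapping.lookup f h' = 0"
        proof (cases "h' \<in> C0")
          case True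
          then show ?thesis using h' root_C0[OF True] by (simp add: lookup_root_indicator)
        next
          case False
          then have "h' \<in> C1" using H_cases[of h'] h' by blast
          then show ?thesis using 0[of h'] by simp
        qed
      qed
    qed
    also have "\<dots> = Poly_Mapping.lookup f h"
      using True root_C0[OF True] by (auto simp: lookup_root_indicator)
    finally show ?thesis by simp
  next
    case F: False
    show ?thesis
    proof (cases "h \<in> H")
      case True
      then have "h \<in> C1" using H_cases[of h] F by blast
      then show ?thesis using 0[of h] by simp
    next
      case False
      then have "h \<notin> Poly_Mapping.keys f" using f by (auto simp: balanced_def hex_lattice_def)
      then show ?thesis by (simp add: in_keys_iff)
    qed
  qed
qed

text \<open>One edge \<open>e h\<close> on the left of each hexagon in \<open>C1\<close> gives
  degrees that are triangular with respect to \<open>column\<close>. The upper bound comes from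
  \<open>balanced_eq_0\<close>.\<close>

lemma rank_span_degrees: "rank (frag.span monomial_degrees) = enat (card C1)"
proof (rule antisym)
  show "rank (frag.span monomial_degrees) \<le> enat (card C1)"
  proof (rule rank_le[OF finite_C(2)])
    fix Q x assume Q: "finite Q" "Q \<subseteq> frag.span monomial_degrees"
      and 0: "\<And>y. y \<in> C1 \<Longrightarrow> Poly_Mapping.lookup (\<Sum>q\<in>Q. frag_cmul (x q) q) y = 0"
    have "(\<Sum>q\<in>Q. frag_cmul (x q) q) \<in> balanced"
      by (intro frag.subspace_sum[OF subspace_balanced] frag.subspace_scale[OF subspace_balanced]
          subsetD[OF span_degrees_balanced] subsetD[OF Q(2)])
    then show "(\<Sum>q\<in>Q. frag_cmul (x q) q) = 0" using 0 by (rule balanced_eq_0)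
  qed
  have "\<forall>h\<in>C1. \<exists>v. v \<in> Rel \<and> right_hex v = h" unfolding right_hex_surj[symmetric] by blast
  from bchoice[OF this] obtain e where e0: "\<forall>h\<in>C1. e h \<in> Rel \<and> right_hex (e h) = h" ..
  note e = bspec[OF e0]
  show "enat (card C1) \<le> rank (frag.span monomial_degrees)"
  proof (rule rank_ge[OF finite_C(2), where g = "\<lambda>h. edge_degree a (e h)" and col = column])
    show "(\<lambda>h. edge_degree a (e h)) ` C1 \<subseteq> frag.span monomial_degrees"
      by (rule image_subsetI) (intro frag.span_base edge_degree_in conjunct1[OF e])
    fix h assume h: "h \<in> C1"
    note eh = e[OF h, THEN conjunct1] e[OF h, THEN conjunct2]
    have ne: "left_hex (e h) \<noteq> h" using left_right_hex(3)[OF eh(1)] eh(2) by auto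
    show "Poly_Mapping.lookup (edge_degree a (e h)) h \<noteq> 0"
      using left_right_hex(4)[OF eh(1)] eh(2) ne by (auto simp: lookup_minus)
    fix h' assume h': "h' \<noteq> h" "column h \<le> column h'"
    then have "left_hex (e h) \<noteq> h'" using column_left[OF eh(1)] eh(2) by auto
    then show "Poly_Mapping.lookup (edge_degree a (e h)) h' = 0"
      using left_right_hex(4)[OF eh(1)] eh(2) h'(1) by (auto simp: lookup_minus)
  qed
qed

end

lemma image_pairs: "f ` T = {f (i, k) |i k. (i, k) \<in> T}"
  by auto

context plane_partition
begin

section \<open>The algebras\<close>

text \<open>Two instances with the same weights follow: all variables and relevant ones only. In the
  first, the surviving variables include the free ones.\<close>

interpretation A: toric "all_vars a b c" edge_weight edge_sign edge_coord column "typeBC a b c S"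
    "\<lambda>(p, q). BVar p (p + q - a)" "\<lambda>(p, q). CVar (p + q - a) q"
    "\<lambda>(p, q). BVar p (p + q - a - 1)" "\<lambda>(p, q). CVar (p + q - a - 1) q"
    "{v \<in> all_vars a b c. edge_sign v \<noteq> 0}"
  by (rule toric_edges[OF finite_all_vars relevant_sub]) simp

interpretation A': toric Rel edge_weight edge_sign edge_coord column "typeBC a b c S"
    "\<lambda>(p, q). BVar p (p + q - a)" "\<lambda>(p, q). CVar (p + q - a) q"
    "\<lambda>(p, q). BVar p (p + q - a - 1)" "\<lambda>(p, q). CVar (p + q - a - 1) q"
    "{v \<in> Rel. edge_sign v \<noteq> 0}"
  by (rule toric_edges[OF finite_relevant order_refl]) simp

abbreviation "\<Phi> \<equiv> toric_map edge_weight edge_sign"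
abbreviation "W \<equiv> {v \<in> all_vars a b c. edge_sign v \<noteq> 0}"
abbreviation "MA \<equiv> monoid_algebra (weight_monoid edge_weight W)"
abbreviation "MA' \<equiv> monoid_algebra (weight_monoid edge_weight Rel)"
abbreviation "PA \<equiv> poly_ring (all_vars a b c)"

lemma relevant_W: "{v \<in> Rel. edge_sign v \<noteq> 0} = Rel"
  using edge_sign_relevant by auto

text \<open>By \<open>pos_bounds\<close> the dimers of \<open>S\<close> have coordinates within the
  ranges of the variables, so the killed variables match the first two families of
  relations.\<close>

lemma edge_sign_eq_0:
  "{v \<in> all_vars a b c. edge_sign v = 0} =
   {BVar i j |i j. (i, j) \<in> typeB a b c S} \<union> {CVar j k |j k. (j, k) \<in> typeC a b c S}"
proof (intro equalityI subsetI)
  fix v assume v: "v \<in> {v \<in> all_vars a b c. edge_sign v = 0}"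
  then show "v \<in> {BVar i j |i j. (i, j) \<in> typeB a b c S} \<union> {CVar j k |j k. (j, k) \<in> typeC a b c S}"
    by (cases v) (auto simp: edge_sign_def split: if_splits)
next
  fix v assume "v \<in> {BVar i j |i j. (i, j) \<in> typeB a b c S} \<union> {CVar j k |j k. (j, k) \<in> typeC a b c S}"
  then consider i j where "v = BVar i j" "(i, j) \<in> typeB a b c S" | j k where "v = CVar j k" "(j, k) \<in> typeC a b c S"
    by blast
  then show "v \<in> {v \<in> all_vars a b c. edge_sign v = 0}"
  proof cases
    case (1 i j)
    then obtain l where l: "l \<in> {1..a}" "j \<in> {1..b + c}" "i = pos l j" unfolding typeB_iff by blast
    then have "i \<in> {1..a + b}" using pos_bounds(1,2)[of l j] by auto
    then show ?thesis using 1 l by (auto simp: all_vars_def edge_sign_def)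
  next
    case (2 j k)
    then obtain l where l: "l \<in> {1..a}" "j \<in> S l" "k + pos l j = a + j" unfolding typeC_iff by blast
    have j: "j \<in> {1..b + c}" using S_l(1)[OF l(1)] l(2) by blast
    then have "k \<in> {1..a + c}" using pos_bounds(3,4)[of l j] l by auto
    then show ?thesis using 2 j by (auto simp: all_vars_def edge_sign_def)
  qed
qed

lemma A_relations_eq: "A_relations a b c S = A.gens"
proof -
  have "all_vars a b c - W = {v \<in> all_vars a b c. edge_sign v = 0}" by blast
  then have 1: "var ` (all_vars a b c - W) =
      {var (BVar i j) |i j. (i, j) \<in> typeB a b c S} \<union> {var (CVar j k) |j k. (j, k) \<in> typeC a b c S}"
    unfolding edge_sign_eq_0 by (simp only: image_Un) (rule arg_cong2[of _ _ _ _ "(\<union>)"]; blast)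
  have 2: "A.rel ` typeBC a b c S = {var (BVar i (i + k - a - 1)) * var (CVar (i + k - a - 1) k) +
        var (BVar i (i + k - a)) * var (CVar (i + k - a) k) |i k. (i, k) \<in> typeBC a b c S}"
    unfolding image_pairs[of A.rel] A.rel_def prod.case ..
  show ?thesis unfolding A_relations_def A.gens_def 1 2 ..
qed

lemma A_ideal_eq: "A_ideal a b c S = a_kernel PA MA \<Phi>"
  unfolding A_ideal_def A_relations_eq A.kernel_eq ..

interpretation PA: cring PA by (rule cring_poly_ring)

interpretation MA: domain MA
  by (rule domain_monoid_algebra[OF submonoid_weight_monoid])

interpretation MA': domain MA'
  by (rule domain_monoid_algebra[OF submonoid_weight_monoid])

interpretation hom: ring_hom_ring PA MA \<Phi>
  by (rule ring_hom_ringI2[OF PA.ring_axioms MA.ring_axioms toric_map_hom])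

text \<open>The map that \<open>\<Phi>\<close> induces on cosets of its kernel; the image of a coset
  has a single element.\<close>

definition A_iso :: "((edge \<Rightarrow>\<^sub>0 nat) \<Rightarrow>\<^sub>0 complex) set \<Rightarrow> ((nat \<times> nat) \<Rightarrow>\<^sub>0 int) \<Rightarrow>\<^sub>0 complex" where
  "A_iso X = the_elem (\<Phi> ` X)"

interpretation A: cring "A_ring a b c S"
  unfolding A_ring_def A_ideal_eq by (rule ideal.quotient_is_cring[OF hom.kernel_is_ideal PA.is_cring])

interpretation cls: ring_hom_ring PA "A_ring a b c S" "cls a b c S"
proof -
  have "cls a b c S = (+>\<^bsub>PA\<^esub>) (A_ideal a b c S)" by (rule ext) (simp add: cls_def)
  then show "ring_hom_ring PA (A_ring a b c S) (cls a b c S)"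
    unfolding A_ring_def A_ideal_eq by (simp only: ideal.rcos_ring_hom_ring[OF hom.kernel_is_ideal])
qed

lemma A_iso_ring_iso: "A_iso \<in> ring_iso (A_ring a b c S) MA"
  using hom.FactRing_iso_set[OF A.toric_map_surj]
  unfolding A_ring_def A_ideal_eq A_iso_def[abs_def] .

lemma A_iso_cls: "p \<in> carrier PA \<Longrightarrow> A_iso (cls a b c S p) = \<Phi> p"
  unfolding A_iso_def cls_def A_ideal_eq by (rule hom.the_elem_simp)

lemma A_presented: "p \<in> carrier PA \<Longrightarrow> cls a b c S p \<in> carrier (A_ring a b c S) \<and> A_iso (cls a b c S p) = \<Phi> p"
  using A_iso_cls cls.hom_closed by blast

lemma poly_ring_relevant_sub: "carrier (poly_ring Rel) \<subseteq> carrier PA"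
  using relevant_sub by auto

lemma const_in: "const z \<in> carrier (poly_ring V)"
  unfolding const_def by (rule single_in_poly_ring) simp

lemma var_in: "v \<in> V \<Longrightarrow> var v \<in> carrier (poly_ring V)"
  unfolding var_def by (rule single_in_poly_ring) auto

lemma subring_poly_ring_relevant: "subring (carrier (poly_ring Rel)) PA"
proof (rule PA.subringI[OF poly_ring_relevant_sub])
  interpret P: cring "poly_ring Rel" by (rule cring_poly_ring)
  show "\<one>\<^bsub>PA\<^esub> \<in> carrier (poly_ring Rel)" using P.one_closed by simp
  fix p assume p: "p \<in> carrier (poly_ring Rel)"
  have "\<ominus>\<^bsub>poly_ring Rel\<^esub> p \<oplus>\<^bsub>poly_ring Rel\<^esub> p = \<zero>\<^bsub>poly_ring Rel\<^esub>" by (rule P.l_neg[OF p])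
  then have "\<ominus>\<^bsub>PA\<^esub> p = \<ominus>\<^bsub>poly_ring Rel\<^esub> p"
    using P.a_inv_closed[OF p] p poly_ring_relevant_sub
    by (intro PA.minus_equality) (simp_all del: poly_ring_simps(1), blast+)
  then show "\<ominus>\<^bsub>PA\<^esub> p \<in> carrier (poly_ring Rel)" using P.a_inv_closed[OF p] by simp
next
  interpret P: cring "poly_ring Rel" by (rule cring_poly_ring)
  fix p q assume "p \<in> carrier (poly_ring Rel)" "q \<in> carrier (poly_ring Rel)"
  from P.m_closed[OF this] P.a_closed[OF this]
  show "p \<otimes>\<^bsub>PA\<^esub> q \<in> carrier (poly_ring Rel)" "p \<oplus>\<^bsub>PA\<^esub> q \<in> carrier (poly_ring Rel)" by simp_all
qed

abbreviation "gens' \<equiv> cls a b c S ` (range const \<union> var ` Rel)"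

lemma gens'_carrier: "gens' \<subseteq> carrier (A_ring a b c S)"
proof (rule image_subsetI)
  fix p assume "p \<in> range const \<union> var ` Rel"
  then consider z where "p = const z" | v where "v \<in> Rel" "p = var v" by blast
  then have "p \<in> carrier PA"
  proof cases
    case (1 z)
    then show ?thesis by (simp only: const_in)
  next
    case (2 v)
    then show ?thesis using var_in[OF subsetD[OF relevant_sub 2(1)]] by (simp only:)
  qed
  then show "cls a b c S p \<in> carrier (A_ring a b c S)" by (rule cls.hom_closed)
qed

lemma cls_monomial_generated:
  "Poly_Mapping.keys m \<subseteq> Rel \<Longrightarrow> cls a b c S (Poly_Mapping.single m z) \<in> generate_ring (A_ring a b c S) gens'"
proof (induction "total_degree m" arbitrary: m)
  case 0
  then have "m = 0" by (simp add: total_degree_eq_0_iff)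
  then show ?case by (intro generate_ring.incl) (auto simp: const_def)
next
  case (Suc n)
  then have "m \<noteq> 0" by auto
  then obtain v where v: "Poly_Mapping.lookup m v > 0"
    by (metis gr0I lookup_zero poly_mapping_eqI)
  then obtain m' where m': "m = m' + Poly_Mapping.single v 1"
    using poly_mapping_minus_single by (metis One_nat_def)
  have "Poly_Mapping.keys m = insert v (Poly_Mapping.keys m')" unfolding m' by (simp add: keys_add_single)
  then have vR: "v \<in> Rel" and m'R: "Poly_Mapping.keys m' \<subseteq> Rel" using Suc.prems by auto
  have "n = total_degree m'" using Suc.hyps(2) by (simp add: m')
  from Suc.hyps(1)[OF this m'R]
  have "cls a b c S (Poly_Mapping.single m' z) \<otimes>\<^bsub>A_ring a b c S\<^esub> cls a b c S (var v) \<in> generate_ring (A_ring a b c S) gens'"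
    using vR by (intro generate_ring.eng_mult generate_ring.incl[of "cls a b c S (var v)"]) auto
  moreover have "Poly_Mapping.single m' z \<in> carrier PA" "var v \<in> carrier PA"
    using single_in_poly_ring[OF m'R] var_in[OF vR] poly_ring_relevant_sub by blast+
  then have "cls a b c S (Poly_Mapping.single m' z) \<otimes>\<^bsub>A_ring a b c S\<^esub> cls a b c S (var v) =
      cls a b c S (Poly_Mapping.single m' z \<otimes>\<^bsub>PA\<^esub> var v)" by (simp only: cls.hom_mult)
  moreover have "Poly_Mapping.single m' z \<otimes>\<^bsub>PA\<^esub> var v = Poly_Mapping.single m z"
    by (simp add: var_def mult_single m')
  ultimately show ?case by simp
qed

text \<open>This turns the generated subring into the image of a polynomial ring, the form that
  presentations require.\<close>

lemma A'_carrier: "carrier (A'_ring a b c S) = cls a b c S ` carrier (poly_ring Rel)"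
proof -
  have "generate_ring (A_ring a b c S) gens' = cls a b c S ` carrier (poly_ring Rel)"
  proof (intro equalityI)
    show "generate_ring (A_ring a b c S) gens' \<subseteq> cls a b c S ` carrier (poly_ring Rel)"
    proof (rule A.generate_ring_min_subring1[OF gens'_carrier])
      show "subring (cls a b c S ` carrier (poly_ring Rel)) (A_ring a b c S)"
        by (rule cls.img_is_subring[OF subring_poly_ring_relevant])
      show "gens' \<subseteq> cls a b c S ` carrier (poly_ring Rel)"
      proof (intro image_mono Un_least)
        show "range const \<subseteq> carrier (poly_ring Rel)" by (intro image_subsetI const_in)
        show "var ` Rel \<subseteq> carrier (poly_ring Rel)" by (intro image_subsetI var_in)
      qed
    qed
    show "cls a b c S ` carrier (poly_ring Rel) \<subseteq> generate_ring (A_ring a b c S) gens'"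
    proof (rule image_subsetI)
      fix p assume p: "p \<in> carrier (poly_ring Rel)"
      have "cls a b c S (\<Sum>m\<in>K. Poly_Mapping.single m (Poly_Mapping.lookup p m)) \<in> generate_ring (A_ring a b c S) gens'"
        if "finite K" "K \<subseteq> Poly_Mapping.keys p" for K
        using that
      proof (induction K rule: finite_induct)
        case empty
        have "cls a b c S \<zero>\<^bsub>PA\<^esub> = \<zero>\<^bsub>A_ring a b c S\<^esub>" by (rule cls.hom_zero)
        then show ?case using A.zero_in_generate[of gens'] by simp
      next
        case (insert m K)
        let ?s = "\<lambda>m. Poly_Mapping.single m (Poly_Mapping.lookup p m)"
        have k: "Poly_Mapping.keys n \<subseteq> Rel" if "n \<in> insert m K" for n
          using insert.prems that p by auto
        have "?s m \<in> carrier PA" using k relevant_sub by (intro single_in_poly_ring) blast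
        moreover have "sum ?s K \<in> carrier PA"
        proof -
          have "Poly_Mapping.keys (sum ?s K) \<subseteq> K"
            using keys_sum[of ?s K] by (auto split: if_splits)
          then show ?thesis using k relevant_sub by fastforce
        qed
        ultimately have "cls a b c S (?s m \<oplus>\<^bsub>PA\<^esub> sum ?s K) = cls a b c S (?s m) \<oplus>\<^bsub>A_ring a b c S\<^esub> cls a b c S (sum ?s K)"
          by (rule cls.hom_add)
        moreover have "cls a b c S (?s m) \<oplus>\<^bsub>A_ring a b c S\<^esub> cls a b c S (sum ?s K) \<in> generate_ring (A_ring a b c S) gens'"
          using insert k by (intro generate_ring.eng_add cls_monomial_generated) auto
        ultimately show ?case using insert.hyps by simp
      qed
      from this[OF finite_keys order_refl] show "cls a b c S p \<in> generate_ring (A_ring a b c S) gens'"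
        by (simp flip: poly_mapping_sum_single)
    qed
  qed
  then show ?thesis by (simp add: A'_ring_def)
qed

lemma A'_sub: "carrier (A'_ring a b c S) \<subseteq> carrier (A_ring a b c S)"
  unfolding A'_carrier using poly_ring_relevant_sub cls.hom_closed by blast

lemma A'_simps:
  "x \<otimes>\<^bsub>A'_ring a b c S\<^esub> y = x \<otimes>\<^bsub>A_ring a b c S\<^esub> y"
  "x \<oplus>\<^bsub>A'_ring a b c S\<^esub> y = x \<oplus>\<^bsub>A_ring a b c S\<^esub> y"
  "\<one>\<^bsub>A'_ring a b c S\<^esub> = \<one>\<^bsub>A_ring a b c S\<^esub>"
  "\<zero>\<^bsub>A'_ring a b c S\<^esub> = \<zero>\<^bsub>A_ring a b c S\<^esub>"
  by (simp_all add: A'_ring_def)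

lemma ring_A': "ring (A'_ring a b c S)"
  unfolding A'_ring_def by (rule A.generate_ring_is_ring[OF gens'_carrier])

lemma A'_presented:
  assumes "p \<in> carrier (poly_ring Rel)"
  shows "cls a b c S p \<in> carrier (A'_ring a b c S) \<and> A_iso (cls a b c S p) = \<Phi> p"
  using assms A_iso_cls poly_ring_relevant_sub unfolding A'_carrier by blast

text \<open>The isomorphism for \<open>A_ring\<close> is restricted; its image is found from the
  surjectivity of \<open>\<Phi>\<close> on the polynomials in relevant variables.\<close>

lemma A'_iso_ring_iso: "A_iso \<in> ring_iso (A'_ring a b c S) MA'"
proof (rule ring_iso_memI)
  note iso = ring_iso_memE[OF A_iso_ring_iso]
  have im: "A_iso ` carrier (A'_ring a b c S) = carrier MA'"
  proof -
    have "A_iso ` carrier (A'_ring a b c S) = \<Phi> ` carrier (poly_ring Rel)"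
      unfolding A'_carrier image_image
      using A_iso_cls poly_ring_relevant_sub by (intro image_cong) blast+
    then show ?thesis using A'.toric_map_surj unfolding relevant_W by simp
  qed
  have "inj_on A_iso (carrier (A'_ring a b c S))"
    using iso(5) A'_sub unfolding bij_betw_def by (blast intro: inj_on_subset)
  then show "bij_betw A_iso (carrier (A'_ring a b c S)) (carrier MA')"
    unfolding bij_betw_def using im by blast
  show "A_iso x \<in> carrier MA'" if "x \<in> carrier (A'_ring a b c S)" for x
    using that im by blast
  show "A_iso (x \<otimes>\<^bsub>A'_ring a b c S\<^esub> y) = A_iso x \<otimes>\<^bsub>MA'\<^esub> A_iso y"
    if "x \<in> carrier (A'_ring a b c S)" "y \<in> carrier (A'_ring a b c S)" for x y
    using iso(2)[of x y] that A'_sub unfolding A'_simps monoid_algebra_simps by blast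
  show "A_iso (x \<oplus>\<^bsub>A'_ring a b c S\<^esub> y) = A_iso x \<oplus>\<^bsub>MA'\<^esub> A_iso y"
    if "x \<in> carrier (A'_ring a b c S)" "y \<in> carrier (A'_ring a b c S)" for x y
    using iso(3)[of x y] that A'_sub unfolding A'_simps monoid_algebra_simps by blast
  show "A_iso \<one>\<^bsub>A'_ring a b c S\<^esub> = \<one>\<^bsub>MA'\<^esub>"
    using iso(4) unfolding A'_simps monoid_algebra_simps .
qed

lemma domain_A': "domain (A'_ring a b c S)"
proof -
  let ?\<psi> = "inv_into (carrier (A'_ring a b c S)) A_iso"
  interpret A'r: ring "A'_ring a b c S" by (rule ring_A')
  have iso: "?\<psi> \<in> ring_iso MA' (A'_ring a b c S)"
    by (rule ring_iso_set_sym[OF ring_A' A'_iso_ring_iso])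
  interpret h: ring_hom_ring MA' "A'_ring a b c S" ?\<psi>
    using iso by (intro ring_hom_ringI2 MA'.ring_axioms ring_A') (simp add: ring_iso_def)
  \<comment> \<open>The transported domain carries the image of the zero of \<open>MA'\<close> as
    its zero, which is the zero of the given ring.\<close>
  have "(A'_ring a b c S)\<lparr>zero := ?\<psi> \<zero>\<^bsub>MA'\<^esub>\<rparr> = A'_ring a b c S"
    using h.hom_zero by simp
  then show ?thesis using MA'.ring_iso_imp_img_domain[OF iso] by simp
qed

lemma cring_A': "cring (A'_ring a b c S)"
  using domain_A' by (rule domain.axioms(1))

lemma weight_degree_relevant: "Poly_Mapping.keys m \<subseteq> Rel \<Longrightarrow> weight_degree edge_weight m = mon_degree a m"
  unfolding weight_degree_def mon_degree_def by (intro sum.cong) (auto simp: edge_weight_def)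

lemma weight_monoid_relevant: "weight_monoid edge_weight Rel = monomial_degrees"
  unfolding weight_monoid_def monomial_degrees_def using weight_degree_relevant by (intro image_cong) auto

text \<open>Relevant variables have nonzero sign, so \<open>\<Phi>\<close> maps every monomial in
  them to a nonzero multiple of a basis element.\<close>

lemma L_S_eq: "L_S a b c S = monomial_degrees"
proof -
  have "cls a b c S (Poly_Mapping.single m 1) \<noteq> \<zero>\<^bsub>A'_ring a b c S\<^esub>" if m: "Poly_Mapping.keys m \<subseteq> Rel" for m
  proof
    assume "cls a b c S (Poly_Mapping.single m 1) = \<zero>\<^bsub>A'_ring a b c S\<^esub>"
    then have "cls a b c S (Poly_Mapping.single m 1) = cls a b c S \<zero>\<^bsub>PA\<^esub>"
      using cls.hom_zero by (simp only: A'_simps)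
    moreover have "Poly_Mapping.single m (1::complex) \<in> carrier PA"
      using m relevant_sub by (intro single_in_poly_ring) blast
    ultimately have "\<Phi> (Poly_Mapping.single m 1) = \<Phi> \<zero>\<^bsub>PA\<^esub>"
      using A_iso_cls[of "Poly_Mapping.single m 1"] A_iso_cls[OF PA.zero_closed] by simp
    then have "Poly_Mapping.single (weight_degree edge_weight m) (weight_coeff edge_sign m) = 0"
      using hom.hom_zero by (simp add: toric_map_single)
    then have "weight_coeff edge_sign m = 0" by (metis lookup_single_eq lookup_zero)
    then show False using m edge_sign_relevant by (auto simp: weight_coeff_eq_0_iff)
  qed
  then show ?thesis unfolding L_S_def monomial_degrees_def by blast
qed

lemma A_iso_graded_part:
  assumes "f \<in> L_S a b c S"
  shows "A_iso ` graded_part a b c S f = range (Poly_Mapping.single f)"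
proof -
  let ?P = "{p \<in> carrier (poly_ring Rel). \<forall>m\<in>Poly_Mapping.keys p. mon_degree a m = f}"
  have "A_iso ` graded_part a b c S f = \<Phi> ` ?P"
    unfolding graded_part_def image_image
    using A_iso_cls poly_ring_relevant_sub by (intro image_cong) blast+
  also have "\<dots> = {q. Poly_Mapping.keys q \<subseteq> weight_degree edge_weight ` {m. Poly_Mapping.keys m \<subseteq> Rel \<and> mon_degree a m = f}}"
    using A'.toric_map_image[of "\<lambda>m. mon_degree a m = f"] unfolding relevant_W .
  also have "weight_degree edge_weight ` {m. Poly_Mapping.keys m \<subseteq> Rel \<and> mon_degree a m = f} = {f}"
    using assms unfolding L_S_eq monomial_degrees_def by (auto simp: weight_degree_relevant image_iff)
  also have "{q. Poly_Mapping.keys q \<subseteq> {f}} = range (Poly_Mapping.single f :: complex \<Rightarrow> _)"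
  proof (intro equalityI subsetI)
    fix q :: "((nat \<times> nat) \<Rightarrow>\<^sub>0 int) \<Rightarrow>\<^sub>0 complex" assume q: "q \<in> {q. Poly_Mapping.keys q \<subseteq> {f}}"
    have "q = Poly_Mapping.single f (Poly_Mapping.lookup q f)"
    proof (rule poly_mapping_eqI)
      fix g
      show "Poly_Mapping.lookup q g = Poly_Mapping.lookup (Poly_Mapping.single f (Poly_Mapping.lookup q f)) g"
        using q by (cases "g = f") (auto simp: lookup_single in_keys_iff)
    qed
    then show "q \<in> range (Poly_Mapping.single f)" by blast
  qed (auto split: if_splits)
  finally show ?thesis .
qed

lemma A_iso_monoid_algebra_iso: "monoid_algebra_iso a b c S A_iso"
  unfolding monoid_algebra_iso_def
proof (intro conjI allI ballI)
  show "A_iso \<in> ring_iso (A'_ring a b c S) (monoid_algebra (L_S a b c S))"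
    using A'_iso_ring_iso unfolding L_S_eq weight_monoid_relevant .
  show "A_iso (cls a b c S (const z)) = Poly_Mapping.single 0 z" for z
    using A_iso_cls[OF const_in] by (simp add: toric_map_const)
qed (rule A_iso_graded_part)

lemma edge_coord_relevant: "edge_coord ` Rel = C1"
  unfolding right_hex_surj[symmetric] by (intro image_cong) (auto simp: edge_coord_def)

lemma A'_iso_ring_iso': "A_iso \<in> ring_iso (A'_ring a b c S) (monoid_algebra (weight_monoid edge_weight {v \<in> Rel. edge_sign v \<noteq> 0}))"
  using A'_iso_ring_iso by (simp only: relevant_W)

lemma krull_dim_A': "krull_dim (A'_ring a b c S) = enat (card C1)"
  using A'.krull_dim_presented[OF cring_A' A'_iso_ring_iso' A'_presented]
  by (simp only: relevant_W edge_coord_relevant)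

lemma complete_intersection_A':
  "complete_intersection Rel (A'_ring a b c S) (cls a b c S)"
  by (rule A'.complete_intersection_presented[OF cring_A' A'_iso_ring_iso' A'_presented])

lemma has_degree_A': "has_degree Rel (A'_ring a b c S) (cls a b c S) (2 ^ (b * c))"
  using A'.has_degree_presented[OF cring_A' A'_iso_ring_iso' A'_presented]
  unfolding card_typeBC .

lemma complete_intersection_A:
  "complete_intersection (all_vars a b c) (A_ring a b c S) (cls a b c S)"
  by (rule A.complete_intersection_presented[OF A.is_cring A_iso_ring_iso A_presented])

lemma has_degree_A: "has_degree (all_vars a b c) (A_ring a b c S) (cls a b c S) (2 ^ (b * c))"
  using A.has_degree_presented[OF A.is_cring A_iso_ring_iso A_presented] unfolding card_typeBC .

end

theorem proposition9:
  fixes a b c :: nat and S :: "nat \<Rightarrow> nat set"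
  assumes "S \<in> PP a b c"
  shows
    "rank (hex_lattice a b c) = enat (a * b + a * c + b * c + a + b + c + 1)
     \<and> (0 \<in> L_S a b c S \<and>
        (\<forall>f\<in>L_S a b c S. \<forall>g\<in>L_S a b c S. f + g \<in> L_S a b c S) \<and>
        (\<exists>\<phi>. monoid_algebra_iso a b c S \<phi>) \<and>
        domain (A'_ring a b c S) \<and>
        krull_dim (A'_ring a b c S) = rank (frag.span (L_S a b c S)))
     \<and> (\<forall>f\<in>hex_lattice a b c.
          f \<in> L_S_perp a b c S \<longleftrightarrow>
          (\<forall>R\<in>regions a b c S. \<forall>h\<in>R. \<forall>h'\<in>R. Poly_Mapping.lookup f h = Poly_Mapping.lookup f h'))
     \<and> (rank (L_S_perp a b c S) = enat (a + 1) \<and>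
        rank (frag.span (L_S a b c S)) = enat (a * b + a * c + b * c + b + c))
     \<and> (complete_intersection (relevant_vars a b c S) (A'_ring a b c S) (cls a b c S) \<and>
        has_degree (relevant_vars a b c S) (A'_ring a b c S) (cls a b c S) (2 ^ (b * c)) \<and>
        complete_intersection (all_vars a b c) (A_ring a b c S) (cls a b c S) \<and>
        has_degree (all_vars a b c) (A_ring a b c S) (cls a b c S) (2 ^ (b * c)))"
proof -
  interpret plane_partition a b c S by unfold_locales (rule assms)
  have perp: "L_S_perp a b c S = {f \<in> hex_lattice a b c. \<forall>g\<in>monomial_degrees. dot f g = 0}"
    by (simp only: L_S_perp_def L_S_eq dot_def)
  have "submonoid_add (L_S a b c S)"
    using submonoid_weight_monoid[of edge_weight "relevant_vars a b c S"] unfolding L_S_eq weight_monoid_relevant .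
  then have 2: "0 \<in> L_S a b c S" "\<forall>f\<in>L_S a b c S. \<forall>g\<in>L_S a b c S. f + g \<in> L_S a b c S"
    by (simp_all add: submonoid_add_def)
  show ?thesis
  proof (intro conjI)
    show "rank (hex_lattice a b c) = enat (a * b + a * c + b * c + a + b + c + 1)"
      unfolding rank_hex_lattice card_hexagons ..
    show "\<exists>\<phi>. monoid_algebra_iso a b c S \<phi>" by (rule exI, rule A_iso_monoid_algebra_iso)
    show "krull_dim (A'_ring a b c S) = rank (frag.span (L_S a b c S))"
      unfolding L_S_eq rank_span_degrees krull_dim_A' ..
    show "rank (L_S_perp a b c S) = enat (a + 1)" unfolding perp by (rule rank_orthogonal)
    show "rank (frag.span (L_S a b c S)) = enat (a * b + a * c + b * c + b + c)"
      unfolding L_S_eq rank_span_degrees card_right_columns ..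
    show "\<forall>f\<in>hex_lattice a b c. f \<in> L_S_perp a b c S \<longleftrightarrow>
        (\<forall>R\<in>regions a b c S. \<forall>h\<in>R. \<forall>h'\<in>R. Poly_Mapping.lookup f h = Poly_Mapping.lookup f h')"
    proof
      fix f assume "f \<in> hex_lattice a b c"
      then have "f \<in> L_S_perp a b c S \<longleftrightarrow> (\<forall>g\<in>monomial_degrees. dot f g = 0)" unfolding perp by blast
      then show "f \<in> L_S_perp a b c S \<longleftrightarrow>
          (\<forall>R\<in>regions a b c S. \<forall>h\<in>R. \<forall>h'\<in>R. Poly_Mapping.lookup f h = Poly_Mapping.lookup f h')"
        unfolding orthogonal_iff regions_constant_iff .
    qed
  qed (rule 2 domain_A' complete_intersection_A' has_degree_A' complete_intersection_A has_degree_A)+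
qed

end
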